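(* Let $t\ge 3$ be an integer and set $p(n,t)=n^{-\frac{1}{t-1}}(\ln n)^{-\frac{t-2}{t-1}}$. (1) There exists $c>0$ such that, if $p=p(n)$ satisfies $\frac{1}{n^2}\ll p<c\,p(n,t)$, then with high probability $\mathrm{wsat}(G(n,p),K_{1,t})\neq\mathrm{wsat}(K_n,K_{1,t})$. (2) There exists $C>0$ such that, if $p>C\,p(n,t)$, then with high probability $\mathrm{wsat}(G(n,p),K_{1,t})=\mathrm{wsat}(K_n,K_{1,t})$.
   Context: $K_n$ is the complete graph on $[n]$, $K_{1,t}$ the star with $t$ leaves, and $G(n,p)$ the binomial random graph on $[n]$ where each pair is an edge independently with probability $p$. A spanning subgraph $F\subset G$ is weakly $(G,H)$-saturated if there is an ordering $e_1,\dots,e_m$ of the edges of $G\setminus F$ such that for each $i$ the graph $F\cup\{e_1,\dots,e_i\}$ contains a copy of $H$ containing $e_i$; $\mathrm{wsat}(G,H)$ is the minimum number of edges in such an $F$. $\frac{1}{n^2}\ll p$ means $pn^2\to\infty$. "With high probability" means with probability tending to $1$ as $n\to\infty$. *)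

theory Defs
  imports "HOL-Probability.Probability" "HOL-Probability.Product_PMF" "HOL-Library.Ramsey"
begin

(* A graph is a pair (vertex set, edge set), an edge being a two-element set of vertices. *)
type_synonym 'a graph = "'a set \<times> 'a set set"

abbreviation verts :: "'a graph \<Rightarrow> 'a set" where "verts \<equiv> fst"
abbreviation edges :: "'a graph \<Rightarrow> 'a set set" where "edges \<equiv> snd"

definition complete_graph_on :: "nat \<Rightarrow> nat graph" where
  "complete_graph_on n = ({1..n}, nsets {1..n} 2)"

(* The centre is 0, the leaves are 1, ..., t. *)
definition star_graph :: "nat \<Rightarrow> nat graph" where
  "star_graph t = ({0..t}, {{0, i} | i. i \<in> {1..t}})"

definition subgraph :: "'a graph \<Rightarrow> 'a graph \<Rightarrow> bool" where
  "subgraph F G \<longleftrightarrow> verts F \<subseteq> verts G \<and> edges F \<subseteq> edges G"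

definition spanning_subgraph :: "'a graph \<Rightarrow> 'a graph \<Rightarrow> bool" where
  "spanning_subgraph F G \<longleftrightarrow> verts F = verts G \<and> edges F \<subseteq> edges G"

definition is_copy :: "'b graph \<Rightarrow> 'a graph \<Rightarrow> bool" where
  "is_copy H H' \<longleftrightarrow>
     (\<exists>f. inj_on f (verts H) \<and> verts H' = f ` verts H \<and> edges H' = (`) f ` edges H)"

definition contains_copy_with_edge :: "'a graph \<Rightarrow> 'b graph \<Rightarrow> 'a set \<Rightarrow> bool" where
  "contains_copy_with_edge G H e \<longleftrightarrow> (\<exists>H'. is_copy H H' \<and> subgraph H' G \<and> e \<in> edges H')"

(* The list es is the ordering of the edges of G outside F; indices start at 0. *)
definition weakly_saturated :: "'a graph \<Rightarrow> 'b graph \<Rightarrow> 'a graph \<Rightarrow> bool" where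
  "weakly_saturated G H F \<longleftrightarrow>
     spanning_subgraph F G \<and>
     (\<exists>es. distinct es \<and> set es = edges G - edges F \<and>
        (\<forall>i < length es.
           contains_copy_with_edge (verts F, edges F \<union> set (take (Suc i) es)) H (es ! i)))"

(* Intended for finite G; then F = G is weakly saturated, so the minimum exists. *)
definition wsat :: "'a graph \<Rightarrow> 'b graph \<Rightarrow> nat" where
  "wsat G H = (LEAST k. \<exists>F. weakly_saturated G H F \<and> card (edges F) = k)"

(* For p outside [0, 1], bernoulli_pmf truncates p to that interval. *)
definition random_graph :: "nat \<Rightarrow> real \<Rightarrow> nat graph pmf" where
  "random_graph n p =
     map_pmf (\<lambda>\<omega>. ({1..n}, {e \<in> edges (complete_graph_on n). \<omega> e}))
       (Pi_pmf (edges (complete_graph_on n)) False (\<lambda>_. bernoulli_pmf p))"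

definition whp :: "(nat \<Rightarrow> nat graph pmf) \<Rightarrow> (nat \<Rightarrow> nat graph \<Rightarrow> bool) \<Rightarrow> bool" where
  "whp \<G> P \<longleftrightarrow> (\<lambda>n. measure_pmf.prob (\<G> n) {G. P n G}) \<longlonglongrightarrow> 1"

definition threshold :: "nat \<Rightarrow> nat \<Rightarrow> real" where
  "threshold n t =
     real n powr (- 1 / (real t - 1)) * ln (real n) powr (- (real t - 2) / (real t - 1))"

end

theory Submission
  imports Defs "HOL-Real_Asymp.Real_Asymp"
begin

text \<open>
  Write r = t - 1. In the process started from F, a missing edge can be added exactly when one of its ends
  already has r edges. Ordering the vertices by the moment at which they
  reach degree r turns a weakly saturated F into an order in which every vertex has r edges that
  lie in F or lead to earlier vertices, and every edge outside F meets the order. Hence, for large n,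
  the value for the complete graph is (t choose 2), and G has the same value as soon as all its vertices
  can be ordered so that each has min j r neighbours among its j predecessors.

  Below the threshold: suppose that F has at most (t choose 2) edges. If the order has at least k = ln n
  vertices, its first k vertices span at least rk - O(1) edges, which a first moment computation excludes;
  if it is shorter, the complement of a set of O(ln n) vertices is independent, which is impossible for
  p at least n to the power -3/2. For smaller p there is almost surely no vertex of degree 3, so that F = G
  has too many edges.

  Above the threshold: write the random graph as a union of two independent ones. In the first one, many
  independent attempts are made to grow an ordered chain of about n to the power 1/r vertices (up to
  logarithms), the j-th of them taken from the j-th member of a family of disjoint pools. The bottleneck is
  the start, up to length m of order ln n, where an attempt survives with a probability that is a small
  negative power of n; fewer than n attempts suffice. The second graph then joins every other vertex to
  r vertices of the chain.
\<close>

section \<open>Random subsets\<close>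

text \<open>The logarithm originates at the start of the chain. If every position up to m has about
  n / m candidates, a candidate for position j has r neighbours in the chain with probability of
  order (p j)^r, so the expected number of good ones is of order n p^r m^(r - 1) (j / m)^r. When n
  p^r m^(r - 1) is a constant, the product of these expectations up to m is exp (- O(m)), and beyond
  m they grow. A small power of n can pay for this as long as m is of order ln n, which gives n p^r
  (ln n)^(r - 1) of order 1; sets of ln n vertices are also where the first moment becomes small
  below the threshold. The obstacle is dependence: every new trial must look at pairs that no
  earlier one has exposed. Hence the conditioning on traces, the disjoint pools and the removal of
  chosen vertices. Neighbours are sought one per residue class of positions instead of being
  counted, so that binomial tails become products of independent events. The second graph supplies
  pairs that are independent of the existence of the chain.\<close>

definition rsub :: "'a set \<Rightarrow> real \<Rightarrow> 'a set pmf" where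
  "rsub E p = map_pmf (\<lambda>\<omega>. {e \<in> E. \<omega> e}) (Pi_pmf E False (\<lambda>_. bernoulli_pmf p))"

lemma rsub_empty [simp]: "rsub {} p = return_pmf {}"
  by (simp add: rsub_def)

lemma set_pmf_rsub: "set_pmf (rsub E p) \<subseteq> Pow E"
  by (auto simp: rsub_def)

section \<open>Independence of events on disjoint parts of the ground set\<close>

lemma rsub_union:
  assumes "finite A" "finite B" "A \<inter> B = {}"
  shows "rsub (A \<union> B) p = map_pmf (\<lambda>(S, T). S \<union> T) (pair_pmf (rsub A p) (rsub B p))"
proof -
  have eq: "{e. (e \<in> A \<or> e \<in> B) \<and> (e \<in> A \<longrightarrow> f e) \<and> (e \<notin> A \<longrightarrow> g e)} = {e \<in> A. f e} \<union> {e \<in> B. g e}"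
    for f g using assms(3) by auto
  show ?thesis
    unfolding rsub_def Pi_pmf_union[OF assms] map_pair[symmetric] map_pmf_comp
    by (intro map_pmf_cong refl) (use assms(3) in \<open>auto simp: eq split: if_splits\<close>)
qed

lemma rsub_insert:
  assumes "finite E" "x \<notin> E"
  shows "rsub (insert x E) p =
    bind_pmf (bernoulli_pmf p) (\<lambda>b. map_pmf (\<lambda>S. if b then insert x S else S) (rsub E p))"
proof -
  have "{e. (e = x \<or> e \<in> E) \<and> (f(x := b)) e} = (if b then insert x {e \<in> E. f e} else {e \<in> E. f e})"
    for f b using assms(2) by auto
  then show ?thesis
    unfolding rsub_def using assms
    by (simp add: Pi_pmf_insert' map_bind_pmf map_pmf_comp map_pmf_def[symmetric] o_def)
qed

text \<open>The ground set is cut into \<open>E \<inter> D\<close> and \<open>E - D\<close>, over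
  which the random set is a product. Since D' misses D, the event Q' is decided by the second part
  alone.\<close>

lemma prob_rsub_indep:
  assumes "finite E" "D \<inter> D' = {}"
    and Q: "\<And>S. S \<subseteq> E \<Longrightarrow> Q S \<longleftrightarrow> Q (S \<inter> D)" and Q': "\<And>S. S \<subseteq> E \<Longrightarrow> Q' S \<longleftrightarrow> Q' (S \<inter> D')"
  shows "measure_pmf.prob (rsub E p) {S. Q S \<and> Q' S} =
    measure_pmf.prob (rsub E p) {S. Q S} * measure_pmf.prob (rsub E p) {S. Q' S}"
proof -
  let ?A = "E \<inter> D" and ?B = "E - D"
  have split: "rsub E p = map_pmf (\<lambda>(S, T). S \<union> T) (pair_pmf (rsub ?A p) (rsub ?B p))"
    using rsub_union[of ?A ?B p] assms(1) by (simp add: Int_Diff_Un Int_Diff_disjoint)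
  have set: "set_pmf (pair_pmf (rsub ?A p) (rsub ?B p)) \<subseteq> Pow ?A \<times> Pow ?B"
    using set_pmf_rsub by fastforce
  \<comment> \<open>This general product form serves three times: for the conjunction, and with a
    constantly true factor for each of the two events.\<close>
  have split_prob: "measure_pmf.prob (rsub E p) {S. P S} =
      measure_pmf.prob (rsub ?A p) {S. R S} * measure_pmf.prob (rsub ?B p) {S. R' S}"
    if P: "\<And>S T. S \<subseteq> ?A \<Longrightarrow> T \<subseteq> ?B \<Longrightarrow> P (S \<union> T) \<longleftrightarrow> R S \<and> R' T" for P R R'
  proof -
    \<comment> \<open>Restricting the events to subsets of the two parts makes them finite, hence
      countable, as the product rule demands.\<close>
    let ?X = "{S. S \<subseteq> ?A \<and> R S}" and ?Y = "{S. S \<subseteq> ?B \<and> R' S}"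
    have fin: "finite ?X" "finite ?Y"
      by (rule finite_subset[of _ "Pow E"]; use assms(1) in auto)+
    have "measure_pmf.prob (rsub E p) {S. P S} =
        measure_pmf.prob (pair_pmf (rsub ?A p) (rsub ?B p)) ((\<lambda>(S, T). S \<union> T) -` {S. P S})"
      by (simp add: split)
    also have "\<dots> = measure_pmf.prob (pair_pmf (rsub ?A p) (rsub ?B p)) (?X \<times> ?Y)"
      using set P by (intro measure_prob_cong_0) (auto simp: set_pmf_iff[symmetric] pmf_eq_0_set_pmf)
    also have "\<dots> = measure_pmf.prob (rsub ?A p) ?X * measure_pmf.prob (rsub ?B p) ?Y"
      using fin by (intro measure_pmf_prob_product countable_finite)
    also have "measure_pmf.prob (rsub ?A p) ?X = measure_pmf.prob (rsub ?A p) {S. R S}"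
      using set_pmf_rsub[of ?A p] by (intro measure_prob_cong_0) (auto simp: pmf_eq_0_set_pmf)
    also have "measure_pmf.prob (rsub ?B p) ?Y = measure_pmf.prob (rsub ?B p) {S. R' S}"
      using set_pmf_rsub[of ?B p] by (intro measure_prob_cong_0) (auto simp: pmf_eq_0_set_pmf)
    finally show ?thesis .
  qed
  have Q1: "Q (S \<union> T) \<longleftrightarrow> Q S" if "S \<subseteq> ?A" "T \<subseteq> ?B" for S T
  proof -
    have "(S \<union> T) \<inter> D = S \<inter> D" using that by auto
    then show ?thesis using Q[of "S \<union> T"] Q[of S] that by auto
  qed
  have Q2: "Q' (S \<union> T) \<longleftrightarrow> Q' T" if "S \<subseteq> ?A" "T \<subseteq> ?B" for S T
  proof -
    have "(S \<union> T) \<inter> D' = T \<inter> D'" using that assms(2) by auto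
    then show ?thesis using Q'[of "S \<union> T"] Q'[of T] that by auto
  qed
  have "measure_pmf.prob (rsub E p) {S. Q S \<and> Q' S} =
      measure_pmf.prob (rsub ?A p) {S. Q S} * measure_pmf.prob (rsub ?B p) {S. Q' S}"
    by (rule split_prob) (simp add: Q1 Q2)
  moreover have "measure_pmf.prob (rsub E p) {S. Q S} =
      measure_pmf.prob (rsub ?A p) {S. Q S} * measure_pmf.prob (rsub ?B p) {S. True}"
    by (rule split_prob) (simp add: Q1)
  moreover have "measure_pmf.prob (rsub E p) {S. Q' S} =
      measure_pmf.prob (rsub ?A p) {S. True} * measure_pmf.prob (rsub ?B p) {S. Q' S}"
    by (rule split_prob) (simp add: Q2)
  ultimately show ?thesis by simp
qed

lemma prob_rsub_indep_family:
  assumes "finite E" "finite I" "disjoint_family_on D I"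
    and Q: "\<And>i S. i \<in> I \<Longrightarrow> S \<subseteq> E \<Longrightarrow> Q i S \<longleftrightarrow> Q i (S \<inter> D i)"
  shows "measure_pmf.prob (rsub E p) {S. \<forall>i\<in>I. Q i S} =
    (\<Prod>i\<in>I. measure_pmf.prob (rsub E p) {S. Q i S})"
  using assms(2,3,4)
proof (induction I rule: finite_induct)
  case (insert i I)
  have dj: "D i \<inter> (\<Union>j\<in>I. D j) = {}"
    using insert.prems(1) insert.hyps by (auto simp: disjoint_family_on_def)
  have Q2: "(\<forall>j\<in>I. Q j S) \<longleftrightarrow> (\<forall>j\<in>I. Q j (S \<inter> (\<Union>j\<in>I. D j)))" if "S \<subseteq> E" for S
  proof (intro ball_cong refl)
    fix j assume j: "j \<in> I"
    have "S \<inter> (\<Union>j\<in>I. D j) \<inter> D j = S \<inter> D j" using j by auto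
    then show "Q j S \<longleftrightarrow> Q j (S \<inter> (\<Union>j\<in>I. D j))"
      using insert.prems(2)[of j S] insert.prems(2)[of j "S \<inter> (\<Union>j\<in>I. D j)"] that j by auto
  qed
  have "measure_pmf.prob (rsub E p) {S. \<forall>j\<in>insert i I. Q j S} =
      measure_pmf.prob (rsub E p) {S. Q i S \<and> (\<forall>j\<in>I. Q j S)}"
    by simp
  also have "\<dots> = measure_pmf.prob (rsub E p) {S. Q i S} *
      measure_pmf.prob (rsub E p) {S. \<forall>j\<in>I. Q j S}"
    by (rule prob_rsub_indep[OF assms(1) dj]) (use insert.prems(2) Q2 in auto)
  also have "measure_pmf.prob (rsub E p) {S. \<forall>j\<in>I. Q j S} =
      (\<Prod>j\<in>I. measure_pmf.prob (rsub E p) {S. Q j S})"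
    by (rule insert.IH) (use insert.prems disjoint_family_on_mono[of I "insert i I" D] in auto)
  finally show ?case using insert.hyps by simp
qed simp

lemma prob_rsub_mem:
  assumes "finite E" "e \<in> E" "0 \<le> p" "p \<le> 1"
  shows "measure_pmf.prob (rsub E p) {S. e \<in> S} = p"
proof -
  have "measure_pmf.prob (rsub E p) {S. e \<in> S} =
      measure_pmf.prob (map_pmf (\<lambda>f. f e) (Pi_pmf E False (\<lambda>_. bernoulli_pmf p))) {True}"
    using assms(2) by (auto simp: rsub_def vimage_def)
  also have "\<dots> = p"
    using assms by (simp add: Pi_pmf_component measure_pmf_single)
  finally show ?thesis .
qed

lemma prob_rsub_not_mem:
  assumes "finite E" "e \<in> E" "0 \<le> p" "p \<le> 1"
  shows "measure_pmf.prob (rsub E p) {S. e \<notin> S} = 1 - p"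
proof -
  have "{S. e \<notin> S} = space (measure_pmf (rsub E p)) - {S. e \<in> S}" by auto
  then show ?thesis
    using prob_rsub_mem[OF assms] measure_pmf.prob_compl[of "{S. e \<in> S}" "rsub E p"] by simp
qed

lemma prob_rsub_superset:
  assumes "finite E" "D \<subseteq> E" "0 \<le> p" "p \<le> 1"
  shows "measure_pmf.prob (rsub E p) {S. D \<subseteq> S} = p ^ card D"
proof -
  have "measure_pmf.prob (rsub E p) {S. \<forall>e\<in>D. e \<in> S} =
      (\<Prod>e\<in>D. measure_pmf.prob (rsub E p) {S. e \<in> S})"
    using assms finite_subset by (intro prob_rsub_indep_family[where D = "\<lambda>e. {e}"])
      (auto simp: disjoint_family_on_def)
  also have "\<dots> = (\<Prod>e\<in>D. p)"
    using assms by (intro prod.cong refl prob_rsub_mem) auto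
  finally show ?thesis by (simp add: subset_eq)
qed

lemma prob_rsub_disjoint:
  assumes "finite E" "D \<subseteq> E" "0 \<le> p" "p \<le> 1"
  shows "measure_pmf.prob (rsub E p) {S. S \<inter> D = {}} = (1 - p) ^ card D"
proof -
  have "measure_pmf.prob (rsub E p) {S. \<forall>e\<in>D. e \<notin> S} =
      (\<Prod>e\<in>D. measure_pmf.prob (rsub E p) {S. e \<notin> S})"
    using assms finite_subset by (intro prob_rsub_indep_family[where D = "\<lambda>e. {e}"])
      (auto simp: disjoint_family_on_def)
  also have "\<dots> = (\<Prod>e\<in>D. 1 - p)"
    using assms by (intro prod.cong refl prob_rsub_not_mem) auto
  also have "{S. \<forall>e\<in>D. e \<notin> S} = {S. S \<inter> D = {}}" by auto
  finally show ?thesis by simp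
qed

section \<open>Sprinkling: a random set as the union of two\<close>

lemma bernoulli_pmf_disj:
  assumes "0 \<le> p" "p \<le> 1" "0 \<le> q" "q \<le> 1"
  shows "bernoulli_pmf (1 - (1 - p) * (1 - q)) =
    bind_pmf (bernoulli_pmf p) (\<lambda>a. map_pmf (\<lambda>b. a \<or> b) (bernoulli_pmf q))"
proof (rule pmf_eqI)
  fix i
  define s where "s = 1 - (1 - p) * (1 - q)"
  have s: "0 \<le> s" "s \<le> 1"
    using assms mult_le_one[of "1 - p" "1 - q"] mult_nonneg_nonneg[of "1 - p" "1 - q"] by (auto simp: s_def)
  have "(\<or>) True = (\<lambda>_. True)" "(\<or>) False = (\<lambda>b. b)" by auto
  then have *: "map_pmf ((\<or>) True) (bernoulli_pmf q) = return_pmf True"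
    "map_pmf ((\<or>) False) (bernoulli_pmf q) = bernoulli_pmf q"
    by (auto simp: map_pmf_const)
  have "pmf (bernoulli_pmf s) i =
      pmf (bind_pmf (bernoulli_pmf p) (\<lambda>a. map_pmf (\<lambda>b. a \<or> b) (bernoulli_pmf q))) i"
    using assms s by (cases i) (simp_all add: pmf_bind *, simp_all add: s_def algebra_simps)
  then show "pmf (bernoulli_pmf (1 - (1 - p) * (1 - q))) i =
      pmf (bind_pmf (bernoulli_pmf p) (\<lambda>a. map_pmf (\<lambda>b. a \<or> b) (bernoulli_pmf q))) i"
    by (simp only: s_def)
qed

text \<open>An element is missing from the union iff both of its coins fail, whence the parameter.
  Elements are added one at a time; the only real step exchanges the second coin of the new element
  with the first random set on the old ones.\<close>

lemma rsub_sprinkle: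
  assumes "finite E" "0 \<le> p" "p \<le> 1" "0 \<le> q" "q \<le> 1"
  shows "rsub E (1 - (1 - p) * (1 - q)) = map_pmf (\<lambda>(S, T). S \<union> T) (pair_pmf (rsub E p) (rsub E q))"
  using assms(1)
proof (induction rule: finite_induct)
  case (insert x E)
  let ?f = "\<lambda>a b S T. return_pmf (if a \<or> b then insert x (S \<union> T) else S \<union> T)"
  have "rsub (insert x E) (1 - (1 - p) * (1 - q)) =
     bind_pmf (bernoulli_pmf p) (\<lambda>a. bind_pmf (bernoulli_pmf q) (\<lambda>b.
       bind_pmf (rsub E p) (\<lambda>S. bind_pmf (rsub E q) (?f a b S))))"
    unfolding rsub_insert[OF insert.hyps] insert.IH bernoulli_pmf_disj[OF assms(2-5)]
    by (simp add: pair_pmf_def bind_assoc_pmf map_pmf_def bind_return_pmf)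
  also have "\<dots> = bind_pmf (bernoulli_pmf p) (\<lambda>a. bind_pmf (rsub E p) (\<lambda>S.
       bind_pmf (bernoulli_pmf q) (\<lambda>b. bind_pmf (rsub E q) (?f a b S))))"
    by (subst bind_commute_pmf[of "bernoulli_pmf q"]) simp
  also have "\<dots> = map_pmf (\<lambda>(S, T). S \<union> T) (pair_pmf (rsub (insert x E) p) (rsub (insert x E) q))"
    unfolding rsub_insert[OF insert.hyps] 
    by (simp add: pair_pmf_def bind_assoc_pmf map_pmf_def bind_return_pmf)
       (intro bind_pmf_cong refl, simp)
  finally show ?case .
qed simp

text \<open>
  Conditioning on the trace T of the random set on X: given T, the event B is contained in an
  event B' T that does not depend on X, and the trace satisfies H with probability at least g.
\<close>

lemma prob_rsub_cond:
  assumes E: "finite E" and \<beta>: "\<beta>' \<le> \<beta>"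
    and B': "\<And>T S. S \<subseteq> E \<Longrightarrow> B' T S \<longleftrightarrow> B' T (S - X)"
      "\<And>S. S \<subseteq> E \<Longrightarrow> B S \<Longrightarrow> B' (S \<inter> X) S"
      "\<And>T. T \<subseteq> X \<Longrightarrow> measure_pmf.prob (rsub E p) {S. B' T S} \<le> (if H T then \<beta>' else \<beta>)"
    and g: "measure_pmf.prob (rsub E p) {S. \<not> H (S \<inter> X)} \<le> 1 - g"
  shows "measure_pmf.prob (rsub E p) {S. B S} \<le> \<beta> - g * (\<beta> - \<beta>')"
proof -
  let ?P = "\<lambda>Q. measure_pmf.prob (rsub E p) {S. Q S}"
  have cell: "?P (\<lambda>S. S \<inter> X = T \<and> B S) \<le> ?P (\<lambda>S. S \<inter> X = T) * (if H T then \<beta>' else \<beta>)"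
    if T: "T \<in> Pow (E \<inter> X)" for T
  proof -
    have "?P (\<lambda>S. S \<inter> X = T \<and> B S) \<le> ?P (\<lambda>S. S \<inter> X = T \<and> B' T S)"
      using set_pmf_rsub[of E p] B'(2) by (intro measure_pmf.finite_measure_mono_AE AE_pmfI) auto
    also have "\<dots> = ?P (\<lambda>S. S \<inter> X = T) * ?P (B' T)"
      by (rule prob_rsub_indep[OF E, where D = X and D' = "- X"])
        (use B'(1) in \<open>auto simp: Diff_eq[symmetric]\<close>)
    also have "\<dots> \<le> ?P (\<lambda>S. S \<inter> X = T) * (if H T then \<beta>' else \<beta>)"
      by (intro mult_left_mono B'(3)) (use T in auto)
    finally show ?thesis .
  qed
  have part: "?P Q = (\<Sum>T\<in>Pow (E \<inter> X). ?P (\<lambda>S. S \<inter> X = T \<and> Q S))" for Q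
  proof -
    have "?P Q = measure_pmf.prob (rsub E p) (\<Union>T\<in>Pow (E \<inter> X). {S. S \<inter> X = T \<and> Q S})"
      using set_pmf_rsub[of E p] by (intro measure_pmf.finite_measure_eq_AE AE_pmfI) auto
    also have "\<dots> = (\<Sum>T\<in>Pow (E \<inter> X). ?P (\<lambda>S. S \<inter> X = T \<and> Q S))"
      using E by (intro measure_pmf.finite_measure_finite_Union) (auto simp: disjoint_family_on_def)
    finally show ?thesis .
  qed
  have "?P B \<le> (\<Sum>T\<in>Pow (E \<inter> X). ?P (\<lambda>S. S \<inter> X = T) * (if H T then \<beta>' else \<beta>))"
    unfolding part[of B] by (intro sum_mono cell)
  \<comment> \<open>The value is \<beta>' on every cell plus the surplus \<beta> - \<beta>' where H
    fails; as the surplus is nonnegative, the bound on the failure of H can be inserted.\<close>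
  also have "\<dots> = (\<Sum>T\<in>Pow (E \<inter> X). \<beta>' * ?P (\<lambda>S. S \<inter> X = T) +
      (\<beta> - \<beta>') * ?P (\<lambda>S. S \<inter> X = T \<and> \<not> H (S \<inter> X)))"
    by (intro sum.cong refl) (auto simp: algebra_simps cong: conj_cong)
  also have "\<dots> = \<beta>' * ?P (\<lambda>S. True) + (\<beta> - \<beta>') * ?P (\<lambda>S. \<not> H (S \<inter> X))"
    unfolding part[of "\<lambda>S. True"] part[of "\<lambda>S. \<not> H (S \<inter> X)"] by (simp add: sum.distrib sum_distrib_left)
  also have "\<dots> \<le> \<beta>' * 1 + (\<beta> - \<beta>') * (1 - g)"
    using mult_left_mono[OF g, of "\<beta> - \<beta>'"] \<beta> by simp
  also have "\<dots> = \<beta> - g * (\<beta> - \<beta>')" by (simp add: algebra_simps)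
  finally show ?thesis .
qed

section \<open>Weak saturation for stars\<close>

lemma nsets_2_edge_at:
  assumes "e \<in> nsets V 2" "c \<in> e"
  obtains x where "e = {c, x}" "x \<noteq> c" "x \<in> V" "c \<in> V"
  using assms by (elim nsets2_E) auto

lemma card_edges_at:
  assumes "finite V" "E \<subseteq> nsets V 2"
  shows "card {e \<in> E. c \<in> e} = card {x. {c, x} \<in> E}"
proof -
  have "bij_betw (\<lambda>x. {c, x}) {x. {c, x} \<in> E} {e \<in> E. c \<in> e}"
  proof (intro bij_betw_imageI inj_onI)
    show "(\<lambda>x. {c, x}) ` {x. {c, x} \<in> E} = {e \<in> E. c \<in> e}"
    proof safe
      fix e assume "e \<in> E" "c \<in> e"
      then obtain x where "e = {c, x}" using assms(2) by (meson nsets_2_edge_at subsetD)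
      then show "e \<in> (\<lambda>x. {c, x}) ` {x. {c, x} \<in> E}" using \<open>e \<in> E\<close> by auto
    qed
  qed (auto simp: doubleton_eq_iff)
  then show ?thesis by (simp add: bij_betw_same_card)
qed

text \<open>Every edge of a star contains its centre, so a copy through e is centred at an end of e.
  Conversely, t - 1 further neighbours of that end complete e to a star. From here on only degrees
  matter.\<close>

lemma contains_star_with_edge_iff:
  assumes V: "finite V" and E: "E \<subseteq> nsets V 2" and t: "t \<ge> 1"
  shows "contains_copy_with_edge (V, E) (star_graph t) e \<longleftrightarrow>
    e \<in> E \<and> (\<exists>c\<in>e. t \<le> card {e' \<in> E. c \<in> e'})"
proof
  assume "contains_copy_with_edge (V, E) (star_graph t) e"
  then obtain f where f: "inj_on f {0..t}" "(`) f ` {{0, i} | i. i \<in> {1..t}} \<subseteq> E"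
    "e \<in> (`) f ` {{0, i} | i. i \<in> {1..t}}"
    by (auto simp: contains_copy_with_edge_def is_copy_def subgraph_def star_graph_def)
  have eq: "(`) f ` {{0, i} | i. i \<in> {1..t}} = (\<lambda>i. {f 0, f i}) ` {1..t}"
    by (simp add: Setcompr_eq_image image_image del: atLeastAtMost_iff)
  have "inj_on (\<lambda>i. {f 0, f i}) {1..t}"
    using f(1) by (auto simp: inj_on_def doubleton_eq_iff)
  then have "t = card ((\<lambda>i. {f 0, f i}) ` {1..t})" by (simp add: card_image)
  also have "\<dots> \<le> card {e' \<in> E. f 0 \<in> e'}"
    using f(2) finite_subset[OF E finite_imp_finite_nsets[OF V]]
    unfolding eq by (intro card_mono) auto
  finally show "e \<in> E \<and> (\<exists>c\<in>e. t \<le> card {e' \<in> E. c \<in> e'})"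
    using f(2,3) by (auto simp: eq)
next
  assume "e \<in> E \<and> (\<exists>c\<in>e. t \<le> card {e' \<in> E. c \<in> e'})"
  then obtain c where c: "e \<in> E" "c \<in> e" "t \<le> card {x. {c, x} \<in> E}"
    using card_edges_at[OF V E] by auto
  obtain x where x: "e = {c, x}" "x \<noteq> c" "x \<in> V" "c \<in> V"
    using E c(1,2) by (meson nsets_2_edge_at subsetD)
  let ?N = "{x. {c, x} \<in> E}"
  have "c \<in> V \<and> y \<in> V \<and> c \<noteq> y" if "y \<in> ?N" for y
    using subsetD[OF E, of "{c, y}"] that by simp
  then have N: "?N \<subseteq> V" "c \<notin> ?N"
    by blast+
  \<comment> \<open>The leaf x is reserved in advance, so that e itself belongs to the star.\<close>
  have "t - 1 \<le> card (?N - {x})"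
    using c x N V finite_subset by (subst card_Diff_singleton) auto
  then obtain T where T: "T \<subseteq> ?N - {x}" "card T = t - 1" "finite T"
    using obtain_subset_with_card_n by metis
  have cT: "card (insert x T) = t" using T t by (subst card_insert_disjoint) auto
  obtain g where g: "bij_betw g {1..t} (insert x T)"
    using cT T(3) by (metis card_atLeastAtMost diff_Suc_1 finite_atLeastAtMost finite_insert finite_same_card_bij)
  define f where "f = g(0 := c)"
  have fg: "f i = g i" if "i \<in> {1..t}" for i using that by (auto simp: f_def)
  have img: "f ` {1..t} = insert x T" using g fg by (auto simp: bij_betw_def)
  have TN: "insert x T \<subseteq> ?N" using T c(1) x(1) by auto
  have "inj_on f {1..t}"
    using g inj_on_cong[of "{1..t}" f g] fg by (simp add: bij_betw_def)
  moreover have "f 0 \<notin> f ` {1..t}" using N TN unfolding img by (auto simp: f_def)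
  moreover have ins: "{0..t} = insert 0 {1..t}" by auto
  ultimately have inj: "inj_on f {0..t}" by (simp add: ins)
  have f0: "f 0 = c" by (simp add: f_def)
  then have eq: "(`) f ` {{0, i} | i. i \<in> {1..t}} = (\<lambda>y. {c, y}) ` f ` {1..t}"
    by (simp add: Setcompr_eq_image image_image del: atLeastAtMost_iff)
  have sub: "f ` {0..t} \<subseteq> V" unfolding ins image_insert img f0 using N TN x by blast
  show "contains_copy_with_edge (V, E) (star_graph t) e"
    unfolding contains_copy_with_edge_def
  proof (intro exI conjI)
    show "is_copy (star_graph t) (f ` {0..t}, (`) f ` {{0, i} | i. i \<in> {1..t}})"
      using inj by (auto simp: is_copy_def star_graph_def)
    show "subgraph (f ` {0..t}, (`) f ` {{0, i} | i. i \<in> {1..t}}) (V, E)"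
      using sub TN unfolding subgraph_def eq img by auto
    show "e \<in> edges (f ` {0..t}, (`) f ` {{0, i} | i. i \<in> {1..t}})"
      unfolding snd_conv eq img using x by auto
  qed
qed

section \<open>Activation orders\<close>

text \<open>The list may be partial; lower bounds for F therefore distinguish a long list, where
  edges are counted along it, from a short one, where F has to reach everything outside it.\<close>

definition activation_order :: "nat \<Rightarrow> 'a graph \<Rightarrow> 'a graph \<Rightarrow> 'a list \<Rightarrow> bool" where
  "activation_order r G F vs \<longleftrightarrow> distinct vs \<and> set vs \<subseteq> verts G \<and>
     (\<forall>i<length vs. r \<le> card {e \<in> edges G. vs ! i \<in> e \<and>
        (e \<in> edges F \<or> e \<inter> set (take i vs) \<noteq> {})})"

lemma activation_order_append:
  assumes "activation_order r G F vs" "v \<in> verts G" "v \<notin> set vs"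
    "r \<le> card {e \<in> edges G. v \<in> e \<and> (e \<in> edges F \<or> e \<inter> set vs \<noteq> {})}"
  shows "activation_order r G F (vs @ [v])"
  using assms by (auto simp: activation_order_def nth_append less_Suc_eq)

text \<open>An added edge completes a star at one of its ends c, so c has r other edges by then.
  Those outside F were added earlier and, by the invariant, meet the list; hence all of them count
  for c, which can be appended unless it is already listed.\<close>

lemma weakly_saturated_star_activation:
  assumes V: "finite (verts G)" and E: "edges G \<subseteq> nsets (verts G) 2"
    and F: "weakly_saturated G (star_graph (Suc r)) F"
  shows "\<exists>vs. activation_order r G F vs \<and> (\<forall>e\<in>edges G - edges F. e \<inter> set vs \<noteq> {})"
proof -
  have FE: "edges F \<subseteq> edges G" and FV: "verts F = verts G"
    using F by (auto simp: weakly_saturated_def spanning_subgraph_def)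
  obtain es where es: "distinct es" "set es = edges G - edges F"
    "\<And>i. i < length es \<Longrightarrow> contains_copy_with_edge
        (verts G, edges F \<union> set (take (Suc i) es)) (star_graph (Suc r)) (es ! i)"
    using F FV by (auto simp: weakly_saturated_def)
  have finE: "finite (edges G)" using E V finite_imp_finite_nsets finite_subset by blast
  have "\<exists>vs. activation_order r G F vs \<and> (\<forall>e\<in>set (take i es). e \<inter> set vs \<noteq> {})"
    if "i \<le> length es" for i
    using that
  proof (induction i)
    case 0
    show ?case by (intro exI[of _ "[]"]) (simp add: activation_order_def)
  next
    case (Suc i)
    then obtain vs where vs: "activation_order r G F vs"
      "\<And>e. e \<in> set (take i es) \<Longrightarrow> e \<inter> set vs \<noteq> {}" by auto
    have i: "i < length es" using Suc by simp
    let ?E = "edges F \<union> set (take (Suc i) es)"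
    have sub: "?E \<subseteq> edges G" using FE es(2) set_take_subset[of "Suc i" es] by auto
    have tk: "set (take (Suc i) es) = insert (es ! i) (set (take i es))"
      using i by (simp add: take_Suc_conv_app_nth)
    obtain c where c: "c \<in> es ! i" "Suc r \<le> card {e \<in> ?E. c \<in> e}"
      using es(3)[OF i] contains_star_with_edge_iff[OF V, of ?E "Suc r" "es ! i"] sub E by auto
    show ?case
    proof (cases "c \<in> set vs")
      case True
      then show ?thesis using vs c(1) by (intro exI[of _ vs]) (auto simp: tk)
    next
      case False
      let ?D = "{e \<in> edges G. c \<in> e \<and> (e \<in> edges F \<or> e \<inter> set vs \<noteq> {})}"
      \<comment> \<open>The new edge itself need not count at c, which is why \<open>Suc r\<close>
        drops to r.\<close>
      have "{e \<in> ?E. c \<in> e} \<subseteq> insert (es ! i) ?D"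
        using sub vs(2) by (auto simp: tk)
      then have "Suc r \<le> card (insert (es ! i) ?D)"
        using c(2) finE by (intro order_trans[OF c(2)] card_mono) auto
      also have "\<dots> \<le> Suc (card ?D)" by (rule card_insert_le_m1) (use finE in auto)
      finally have "r \<le> card ?D" by simp
      moreover have "c \<in> verts G"
        using c(1) es(2) i E by (metis DiffD1 nsets_2_edge_at nth_mem subsetD)
      ultimately have "activation_order r G F (vs @ [c])"
        using vs(1) False by (intro activation_order_append)
      then show ?thesis using vs(2) c(1) by (intro exI[of _ "vs @ [c]"]) (auto simp: tk)
    qed
  qed
  from this[of "length es"] show ?thesis using es(2) by simp
qed

text \<open>Missing edges are added vertex by vertex: at the turn of \<open>vs ! k\<close>, all
  missing edges at it that avoid its predecessors are appended in any order. Its r counted edges are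
  present by then, so each new edge completes a star centred there.\<close>

lemma activation_order_weakly_saturated:
  assumes V: "finite (verts G)" and E: "edges G \<subseteq> nsets (verts G) 2"
    and F: "spanning_subgraph F G"
    and vs: "activation_order r G F vs" "\<And>e. e \<in> edges G - edges F \<Longrightarrow> e \<inter> set vs \<noteq> {}"
  shows "weakly_saturated G (star_graph (Suc r)) F"
proof -
  have FE: "edges F \<subseteq> edges G" and FV: "verts F = verts G"
    using F by (auto simp: spanning_subgraph_def)
  have finE: "finite (edges G)" using E V finite_imp_finite_nsets finite_subset by blast
  let ?ok = "\<lambda>es. \<forall>i<length es. contains_copy_with_edge
        (verts F, edges F \<union> set (take (Suc i) es)) (star_graph (Suc r)) (es ! i)"
  have "\<exists>es. distinct es \<and> set es = {e \<in> edges G - edges F. e \<inter> set (take k vs) \<noteq> {}} \<and> ?ok es"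
    if "k \<le> length vs" for k
    using that
  proof (induction k)
    case (Suc k)
    then obtain es where es: "distinct es"
      "set es = {e \<in> edges G - edges F. e \<inter> set (take k vs) \<noteq> {}}" "?ok es" by auto
    have k: "k < length vs" using Suc by simp
    have tk: "set (take (Suc k) vs) = insert (vs ! k) (set (take k vs))"
      using k by (simp add: take_Suc_conv_app_nth)
    let ?N = "{e \<in> edges G - edges F. vs ! k \<in> e \<and> e \<inter> set (take k vs) = {}}"
    obtain ds where ds: "set ds = ?N" "distinct ds"
      using finE finite_distinct_list[of ?N] by auto
    have "?ok (es @ ds)"
    proof (intro allI impI)
      fix i assume i: "i < length (es @ ds)"
      show "contains_copy_with_edge (verts F, edges F \<union> set (take (Suc i) (es @ ds)))
          (star_graph (Suc r)) ((es @ ds) ! i)"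
      proof (cases "i < length es")
        case True
        then show ?thesis using es(3) by (simp add: nth_append)
      next
        case False
        define j where "j = i - length es"
        have j: "j < length ds" "(es @ ds) ! i = ds ! j" using i False by (auto simp: j_def nth_append)
        let ?E = "edges F \<union> set (take (Suc i) (es @ ds))"
        let ?D = "{e \<in> edges G. vs ! k \<in> e \<and> (e \<in> edges F \<or> e \<inter> set (take k vs) \<noteq> {})}"
        have sub: "?E \<subseteq> edges G"
          using FE es(2) ds(1) set_take_subset[of "Suc i" "es @ ds"] by auto
        have dj: "ds ! j \<in> ?N" using j(1) ds(1) nth_mem by blast
        have inE: "ds ! j \<in> ?E"
          using j i by (metis UnI2 in_set_conv_nth length_take lessI min_less_iff_conj nth_take)
        have "set es \<subseteq> ?E" using False by (auto simp: )
        then have "insert (ds ! j) ?D \<subseteq> {e \<in> ?E. vs ! k \<in> e}"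
          using dj inE es(2) by auto
        then have "card (insert (ds ! j) ?D) \<le> card {e \<in> ?E. vs ! k \<in> e}"
          using finite_subset[OF sub finE] by (intro card_mono) auto
        moreover have "card (insert (ds ! j) ?D) = Suc (card ?D)"
          using finE dj by (intro card_insert_disjoint) auto
        moreover have "r \<le> card ?D" using vs(1) k by (auto simp: activation_order_def)
        ultimately have "Suc r \<le> card {e \<in> ?E. vs ! k \<in> e}" by simp
        then show ?thesis
          unfolding j(2) FV using inE dj sub E
          by (subst contains_star_with_edge_iff[OF V]) auto
      qed
    qed
    moreover have "distinct (es @ ds)" using es ds by auto
    moreover have "set (es @ ds) = {e \<in> edges G - edges F. e \<inter> set (take (Suc k) vs) \<noteq> {}}"
      using es(2) ds(1) by (auto simp: tk)
    ultimately show ?case by blast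
  qed auto
  from this[of "length vs"] obtain es where
    "distinct es" "set es = {e \<in> edges G - edges F. e \<inter> set vs \<noteq> {}}" "?ok es" by auto
  then show ?thesis
    using F vs(2) unfolding weakly_saturated_def by (intro conjI exI[of _ es]) auto
qed

section \<open>Percolating orders and the exact value of wsat\<close>

text \<open>The term \<open>min j r\<close> forces the first \<open>Suc r\<close> vertices to form a
  clique, which serves as F. No F is mentioned, so this is a property of the graph alone and can be
  studied for a random one.\<close>

definition percolating_order :: "nat \<Rightarrow> 'a graph \<Rightarrow> 'a list \<Rightarrow> bool" where
  "percolating_order r G vs \<longleftrightarrow> distinct vs \<and> set vs = verts G \<and>
     (\<forall>j<length vs. min j r \<le> card {x \<in> set (take j vs). {vs ! j, x} \<in> edges G})"

lemma card_edges_at_meeting: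
  assumes "E \<subseteq> nsets V 2" "v \<notin> A"
  shows "card {e \<in> E. v \<in> e \<and> e \<inter> A \<noteq> {}} = card {x \<in> A. {v, x} \<in> E}"
proof -
  have "bij_betw (\<lambda>x. {v, x}) {x \<in> A. {v, x} \<in> E} {e \<in> E. v \<in> e \<and> e \<inter> A \<noteq> {}}"
  proof (intro bij_betw_imageI inj_onI)
    show "(\<lambda>x. {v, x}) ` {x \<in> A. {v, x} \<in> E} = {e \<in> E. v \<in> e \<and> e \<inter> A \<noteq> {}}"
    proof (intro subset_antisym subsetI)
      fix e assume e: "e \<in> {e \<in> E. v \<in> e \<and> e \<inter> A \<noteq> {}}"
      then obtain y where "e = {v, y}" using assms(1) by (metis (lifting) mem_Collect_eq nsets_2_edge_at subsetD)
      then show "e \<in> (\<lambda>x. {v, x}) ` {x \<in> A. {v, x} \<in> E}" using assms(2) e by auto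
    qed auto
  qed (use assms(2) in \<open>auto simp: doubleton_eq_iff\<close>)
  then show ?thesis by (simp add: bij_betw_same_card)
qed

lemma card_edges_at_meeting_le:
  assumes "E \<subseteq> nsets V 2" "v \<notin> A" "finite A"
  shows "card {e \<in> E. v \<in> e \<and> e \<inter> A \<noteq> {}} \<le> card A"
  using card_edges_at_meeting[OF assms(1,2)] assms(3) by (simp add: card_mono)

lemma percolating_order_clique:
  assumes "percolating_order r G vs"
  shows "nsets (set (take (Suc r) vs)) 2 \<subseteq> edges G"
proof
  have adj: "{vs ! j, vs ! i} \<in> edges G" if ij: "i < j" "j \<le> r" "j < length vs" for i j
  proof -
    have "{x \<in> set (take j vs). {vs ! j, x} \<in> edges G} = set (take j vs)"
      using assms ij by (intro card_seteq)
        (auto simp: percolating_order_def distinct_card min_def)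
    moreover have "vs ! i \<in> set (take j vs)" using ij by (auto simp: in_set_conv_nth)
    ultimately show ?thesis by blast
  qed
  fix e assume "e \<in> nsets (set (take (Suc r) vs)) 2"
  then obtain x y where xy: "e = {x, y}" "x \<noteq> y" "x \<in> set (take (Suc r) vs)" "y \<in> set (take (Suc r) vs)"
    by (elim nsets2_E) auto
  then obtain i j where "x = vs ! i" "y = vs ! j" "i \<le> r" "j \<le> r" "i < length vs" "j < length vs"
    by (auto simp: in_set_conv_nth)
  then show "e \<in> edges G"
    using xy adj[of i j] adj[of j i] by (cases i j rule: linorder_cases) (auto simp: insert_commute)
qed

lemma percolating_order_activation:
  assumes V: "finite (verts G)" and E: "edges G \<subseteq> nsets (verts G) 2"
    and vs: "percolating_order r G vs" "Suc r \<le> length vs"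
  shows "activation_order r G (verts G, nsets (set (take (Suc r) vs)) 2) vs"
  unfolding activation_order_def snd_conv
proof (intro conjI allI impI)
  show "distinct vs" "set vs \<subseteq> verts G" using vs by (auto simp: percolating_order_def)
  let ?A = "set (take (Suc r) vs)"
  fix i assume i: "i < length vs"
  let ?D = "{e \<in> edges G. vs ! i \<in> e \<and> (e \<in> nsets ?A 2 \<or> e \<inter> set (take i vs) \<noteq> {})}"
  have fin: "finite ?D"
    using finite_subset[OF E finite_imp_finite_nsets[OF V]] by simp
  show "r \<le> card ?D"
  proof (cases "i \<le> r")
    case True
    have iA: "vs ! i \<in> ?A" using i True by (auto simp: in_set_conv_nth)
    have "card ?A = Suc r"
      using vs by (simp add: percolating_order_def distinct_card)
    then have "r = card (?A - {vs ! i})" using iA by simp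
    also have "?A - {vs ! i} = {x. {vs ! i, x} \<in> nsets ?A 2}"
      using iA by auto
    also have "card \<dots> = card {e \<in> nsets ?A 2. vs ! i \<in> e}"
      by (rule card_edges_at[symmetric, of ?A]) auto
    also have "\<dots> \<le> card ?D"
      using percolating_order_clique[OF vs(1)] by (intro card_mono fin) auto
    finally show ?thesis .
  next
    case False
    have "r \<le> card {x \<in> set (take i vs). {vs ! i, x} \<in> edges G}"
      using vs(1) i False by (auto simp: percolating_order_def min_def)
    also have "\<dots> = card {e \<in> edges G. vs ! i \<in> e \<and> e \<inter> set (take i vs) \<noteq> {}}"
      using vs(1) i by (intro card_edges_at_meeting[OF E, symmetric])
        (auto simp: percolating_order_def in_set_conv_nth nth_eq_iff_index_eq)
    also have "\<dots> \<le> card ?D" by (intro card_mono fin) auto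
    finally show ?thesis .
  qed
qed

lemma sum_descending: "(\<Sum>i<r. r - i) = Suc r choose 2"
proof (induction r)
  case (Suc r)
  have "(\<Sum>i<Suc r. Suc r - i) = Suc r + (\<Sum>i<r. r - i)"
    by (simp add: sum.lessThan_Suc_shift del: sum.lessThan_Suc)
  then show ?case using Suc by (simp add: numeral_2_eq_2)
qed simp

text \<open>If the order has at least r vertices, \<open>vs ! i\<close> has at most i edges to
  predecessors, so at least r - i edges of F at it avoid them; an edge is charged to its first
  listed end, and the sum is r + ... + 1. If the order is shorter, every unlisted vertex has degree
  at least r but fewer than r edges into the order, so it lies on an edge of F, and 2 |F| is at
  least the number of unlisted vertices.\<close>

lemma weakly_saturated_star_card_ge:
  assumes V: "finite (verts G)" and E: "edges G \<subseteq> nsets (verts G) 2"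
    and F: "weakly_saturated G (star_graph (Suc r)) F"
    and deg: "\<And>v. v \<in> verts G \<Longrightarrow> r \<le> card {e \<in> edges G. v \<in> e}"
    and large: "r + 2 * (Suc r choose 2) \<le> card (verts G)"
  shows "Suc r choose 2 \<le> card (edges F)"
proof -
  obtain vs where vs: "activation_order r G F vs" "\<And>e. e \<in> edges G - edges F \<Longrightarrow> e \<inter> set vs \<noteq> {}"
    using weakly_saturated_star_activation[OF V E F] by blast
  have dist: "distinct vs" and sub: "set vs \<subseteq> verts G" using vs(1) by (auto simp: activation_order_def)
  have finE: "finite (edges G)" using E V finite_imp_finite_nsets finite_subset by blast
  have FE: "edges F \<subseteq> edges G" using F by (auto simp: weakly_saturated_def spanning_subgraph_def)
  then have finF: "finite (edges F)" using finE finite_subset by blast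
  show ?thesis
  proof (cases "r \<le> length vs")
    case True
    let ?S = "\<lambda>i. {e \<in> edges F. vs ! i \<in> e \<and> e \<inter> set (take i vs) = {}}"
    have "r - i \<le> card (?S i)" if i: "i < r" for i
    proof -
      let ?T = "{e \<in> edges G. vs ! i \<in> e \<and> e \<inter> set (take i vs) \<noteq> {}}"
      have "r \<le> card {e \<in> edges G. vs ! i \<in> e \<and> (e \<in> edges F \<or> e \<inter> set (take i vs) \<noteq> {})}"
        using vs(1) i True by (auto simp: activation_order_def)
      also have "\<dots> \<le> card (?S i \<union> ?T)" using finE finF by (intro card_mono) auto
      also have "\<dots> \<le> card (?S i) + card ?T" by (rule card_Un_le)
      also have "card ?T \<le> card (set (take i vs))"
        using dist i True by (intro card_edges_at_meeting_le[OF E])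
          (auto simp: in_set_conv_nth nth_eq_iff_index_eq)
      also have "\<dots> \<le> i" by (rule order_trans[OF card_length]) simp
      finally show ?thesis by simp
    qed
    then have "Suc r choose 2 \<le> (\<Sum>i<r. card (?S i))"
      unfolding sum_descending[symmetric] by (intro sum_mono) auto
    also have "\<dots> = card (\<Union>i<r. ?S i)"
    proof (intro card_UN_disjoint[symmetric] ballI impI)
      fix i j assume ij: "i \<in> {..<r}" "j \<in> {..<r}" "i \<noteq> j"
      then have "vs ! i \<in> set (take j vs) \<or> vs ! j \<in> set (take i vs)"
        using True by (auto simp: in_set_conv_nth linorder_neq_iff)
      then show "?S i \<inter> ?S j = {}" by auto
    qed (use finF in auto)
    also have "\<dots> \<le> card (edges F)" using finF by (intro card_mono) auto
    finally show ?thesis .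
  next
    case False
    have "verts G - set vs \<subseteq> \<Union> (edges F)"
    proof
      fix u assume u: "u \<in> verts G - set vs"
      have "card {e \<in> edges G. u \<in> e \<and> e \<inter> set vs \<noteq> {}} \<le> card (set vs)"
        using u by (intro card_edges_at_meeting_le[OF E]) auto
      also have "\<dots> < r" using False card_length[of vs] by linarith
      also have "r \<le> card {e \<in> edges G. u \<in> e}" using deg u by auto
      finally have "{e \<in> edges G. u \<in> e \<and> e \<inter> set vs \<noteq> {}} \<noteq> {e \<in> edges G. u \<in> e}"
        by (metis less_irrefl)
      then obtain e where "e \<in> edges G" "u \<in> e" "e \<inter> set vs = {}" by blast
      then show "u \<in> \<Union> (edges F)" using vs(2)[of e] by auto
    qed
    moreover have "finite (\<Union> (edges F))"
      using finF FE E by (intro finite_Union) (auto simp: nsets_def)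
    ultimately have "card (verts G - set vs) \<le> card (\<Union> (edges F))"
      by (intro card_mono)
    also have "\<dots> \<le> (\<Sum>e\<in>edges F. card e)" by (rule card_Union_le_sum_card)
    also have "\<dots> = (\<Sum>e\<in>edges F. 2)" using FE E by (intro sum.cong) (auto simp: nsets_def)
    finally have "card (verts G - set vs) \<le> 2 * card (edges F)" by simp
    moreover have "card (verts G - set vs) = card (verts G) - card (set vs)"
      using sub by (intro card_Diff_subset) auto
    ultimately show ?thesis using large False card_length[of vs] by linarith
  qed
qed

text \<open>The clique on the first \<open>Suc r\<close> vertices attains the lower bound; the
  minimum degree required by that bound is read off from the same order.\<close>

lemma wsat_star_eq:
  assumes V: "finite (verts G)" and E: "edges G \<subseteq> nsets (verts G) 2"
    and vs: "percolating_order r G vs"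
    and large: "Suc r + 2 * (Suc r choose 2) \<le> card (verts G)"
  shows "wsat G (star_graph (Suc r)) = Suc r choose 2"
proof -
  let ?F = "(verts G, nsets (set (take (Suc r) vs)) 2)"
  have len: "length vs = card (verts G)"
    using vs by (metis distinct_card percolating_order_def)
  have act: "activation_order r G ?F vs"
    using percolating_order_activation[OF V E vs] large len by simp
  have finE: "finite (edges G)" using E V finite_imp_finite_nsets finite_subset by blast
  have ws: "weakly_saturated G (star_graph (Suc r)) ?F"
  proof (rule activation_order_weakly_saturated[OF V E _ act])
    show "spanning_subgraph ?F G"
      using percolating_order_clique[OF vs] by (simp add: spanning_subgraph_def)
    show "e \<inter> set vs \<noteq> {}" if "e \<in> edges G - edges ?F" for e
    proof -
      have "e \<subseteq> verts G" "card e = 2" using that E by (auto simp: nsets_def)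
      then show ?thesis using vs by (auto simp: percolating_order_def Int_absorb2)
    qed
  qed
  have cF: "card (edges ?F) = Suc r choose 2"
    using vs large len by (simp add: distinct_card percolating_order_def)
  have lb: "Suc r choose 2 \<le> card (edges F)" if "weakly_saturated G (star_graph (Suc r)) F" for F
  proof (rule weakly_saturated_star_card_ge[OF V E that])
    fix v assume "v \<in> verts G"
    then obtain i where i: "v = vs ! i" "i < length vs"
      using vs by (metis in_set_conv_nth percolating_order_def)
    have "r \<le> card {e \<in> edges G. vs ! i \<in> e \<and> (e \<in> edges ?F \<or> e \<inter> set (take i vs) \<noteq> {})}"
      using act i by (auto simp: activation_order_def)
    also have "\<dots> \<le> card {e \<in> edges G. v \<in> e}" using finE i by (intro card_mono) auto
    finally show "r \<le> card {e \<in> edges G. v \<in> e}" .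
  qed (use large in auto)
  show ?thesis
    unfolding wsat_def
  proof (rule Least_equality)
    show "\<exists>F. weakly_saturated G (star_graph (Suc r)) F \<and> card (edges F) = Suc r choose 2"
      using ws cF by blast
  qed (use lb in auto)
qed

lemma wsat_complete_graph_star:
  assumes "Suc r + 2 * (Suc r choose 2) \<le> n"
  shows "wsat (complete_graph_on n) (star_graph (Suc r)) = Suc r choose 2"
proof (rule wsat_star_eq)
  show "percolating_order r (complete_graph_on n) [1..<Suc n]"
    unfolding percolating_order_def
  proof (intro conjI allI impI)
    fix j assume j: "j < length [1..<Suc n]"
    have "{x \<in> set (take j [1..<Suc n]). {[1..<Suc n] ! j, x} \<in> edges (complete_graph_on n)} = {1..<Suc j}"
      using j by (auto simp: complete_graph_on_def take_upt simp del: upt_Suc)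
    then show "min j r \<le> card {x \<in> set (take j [1..<Suc n]). {[1..<Suc n] ! j, x} \<in> edges (complete_graph_on n)}"
      by simp
  qed (auto simp: complete_graph_on_def)
qed (use assms in \<open>auto simp: complete_graph_on_def\<close>)

section \<open>Consequences of a small weakly saturated subgraph\<close>

text \<open>With all degrees at most r there is no star with \<open>Suc r\<close> edges in G, so not
  even a first edge can be added.\<close>

lemma weakly_saturated_star_trivial:
  assumes V: "finite (verts G)" and E: "edges G \<subseteq> nsets (verts G) 2"
    and F: "weakly_saturated G (star_graph (Suc r)) F"
    and deg: "\<And>v. v \<in> verts G \<Longrightarrow> card {e \<in> edges G. v \<in> e} \<le> r"
  shows "edges F = edges G"
proof (rule ccontr)
  assume ne: "edges F \<noteq> edges G"
  have FE: "edges F \<subseteq> edges G" and FV: "verts F = verts G"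
    using F by (auto simp: weakly_saturated_def spanning_subgraph_def)
  have finE: "finite (edges G)" using E V finite_imp_finite_nsets finite_subset by blast
  obtain es where es: "set es = edges G - edges F"
    "\<And>i. i < length es \<Longrightarrow> contains_copy_with_edge
        (verts G, edges F \<union> set (take (Suc i) es)) (star_graph (Suc r)) (es ! i)"
    using F FV by (auto simp: weakly_saturated_def)
  let ?E = "edges F \<union> set (take (Suc 0) es)"
  have "0 < length es" using es(1) ne FE by auto
  moreover have sub: "?E \<subseteq> edges G" using FE es(1) set_take_subset[of "Suc 0" es] by auto
  ultimately obtain c where c: "c \<in> es ! 0" "es ! 0 \<in> edges G" "Suc r \<le> card {e \<in> ?E. c \<in> e}"
    using es(2)[of 0] contains_star_with_edge_iff[OF V, of ?E "Suc r" "es ! 0"] sub E by auto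
  have "card {e \<in> ?E. c \<in> e} \<le> card {e \<in> edges G. c \<in> e}"
    using sub finE by (intro card_mono) auto
  moreover have "c \<in> verts G" using c(1,2) E by (meson nsets_2_edge_at subsetD)
  ultimately show False using deg[of c] c(3) by simp
qed

text \<open>When the r admissible edges are summed over the first k vertices of the order, an edge
  of F is counted at most twice, and a backward edge once, at its later end; backward edges lie
  inside the set of these k vertices. If the order is shorter than k, it meets all edges once it is
  joined by one end of every edge of F.\<close>

lemma weakly_saturated_star_dense_or_cover:
  assumes V: "finite (verts G)" and E: "edges G \<subseteq> nsets (verts G) 2"
    and F: "weakly_saturated G (star_graph (Suc r)) F"
  shows "(\<exists>S\<subseteq>verts G. card S = k \<and> r * k \<le> 2 * card (edges F) + card (edges G \<inter> nsets S 2)) \<or>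
    (\<exists>B\<subseteq>verts G. card B \<le> k + card (edges F) \<and> (\<forall>e\<in>edges G. e \<inter> B \<noteq> {}))"
proof -
  obtain vs where vs: "activation_order r G F vs" "\<And>e. e \<in> edges G - edges F \<Longrightarrow> e \<inter> set vs \<noteq> {}"
    using weakly_saturated_star_activation[OF V E F] by blast
  have dist: "distinct vs" and sub: "set vs \<subseteq> verts G" using vs(1) by (auto simp: activation_order_def)
  have finE: "finite (edges G)" using E V finite_imp_finite_nsets finite_subset by blast
  have FE: "edges F \<subseteq> edges G" using F by (auto simp: weakly_saturated_def spanning_subgraph_def)
  then have finF: "finite (edges F)" using finE finite_subset by blast
  show ?thesis
  proof (cases "k \<le> length vs")
    case True
    let ?S = "set (take k vs)"
    let ?T = "\<lambda>i. {e \<in> edges G. vs ! i \<in> e \<and> e \<inter> set (take i vs) \<noteq> {}}"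
    let ?D = "\<lambda>i. {e \<in> edges F. vs ! i \<in> e}"
    have "r \<le> card (?D i) + card (?T i)" if i: "i < k" for i
    proof -
      have "r \<le> card {e \<in> edges G. vs ! i \<in> e \<and> (e \<in> edges F \<or> e \<inter> set (take i vs) \<noteq> {})}"
        using vs(1) i True by (auto simp: activation_order_def)
      also have "\<dots> \<le> card (?D i \<union> ?T i)" using finE finF by (intro card_mono) auto
      also have "\<dots> \<le> card (?D i) + card (?T i)" by (rule card_Un_le)
      finally show ?thesis .
    qed
    then have "(\<Sum>i<k. r) \<le> (\<Sum>i<k. card (?D i) + card (?T i))" by (intro sum_mono) auto
    also have "\<dots> = (\<Sum>i<k. card (?D i)) + (\<Sum>i<k. card (?T i))" by (rule sum.distrib)
    also have "(\<Sum>i<k. card (?T i)) = card (\<Union>i<k. ?T i)"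
    proof (intro card_UN_disjoint[symmetric] ballI impI)
      have "?T i \<inter> ?T j = {}" if "i < j" "j < k" for i j
      proof -
        have "vs ! j \<notin> e" if "e \<in> ?T i" for e
        proof -
          have "e \<in> nsets (verts G) 2" "vs ! i \<in> e" using that E by auto
          then obtain x where x: "e = {vs ! i, x}" by (metis nsets_2_edge_at)
          moreover have "vs ! i \<notin> set (take i vs)"
            using \<open>i < j\<close> \<open>j < k\<close> True dist by (auto simp: in_set_conv_nth nth_eq_iff_index_eq)
          ultimately have "x \<in> set (take i vs)" using that by auto
          with x show ?thesis using \<open>i < j\<close> \<open>j < k\<close> dist True
            by (auto simp: in_set_conv_nth nth_eq_iff_index_eq)
        qed
        then show ?thesis by auto
      qed
      then show "?T i \<inter> ?T j = {}" if "i \<in> {..<k}" "j \<in> {..<k}" "i \<noteq> j" for i j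
        using that by (metis (lifting) Int_commute lessThan_iff linorder_neqE_nat)
    qed (use finE in auto)
    also have "\<dots> \<le> card (edges G \<inter> nsets ?S 2)"
    proof (intro card_mono subsetI)
      show "finite (edges G \<inter> nsets ?S 2)" using finE by auto
      fix e assume "e \<in> (\<Union>i<k. ?T i)"
      then obtain i where i: "i < k" "e \<in> ?T i" by auto
      then have "e \<in> nsets (verts G) 2" using E by auto
      then obtain x where x: "e = {vs ! i, x}" "x \<noteq> vs ! i"
        using i by (auto elim!: nsets_2_edge_at)
      have "vs ! i \<notin> set (take i vs)"
        using i(1) True dist by (auto simp: in_set_conv_nth nth_eq_iff_index_eq)
      then have "x \<in> set (take i vs)" using i(2) x by auto
      moreover have "set (take i vs) \<subseteq> ?S" using i(1) by (intro set_take_subset_set_take) simp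
      moreover have "vs ! i \<in> ?S" using i(1) True by (auto simp: in_set_conv_nth)
      ultimately show "e \<in> edges G \<inter> nsets ?S 2" using i(2) x by auto
    qed
    also have "(\<Sum>i<k. card (?D i)) \<le> 2 * card (edges F)"
    proof -
      have "(\<Sum>i<k. card (?D i)) = (\<Sum>i<k. \<Sum>e\<in>edges F. of_bool (vs ! i \<in> e))"
        using finF by (simp add: sum_of_bool_eq Int_def)
      also have "\<dots> = (\<Sum>e\<in>edges F. \<Sum>i<k. of_bool (vs ! i \<in> e))" by (rule sum.swap)
      also have "\<dots> \<le> (\<Sum>e\<in>edges F. 2)"
      proof (intro sum_mono)
        fix e assume "e \<in> edges F"
        then have e: "finite e" "card e = 2" using FE E by (auto simp: nsets_def)
        have "(\<Sum>i<k. of_bool (vs ! i \<in> e)) = card {i \<in> {..<k}. vs ! i \<in> e}"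
          by (simp add: sum_of_bool_eq Int_def)
        also have "\<dots> = card ((!) vs ` {i \<in> {..<k}. vs ! i \<in> e})"
          using dist True by (intro card_image[symmetric] inj_onI) (auto simp: nth_eq_iff_index_eq)
        also have "\<dots> \<le> card e" using e by (intro card_mono) auto
        finally show "(\<Sum>i<k. of_bool (vs ! i \<in> e)) \<le> (2::nat)" using e by simp
      qed
      finally show ?thesis by simp
    qed
    finally have "r * k \<le> 2 * card (edges F) + card (edges G \<inter> nsets ?S 2)"
      by (simp add: mult.commute)
    moreover have "card ?S = k" using dist True by (simp add: distinct_card)
    moreover have "?S \<subseteq> verts G" using sub set_take_subset[of k vs] by auto
    ultimately show ?thesis by blast
  next
    case False
    define f where "f e = (SOME x. x \<in> e)" for e :: "'a set"
    have f: "f e \<in> e" if "e \<in> edges G" for e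
    proof -
      have "e \<noteq> {}" using that E by (auto simp: nsets_def)
      then show ?thesis unfolding f_def by (simp add: some_in_eq)
    qed
    let ?B = "set vs \<union> f ` edges F"
    have "f e \<in> verts G" if "e \<in> edges F" for e
    proof -
      have "e \<in> nsets (verts G) 2" "f e \<in> e" using f that FE E by blast+
      then show ?thesis by (auto simp: nsets_def)
    qed
    then have "?B \<subseteq> verts G" using sub by blast
    moreover have "card ?B \<le> k + card (edges F)"
    proof -
      have "card ?B \<le> card (set vs) + card (f ` edges F)" by (rule card_Un_le)
      also have "\<dots> \<le> k + card (edges F)"
        using False card_length[of vs] card_image_le[OF finF, of f] by linarith
      finally show ?thesis .
    qed
    moreover have "\<forall>e\<in>edges G. e \<inter> ?B \<noteq> {}"
    proof
      fix e assume e: "e \<in> edges G"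
      show "e \<inter> ?B \<noteq> {}"
      proof (cases "e \<in> edges F")
        case True
        then have "f e \<in> e \<inter> ?B" using f[OF e] by simp
        then show ?thesis by auto
      next
        case False
        then show ?thesis using vs(2)[of e] e by auto
      qed
    qed
    ultimately show ?thesis by blast
  qed
qed

section \<open>Growing a chain\<close>

text \<open>
  The vertex v has a neighbour in every nonempty residue class modulo r of positions of Y. This forces
  min (length Y) r neighbours in Y, and it is a conjunction of independent events.
\<close>

definition linked :: "nat \<Rightarrow> 'a list \<Rightarrow> 'a \<Rightarrow> 'a set set \<Rightarrow> bool" where
  "linked r Y v S \<longleftrightarrow>
     (\<forall>c<r. (\<exists>i<length Y. i mod r = c) \<longrightarrow> (\<exists>i<length Y. i mod r = c \<and> {Y ! i, v} \<in> S))"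

text \<open>The position of the next vertex is \<open>length Y\<close>, so the pool advances by
  itself. The set W of permitted vertices is a separate parameter because a fresh start takes place
  inside a smaller W, and \<open>chain_mono\<close> carries its success back.\<close>

primrec chain :: "nat \<Rightarrow> (nat \<Rightarrow> 'a set) \<Rightarrow> nat \<Rightarrow> 'a list \<Rightarrow> 'a set \<Rightarrow> 'a set set \<Rightarrow> bool" where
  "chain r P 0 Y W S \<longleftrightarrow> True"
| "chain r P (Suc k) Y W S \<longleftrightarrow>
     (\<exists>v\<in>P (length Y) \<inter> W. linked r Y v S \<and> chain r P k (Y @ [v]) (W - {v}) S)"

lemma linked_mono: "linked r Y v S \<Longrightarrow> S \<subseteq> S' \<Longrightarrow> linked r Y v S'"
  unfolding linked_def by blast

lemma linked_cong:
  assumes "\<And>y. y \<in> set Y \<Longrightarrow> {y, v} \<in> S \<longleftrightarrow> {y, v} \<in> S'"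
  shows "linked r Y v S \<longleftrightarrow> linked r Y v S'"
  using assms unfolding linked_def by (metis nth_mem)

text \<open>Neighbours from different residue classes sit at different positions and are therefore
  distinct. For c < min (length Y) r the class of c is nonempty, as it contains position c.\<close>

lemma linked_card:
  assumes "linked r Y v S" "distinct Y"
  shows "min (length Y) r \<le> card {x \<in> set Y. {v, x} \<in> S}"
proof -
  have "\<exists>i<length Y. i mod r = c \<and> {Y ! i, v} \<in> S" if "c < min (length Y) r" for c
    using assms(1) that unfolding linked_def by (metis min_less_iff_conj mod_less)
  then obtain f where f: "\<And>c. c < min (length Y) r \<Longrightarrow> f c < length Y \<and> f c mod r = c \<and> {Y ! f c, v} \<in> S"
    by metis
  have "inj_on (\<lambda>c. Y ! f c) {..<min (length Y) r}"
    using f assms(2) by (intro inj_onI) (metis lessThan_iff nth_eq_iff_index_eq)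
  then have "card {..<min (length Y) r} \<le> card {x \<in> set Y. {v, x} \<in> S}"
    using f by (intro card_inj_on_le) (auto simp: insert_commute)
  then show ?thesis by simp
qed

lemma chain_mono:
  "chain r P k Y W S \<Longrightarrow> W \<subseteq> W' \<Longrightarrow> chain r P k Y W' S"
proof (induction k arbitrary: Y W W')
  case (Suc k)
  then obtain v where v: "v \<in> P (length Y) \<inter> W" "linked r Y v S" "chain r P k (Y @ [v]) (W - {v}) S"
    by auto
  have "chain r P k (Y @ [v]) (W' - {v}) S"
    by (rule Suc.IH[OF v(3)]) (use Suc.prems in auto)
  then show ?case using v Suc.prems by auto
qed simp

text \<open>Only pairs between Y and later pools and pairs inside W are inspected. This locality is
  what separates exposed from unexposed pairs in the probabilistic argument.\<close>

lemma chain_cong: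
  assumes "\<And>y w i. y \<in> set Y \<Longrightarrow> w \<in> W \<Longrightarrow> w \<in> P i \<Longrightarrow> length Y \<le> i \<Longrightarrow> i < length Y + k \<Longrightarrow>
      {y, w} \<in> S \<longleftrightarrow> {y, w} \<in> S'"
    and "\<And>a b. a \<in> W \<Longrightarrow> b \<in> W \<Longrightarrow> {a, b} \<in> S \<longleftrightarrow> {a, b} \<in> S'"
  shows "chain r P k Y W S \<longleftrightarrow> chain r P k Y W S'"
  using assms
proof (induction k arbitrary: Y W)
  case (Suc k)
  have "linked r Y v S \<longleftrightarrow> linked r Y v S'" if "v \<in> P (length Y) \<inter> W" for v
    using Suc.prems(1)[of _ v "length Y"] that by (intro linked_cong) auto
  moreover have "chain r P k (Y @ [v]) (W - {v}) S \<longleftrightarrow> chain r P k (Y @ [v]) (W - {v}) S'"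
    if v: "v \<in> P (length Y) \<inter> W" for v
  proof (rule Suc.IH)
    fix y w i
    assume "y \<in> set (Y @ [v])" "w \<in> W - {v}" "w \<in> P i" "length (Y @ [v]) \<le> i" "i < length (Y @ [v]) + k"
    then show "{y, w} \<in> S \<longleftrightarrow> {y, w} \<in> S'"
      using Suc.prems(1)[of y w i] Suc.prems(2)[of v w] v by auto
  qed (use Suc.prems(2) in auto)
  ultimately show ?case unfolding chain.simps by (intro bex_cong refl) blast
qed simp

lemma chain_list:
  assumes "chain r P k Y W S"
  shows "\<exists>zs. length zs = k \<and> distinct zs \<and> set zs \<subseteq> W \<and>
    (\<forall>i<k. linked r (Y @ take i zs) (zs ! i) S)"
  using assms
proof (induction k arbitrary: Y W)
  case (Suc k)
  then obtain v where v: "v \<in> W" "linked r Y v S" "chain r P k (Y @ [v]) (W - {v}) S"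
    by auto
  from Suc.IH[OF v(3)] obtain zs where zs: "length zs = k" "distinct zs" "set zs \<subseteq> W - {v}"
    "\<And>i. i < k \<Longrightarrow> linked r ((Y @ [v]) @ take i zs) (zs ! i) S" by blast
  have "linked r (Y @ take i (v # zs)) ((v # zs) ! i) S" if "i < Suc k" for i
    using that v(2) zs(4) by (cases i) auto
  then show ?case using zs v(1) by (intro exI[of _ "v # zs"]) auto
qed simp

text \<open>The chain comes first and the remaining vertices follow in any order: r neighbours in
  the chain suffice wherever they stand.\<close>

lemma percolating_order_linked:
  assumes Y: "distinct Y" "set Y \<subseteq> V" "r \<le> length Y" "\<And>i. i < length Y \<Longrightarrow> linked r (take i Y) (Y ! i) S"
    and U: "finite V" "\<And>v. v \<in> V - set Y \<Longrightarrow> linked r Y v S"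
  shows "\<exists>vs. percolating_order r (V, S) vs"
proof -
  obtain us where us: "distinct us" "set us = V - set Y"
    using U(1) finite_distinct_list[of "V - set Y"] by auto
  have "min j r \<le> card {x \<in> set (take j (Y @ us)). {(Y @ us) ! j, x} \<in> S}" if j: "j < length (Y @ us)" for j
  proof (cases "j < length Y")
    case True
    have "min (length (take j Y)) r \<le> card {x \<in> set (take j Y). {Y ! j, x} \<in> S}"
      using Y True by (intro linked_card) auto
    then show ?thesis using True by (simp add: nth_append)
  next
    case False
    define v where "v = us ! (j - length Y)"
    have "v \<in> set us" using j False by (simp add: v_def)
    then have "min (length Y) r \<le> card {x \<in> set Y. {v, x} \<in> S}"
      using us U(2) Y(1) by (intro linked_card) auto
    also have "\<dots> \<le> card {x \<in> set (take j (Y @ us)). {v, x} \<in> S}"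
      using False by (intro card_mono) auto
    also have "v = (Y @ us) ! j" using False by (simp add: v_def nth_append)
    finally show ?thesis using Y(3) by simp
  qed
  then show ?thesis
    using Y us by (intro exI[of _ "Y @ us"]) (auto simp: percolating_order_def)
qed

text \<open>
  N attempts, one after the other. An attempt exposes only pairs between the current chain and the next
  pool. When it gets stuck, the pairs inside the set W of vertices that were never chosen are all still
  unexposed, so a new attempt can start from scratch inside W; each attempt uses up at most one vertex of
  every pool. The inner induction runs along a single attempt.
\<close>

lemma prob_no_chain:
  fixes V :: "'a set" and s :: "nat \<Rightarrow> nat" and g :: "nat \<Rightarrow> real"
  assumes E: "finite E" and P: "disjoint_family_on P {..<M}"
    and step: "\<And>Y Q. distinct Y \<Longrightarrow> set Y \<subseteq> V \<Longrightarrow> length Y < M \<Longrightarrow> Q \<subseteq> V \<Longrightarrow> Q \<inter> set Y = {} \<Longrightarrow>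
        s (length Y) \<le> card Q \<Longrightarrow> measure_pmf.prob (rsub E p) {S. \<forall>v\<in>Q. \<not> linked r Y v S} \<le> 1 - g (length Y)"
    and g: "\<And>j. j < M \<Longrightarrow> 0 \<le> g j" "\<And>j. j < M \<Longrightarrow> g j \<le> 1"
    and W: "W \<subseteq> V" "\<And>i. i < M \<Longrightarrow> s i + N \<le> card (P i \<inter> W)"
  shows "measure_pmf.prob (rsub E p) {S. \<not> chain r P M [] W S} \<le> (1 - (\<Prod>j<M. g j)) ^ N"
  using W
proof (induction N arbitrary: W)
  case 0
  then show ?case by simp
next
  case (Suc N)
  let ?pr = "\<lambda>Q. measure_pmf.prob (rsub E p) {S. Q S}"
  define b where "b = (1 - (\<Prod>j<M. g j)) ^ N"
  have b: "0 \<le> b"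
    unfolding b_def using g by (intro zero_le_power) (auto intro!: prod_le_1)
  note outer_IH = Suc.IH
  \<comment> \<open>The conjunct about a fresh chain is carried along because the outer hypothesis
    estimates it when the current trial is stuck. Pools that Y has passed have room for N further
    trials only, the others still for \<open>Suc N\<close>.\<close>
  have inner: "?pr (\<lambda>S. \<not> chain r P k Y W S \<and> \<not> chain r P M [] W S) \<le> b * (1 - (\<Prod>i\<in>{length Y..<M}. g i))"
    if "length Y + k = M" "distinct Y" "set Y \<subseteq> V" "W \<subseteq> V" "set Y \<inter> W = {}"
      "\<And>i. i < M \<Longrightarrow> s i + N \<le> card (P i \<inter> W)"
      "\<And>i. length Y \<le> i \<Longrightarrow> i < M \<Longrightarrow> s i + Suc N \<le> card (P i \<inter> W)" for k Y W
    using that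
  proof (induction k arbitrary: Y W)
    case (Suc k)
    define j where "j = length Y"
    have jM: "j < M" using Suc.prems(1) by (simp add: j_def)
    define Q where "Q = P j \<inter> W"
    \<comment> \<open>The pairs exposed now. They are not inside W, since Y avoids W, and they do
      not join the longer chain to a later pool, since pools are disjoint.\<close>
    define X where "X = {{y, w} | y w. y \<in> set Y \<and> w \<in> Q}"
    define H where "H T \<longleftrightarrow> (\<exists>v\<in>Q. linked r Y v T)" for T
    define v where "v T = (SOME v. v \<in> Q \<and> linked r Y v T)" for T
    have v: "v T \<in> Q" "linked r Y (v T) T" if "H T" for T
      using someI_ex[of "\<lambda>v. v \<in> Q \<and> linked r Y v T"] that by (auto simp: H_def v_def)
    \<comment> \<open>After a success both failures persist with the selected vertex removed from W;
      after a failure a fresh chain is sought in the same W.\<close>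
    define B' where "B' T S \<longleftrightarrow> (if H T
      then \<not> chain r P k (Y @ [v T]) (W - {v T}) S \<and> \<not> chain r P M [] (W - {v T}) S
      else \<not> chain r P M [] W S)" for T S
    define \<pi> where "\<pi> = (\<Prod>i\<in>{Suc j..<M}. g i)"
    have \<pi>: "0 \<le> \<pi>" unfolding \<pi>_def using g(1) by (intro prod_nonneg) auto
    have cards: "s i + N \<le> card (P i \<inter> (W - {u}))" if "u \<in> Q" "i < M" for u i
    proof (cases "i = j")
      case True
      have "P i \<inter> (W - {u}) = P i \<inter> W - {u}" by auto
      moreover have "u \<in> P i \<inter> W" using that True by (simp add: Q_def)
      ultimately show ?thesis using Suc.prems(7)[of i] True that(2) by (simp add: j_def)
    next
      case False
      then have "P i \<inter> P j = {}"
        using that jM by (intro disjoint_family_onD[OF P]) auto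
      then have "u \<notin> P i" using that by (auto simp: Q_def)
      then have "P i \<inter> (W - {u}) = P i \<inter> W" by auto
      then show ?thesis using Suc.prems(6)[of i] that by simp
    qed
    have dW: "{a, a'} \<notin> X" if "a \<in> W" "a' \<in> W" for a a'
      using that Suc.prems(5) by (auto simp: X_def doubleton_eq_iff)
    have "?pr (\<lambda>S. \<not> chain r P (Suc k) Y W S \<and> \<not> chain r P M [] W S) \<le> b - g j * (b - b * (1 - \<pi>))"
    proof (rule prob_rsub_cond[OF E, where X = X and H = H and B' = B'])
      show "b * (1 - \<pi>) \<le> b" using b \<pi> by (simp add: algebra_simps)
    next
      fix T S
      have "chain r P M [] W' S \<longleftrightarrow> chain r P M [] W' (S - X)" if "W' \<subseteq> W" for W'
        using that dW by (intro chain_cong) auto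
      moreover have "chain r P k (Y @ [v T]) (W - {v T}) S \<longleftrightarrow> chain r P k (Y @ [v T]) (W - {v T}) (S - X)"
        if T: "H T"
      proof (intro chain_cong)
        fix y w i
        assume y: "y \<in> set (Y @ [v T])" "w \<in> W - {v T}" "w \<in> P i" "length (Y @ [v T]) \<le> i"
          "i < length (Y @ [v T]) + k"
        have "P i \<inter> P j = {}"
          using y Suc.prems(1) jM by (intro disjoint_family_onD[OF P]) (auto simp: j_def)
        then have "w \<notin> Q" using y by (auto simp: Q_def)
        then have "{y, w} \<notin> X"
          using y v(1)[OF T] Suc.prems(5) by (auto simp: X_def doubleton_eq_iff Q_def)
        then show "{y, w} \<in> S \<longleftrightarrow> {y, w} \<in> S - X" by simp
      qed (use dW in auto)
      ultimately show "B' T S \<longleftrightarrow> B' T (S - X)" unfolding B'_def by auto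
    next
      fix S
      assume "\<not> chain r P (Suc k) Y W S \<and> \<not> chain r P M [] W S"
      then show "B' (S \<inter> X) S"
        using v[of "S \<inter> X"] chain_mono[of r P M "[]" "W - {v (S \<inter> X)}" S W] linked_mono[of r Y "v (S \<inter> X)" "S \<inter> X" S]
        by (auto simp: B'_def Q_def j_def)
    next
      fix T
      show "?pr (B' T) \<le> (if H T then b * (1 - \<pi>) else b)"
      proof (cases "H T")
        case True
        have "?pr (\<lambda>S. \<not> chain r P k (Y @ [v T]) (W - {v T}) S \<and> \<not> chain r P M [] (W - {v T}) S)
            \<le> b * (1 - (\<Prod>i\<in>{length (Y @ [v T])..<M}. g i))"
        proof (rule Suc.IH)
          fix i assume i: "length (Y @ [v T]) \<le> i" "i < M"
          have "P i \<inter> P j = {}"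
            using i jM by (intro disjoint_family_onD[OF P]) (auto simp: j_def)
          then have "v T \<notin> P i" using v(1)[OF True] by (auto simp: Q_def)
          then have "P i \<inter> (W - {v T}) = P i \<inter> W" by auto
          then show "s i + Suc N \<le> card (P i \<inter> (W - {v T}))" using Suc.prems(7)[of i] i by simp
        qed (use Suc.prems v(1)[OF True] cards[of "v T"] in \<open>auto simp: Q_def\<close>)
        then show ?thesis using True by (simp add: B'_def \<pi>_def j_def)
      next
        case False
        have "?pr (\<lambda>S. \<not> chain r P M [] W S) \<le> b"
          unfolding b_def using Suc.prems by (intro outer_IH) auto
        then show ?thesis using False by (simp add: B'_def)
      qed
    next
      have "\<not> H (S \<inter> X) \<longleftrightarrow> (\<forall>v\<in>Q. \<not> linked r Y v S)" for S
      proof -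
        have "linked r Y v (S \<inter> X) \<longleftrightarrow> linked r Y v S" if "v \<in> Q" for v
          using that by (intro linked_cong) (auto simp: X_def)
        then show ?thesis by (auto simp: H_def)
      qed
      moreover have "?pr (\<lambda>S. \<forall>v\<in>Q. \<not> linked r Y v S) \<le> 1 - g (length Y)"
        using Suc.prems(1-5) jM add_leD1[OF Suc.prems(6)[OF jM]]
        by (intro step) (auto simp: Q_def j_def)
      ultimately show "?pr (\<lambda>S. \<not> H (S \<inter> X)) \<le> 1 - g j" by (simp add: j_def)
    qed
    \<comment> \<open>A success lowers b to b (1 - \<pi>), a failure leaves b; so exactly one factor
      g j joins the product.\<close>
    also have "b - g j * (b - b * (1 - \<pi>)) = b * (1 - (\<Prod>i\<in>{j..<M}. g i))"
      using jM by (simp add: \<pi>_def prod.atLeast_Suc_lessThan algebra_simps)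
    finally show ?case by (simp add: j_def)
  qed simp
  \<comment> \<open>For the empty chain the two conjuncts coincide.\<close>
  have "?pr (\<lambda>S. \<not> chain r P M [] W S \<and> \<not> chain r P M [] W S) \<le> b * (1 - (\<Prod>i\<in>{length ([] :: 'a list)..<M}. g i))"
    using Suc.prems Suc_leD by (intro inner) force+
  then show ?case by (simp add: b_def atLeast0LessThan mult.commute)
qed

section \<open>Probability that a pool extends the chain\<close>

lemma card_residue_class_ge:
  assumes "c < (r::nat)"
  shows "j div r \<le> card {i. i < j \<and> i mod r = c}"
proof -
  have "(\<lambda>m. c + r * m) ` {..<j div r} \<subseteq> {i. i < j \<and> i mod r = c}"
  proof safe
    fix m assume "m < j div r"
    then have "r * Suc m \<le> r * (j div r)" by (intro mult_le_mono2) auto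
    also have "\<dots> \<le> j" by simp
    finally show "c + r * m < j" using assms by simp
  qed (use assms in auto)
  then have "card ((\<lambda>m. c + r * m) ` {..<j div r}) \<le> card {i. i < j \<and> i mod r = c}"
    by (intro card_mono) auto
  moreover have "inj_on (\<lambda>m. c + r * m) {..<j div r}" using assms by (auto simp: inj_on_def)
  ultimately show ?thesis by (simp add: card_image)
qed

text \<open>Distinct classes use disjoint sets of pairs at v, so their events are independent. A
  nonempty class has at least \<open>length Y div r\<close> positions and at least one, hence the
  maximum; for an empty class the event is certain.\<close>

lemma prob_linked_ge:
  assumes V: "finite V" and Y: "distinct Y" "set Y \<subseteq> V" and v: "v \<in> V" "v \<notin> set Y"
    and p: "0 \<le> p" "p \<le> 1"
  shows "(1 - (1 - p) ^ max 1 (length Y div r)) ^ r \<le> measure_pmf.prob (rsub (nsets V 2) p) {S. linked r Y v S}"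
proof -
  let ?E = "nsets V 2"
  let ?I = "\<lambda>c. {i. i < length Y \<and> i mod r = c}"
  let ?D = "\<lambda>c. (\<lambda>i. {Y ! i, v}) ` ?I c"
  let ?L = "max 1 (length Y div r)"
  have E: "finite ?E" using V by (rule finite_imp_finite_nsets)
  have sub: "?D c \<subseteq> ?E" for c using Y v nth_mem by fastforce
  have inj: "inj_on (\<lambda>i. {Y ! i, v}) {..<length Y}"
    using Y v by (auto simp: inj_on_def doubleton_eq_iff nth_eq_iff_index_eq)
  have "(1 - (1 - p) ^ ?L) ^ r = (\<Prod>c<r. 1 - (1 - p) ^ ?L)" by simp
  also have "\<dots> \<le> (\<Prod>c<r. measure_pmf.prob (rsub ?E p) {S. ?D c \<noteq> {} \<longrightarrow> S \<inter> ?D c \<noteq> {}})"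
  proof (intro prod_mono conjI)
    fix c assume c: "c \<in> {..<r}"
    show "0 \<le> 1 - (1 - p) ^ ?L" using p by (simp add: power_le_one)
    show "1 - (1 - p) ^ ?L \<le> measure_pmf.prob (rsub ?E p) {S. ?D c \<noteq> {} \<longrightarrow> S \<inter> ?D c \<noteq> {}}"
    proof (cases "?D c = {}")
      case True
      then show ?thesis using p by simp
    next
      case False
      have cardD: "card (?D c) = card (?I c)"
        by (intro card_image inj_on_subset[OF inj]) auto
      have "1 \<le> card (?I c)" using False by (simp add: Suc_le_eq card_gt_0_iff)
      then have "?L \<le> card (?D c)"
        using card_residue_class_ge[of c r "length Y"] c unfolding cardD by simp
      then have "(1 - p) ^ card (?D c) \<le> (1 - p) ^ ?L"
        using p by (intro power_decreasing) auto
      moreover have "{S. ?D c \<noteq> {} \<longrightarrow> S \<inter> ?D c \<noteq> {}} = space (rsub ?E p) - {S. S \<inter> ?D c = {}}"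
        using False by auto
      ultimately show ?thesis
        using prob_rsub_disjoint[OF E sub p, of c] measure_pmf.prob_compl[of "{S. S \<inter> ?D c = {}}" "rsub ?E p"]
        by simp
    qed
  qed
  also have "\<dots> = measure_pmf.prob (rsub ?E p) {S. \<forall>c\<in>{..<r}. ?D c \<noteq> {} \<longrightarrow> S \<inter> ?D c \<noteq> {}}"
  proof (rule prob_rsub_indep_family[OF E, symmetric])
    have "?D c \<inter> ?D d = {}" if "c \<noteq> d" for c d
      using inj that by (auto simp: inj_on_def)
    then show "disjoint_family_on ?D {..<r}" by (simp add: disjoint_family_on_def)
  qed auto
  also have "{S. \<forall>c\<in>{..<r}. ?D c \<noteq> {} \<longrightarrow> S \<inter> ?D c \<noteq> {}} = {S. linked r Y v S}"
    by (auto simp: linked_def)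
  finally show ?thesis .
qed

lemma prob_not_linked_le:
  assumes "finite V" "distinct Y" "set Y \<subseteq> V" "v \<in> V" "v \<notin> set Y" "0 \<le> p" "p \<le> 1"
  shows "measure_pmf.prob (rsub (nsets V 2) p) {S. \<not> linked r Y v S} \<le>
    1 - (1 - (1 - p) ^ max 1 (length Y div r)) ^ r"
proof -
  have "{S. \<not> linked r Y v S} = space (rsub (nsets V 2) p) - {S. linked r Y v S}" by auto
  then show ?thesis
    using prob_linked_ge[OF assms, of r]
      measure_pmf.prob_compl[of "{S. linked r Y v S}" "rsub (nsets V 2) p"] by simp
qed

text \<open>Different candidates use disjoint sets of pairs to Y, so their failures are
  independent.\<close>

lemma prob_none_linked_le:
  assumes V: "finite V" and Y: "distinct Y" "set Y \<subseteq> V" and Q: "Q \<subseteq> V" "Q \<inter> set Y = {}"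
    and p: "0 \<le> p" "p \<le> 1"
  shows "measure_pmf.prob (rsub (nsets V 2) p) {S. \<forall>v\<in>Q. \<not> linked r Y v S} \<le>
    (1 - (1 - (1 - p) ^ max 1 (length Y div r)) ^ r) ^ card Q"
proof -
  let ?h = "(1 - (1 - p) ^ max 1 (length Y div r)) ^ r"
  have "measure_pmf.prob (rsub (nsets V 2) p) {S. \<forall>v\<in>Q. \<not> linked r Y v S} =
      (\<Prod>v\<in>Q. measure_pmf.prob (rsub (nsets V 2) p) {S. \<not> linked r Y v S})"
  proof (rule prob_rsub_indep_family[where D = "\<lambda>v. {{y, v} | y. y \<in> set Y}"])
    show "finite (nsets V 2)" "finite Q" using V Q finite_subset by (auto intro: finite_imp_finite_nsets)
    show "disjoint_family_on (\<lambda>v. {{y, v} |y. y \<in> set Y}) Q"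
      using Q(2) by (auto simp: disjoint_family_on_def doubleton_eq_iff)
    show "(\<not> linked r Y v S) = (\<not> linked r Y v (S \<inter> {{y, v} |y. y \<in> set Y}))" for v S
      using linked_cong[of Y v S "S \<inter> {{y, v} |y. y \<in> set Y}" r] by auto
  qed
  also have "\<dots> \<le> (\<Prod>v\<in>Q. 1 - ?h)"
    using assms by (intro prod_mono conjI prob_not_linked_le) auto
  finally show ?thesis by simp
qed

text \<open>Integration over the first coordinate: either it falls into A, or the second coordinate
  fails with probability at most \<delta>. It lets the chain be fixed before the second graph is
  drawn.\<close>

lemma prob_pair_pmf_le:
  assumes "0 \<le> \<delta>" "\<And>x. x \<in> set_pmf M \<Longrightarrow> x \<notin> A \<Longrightarrow> measure_pmf.prob N {y. (x, y) \<in> B} \<le> \<delta>"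
  shows "measure_pmf.prob (pair_pmf M N) B \<le> measure_pmf.prob M A + \<delta>"
proof -
  have "emeasure (pair_pmf M N) B = (\<integral>\<^sup>+z. indicator B z \<partial>pair_pmf M N)" by simp
  also have "\<dots> = (\<integral>\<^sup>+x. emeasure N {y. (x, y) \<in> B} \<partial>M)"
  proof -
    have "indicator B (x, y) = (indicator {y. (x, y) \<in> B} y :: ennreal)" for x y
      by (simp add: indicator_def)
    then show ?thesis unfolding nn_integral_pair_pmf' by simp
  qed
  also have "\<dots> \<le> (\<integral>\<^sup>+x. indicator A x + ennreal \<delta> \<partial>M)"
  proof (intro nn_integral_mono_AE AE_pmfI)
    fix x assume "x \<in> set_pmf M"
    then show "emeasure N {y. (x, y) \<in> B} \<le> indicator A x + ennreal \<delta>"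
      using assms(2)[of x] measure_pmf.emeasure_le_1[of N]
      by (cases "x \<in> A") (auto simp: measure_pmf.emeasure_eq_measure ennreal_leI add_increasing2)
  qed
  also have "\<dots> = ennreal (measure_pmf.prob M A + \<delta>)"
    using assms(1) by (simp add: nn_integral_add measure_pmf.emeasure_eq_measure)
  finally show ?thesis
    using assms(1) by (simp add: measure_pmf.emeasure_eq_measure flip: ennreal_plus)
qed

lemma disjoint_pools:
  assumes "(\<Sum>j<M. a j) \<le> n"
  obtains P :: "nat \<Rightarrow> nat set" where "disjoint_family_on P {..<M}"
    "\<And>j. j < M \<Longrightarrow> P j \<subseteq> {1..n}" "\<And>j. card (P j) = a j"
proof
  let ?P = "\<lambda>j. {(\<Sum>i<j. a i)<..(\<Sum>i<j. a i) + a j}"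
  have mono: "(\<Sum>i<j. a i) + a j \<le> (\<Sum>i<k. a i)" if "j < k" for j k
    using sum_mono2[of "{..<k}" "{..<Suc j}" a] that by auto
  have "?P j \<inter> ?P k = {}" if "j < k" for j k using mono[OF that] by auto
  then have "?P j \<inter> ?P k = {}" if "j \<noteq> k" for j k
    using that by (metis Int_commute linorder_neqE_nat)
  then show "disjoint_family_on ?P {..<M}" by (simp add: disjoint_family_on_def)
  show "?P j \<subseteq> {1..n}" if "j < M" for j using mono[OF that] assms by auto
qed simp

section \<open>Elementary inequalities\<close>

lemma half_min_le_one_minus_exp:
  fixes y :: real
  assumes "0 \<le> y"
  shows "min 1 y / 2 \<le> 1 - exp (- y)"
proof -
  have "1 / (1 + y) \<ge> exp (- y)"
    using assms exp_ge_add_one_self[of y] by (simp add: exp_minus field_simps)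
  moreover have "min 1 y / 2 \<le> 1 - 1 / (1 + y)"
  proof -
    have "1 - 1 / (1 + y) = y / (1 + y)" using assms by (simp add: field_simps)
    moreover have "y / 2 \<le> y / (1 + y)" if "y \<le> 1"
      using assms that by (intro divide_left_mono) auto
    moreover have "1 / 2 \<le> y / (1 + y)" if "1 < y" using that by (simp add: field_simps)
    ultimately show ?thesis by (auto simp: min_def)
  qed
  ultimately show ?thesis by linarith
qed

lemma power_div_fact_le_exp:
  fixes x :: real
  assumes "0 \<le> x"
  shows "x ^ n / fact n \<le> exp x"
proof -
  have "(\<Sum>k\<in>{n}. x ^ k /\<^sub>R fact k) \<le> (\<Sum>k. x ^ k /\<^sub>R fact k)"
    using assms exp_converges[of x] by (intro sum_le_suminf) (auto simp: sums_iff)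
  then show ?thesis using exp_converges[of x] by (simp add: sums_iff field_simps)
qed

lemma exp_minus_two_le:
  fixes z :: real
  assumes "0 \<le> z" "z \<le> 1 / 2"
  shows "exp (- 2 * z) \<le> 1 - z"
proof -
  have "exp (- 2 * z) = 1 / exp (2 * z)" by (simp add: exp_minus field_simps)
  also have "\<dots> \<le> 1 / (1 + 2 * z)"
    using assms exp_ge_add_one_self[of "2 * z"] by (intro divide_left_mono) auto
  also have "\<dots> \<le> 1 - z"
    using mult_nonneg_nonneg[of z "1 - 2 * z"] assms by (simp add: field_simps)
  finally show ?thesis .
qed

text \<open>Telescoping: for a and b the roots of j and \<open>Suc j\<close>, 2 / a - 2 / b equals 2
  / ((a + b) a b), which is at least 1 / b^3. The sum bounds the total size of the pools beyond
  m.\<close>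

lemma sum_inverse_three_halves_le:
  assumes "1 \<le> m"
  shows "(\<Sum>j\<in>{Suc m..<M}. 1 / (real j * sqrt (real j))) \<le> 2 / sqrt (real m)"
proof -
  have step: "1 / (real (Suc j) * sqrt (real (Suc j))) \<le> 2 / sqrt (real j) - 2 / sqrt (real (Suc j))"
    if "1 \<le> j" for j
  proof -
    define a b where "a = sqrt (real j)" and "b = sqrt (real (Suc j))"
    have ab: "0 < a" "a \<le> b" "b\<^sup>2 - a\<^sup>2 = 1" using that by (auto simp: a_def b_def)
    have "1 / (b\<^sup>2 * b) \<le> 2 / a - 2 / b"
    proof -
      have "2 / a - 2 / b = 2 * (b - a) / (a * b)" using ab by (simp add: field_simps)
      also have "b - a = 1 / (b + a)"
        using ab by (simp add: field_simps power2_eq_square)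
      finally have eq: "2 / a - 2 / b = 2 / ((b + a) * (a * b))" by simp
      have "(b + a) * (a * b) \<le> (b + b) * (b * b)"
        using ab by (intro mult_mono) auto
      then have "(b + a) * (a * b) \<le> 2 * (b\<^sup>2 * b)" by (simp add: power2_eq_square)
      then have "2 / (2 * (b\<^sup>2 * b)) \<le> 2 / ((b + a) * (a * b))"
        using ab by (intro divide_left_mono) auto
      then show ?thesis by (simp add: eq)
    qed
    then show ?thesis by (simp add: a_def b_def)
  qed
  have "(\<Sum>j\<in>{Suc m..<M}. 1 / (real j * sqrt (real j))) \<le> 2 / sqrt (real m) - 2 / sqrt (real (M - 1))" if "m < M"
    using that
  proof (induction M)
    case (Suc M)
    show ?case
    proof (cases "m = M")
      case False
      then have "m < M" using Suc.prems by simp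
      then have "1 / (real M * sqrt (real M)) \<le> 2 / sqrt (real (M - 1)) - 2 / sqrt (real M)"
        using step[of "M - 1"] assms by simp
      then show ?thesis using Suc.IH \<open>m < M\<close> by simp
    qed simp
  qed simp
  then show ?thesis
    by (cases "m < M") (auto intro: order_trans)
qed

text \<open>By 1 - z \<ge> exp (- 2 z) the logarithm is at least - m^2 / 2 times the sum of 1 / j^2,
  and 1 / j^2 \<le> 1 / (j - 1) - 1 / j telescopes. The induction keeps the term 1 / (M - 1), which
  is dropped at the end.\<close>

lemma prod_tail_ge:
  assumes "1 \<le> m" "m < M"
  shows "exp (- real m / 2) \<le> (\<Prod>j\<in>{Suc m..<M}. 1 - (real m / real j)\<^sup>2 / 4)"
proof -
  have "exp (- (real m)\<^sup>2 / 2 * (1 / real m - 1 / real (M - 1))) \<le>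
      (\<Prod>j\<in>{Suc m..<M}. 1 - (real m / real j)\<^sup>2 / 4)"
    using assms(2)
  proof (induction M)
    case (Suc M)
    show ?case
    proof (cases "m = M")
      case False
      then have mM: "m < M" using Suc.prems by simp
      define z where "z = (real m / real M)\<^sup>2 / 4"
      have "(real m / real M)\<^sup>2 \<le> 1" using mM by (intro power_le_one) auto
      then have z: "0 \<le> z" "z \<le> 1 / 2" by (auto simp: z_def)
      have "1 / (real M)\<^sup>2 \<le> 1 / real (M - 1) - 1 / real M"
        using mM assms(1) by (simp add: field_simps power2_eq_square of_nat_diff)
      then have "(real m)\<^sup>2 / 2 * (1 / (real M)\<^sup>2) \<le> (real m)\<^sup>2 / 2 * (1 / real (M - 1) - 1 / real M)"
        by (intro mult_left_mono) auto
      then have le: "- (real m)\<^sup>2 / 2 * (1 / real m - 1 / real M) \<le>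
          - (real m)\<^sup>2 / 2 * (1 / real m - 1 / real (M - 1)) + (- 2 * z)"
      proof -
        have "- Q / 2 * (A - C) = - Q / 2 * (A - D) - Q / 2 * (D - C)" for A C D Q :: real
          by (simp add: algebra_simps diff_divide_distrib)
        then have "- (real m)\<^sup>2 / 2 * (1 / real m - 1 / real M) =
            - (real m)\<^sup>2 / 2 * (1 / real m - 1 / real (M - 1)) - (real m)\<^sup>2 / 2 * (1 / real (M - 1) - 1 / real M)"
          by blast
        also have "\<dots> \<le> - (real m)\<^sup>2 / 2 * (1 / real m - 1 / real (M - 1)) - 2 * z"
        proof (rule diff_left_mono)
          have "2 * z = (real m)\<^sup>2 / 2 * (1 / (real M)\<^sup>2)" by (simp add: z_def power_divide)
          also note \<open>\<dots> \<le> (real m)\<^sup>2 / 2 * (1 / real (M - 1) - 1 / real M)\<close>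
          finally show "2 * z \<le> (real m)\<^sup>2 / 2 * (1 / real (M - 1) - 1 / real M)" .
        qed
        finally show ?thesis by simp
      qed
      have "exp (- (real m)\<^sup>2 / 2 * (1 / real m - 1 / real M)) \<le>
          exp (- (real m)\<^sup>2 / 2 * (1 / real m - 1 / real (M - 1))) * exp (- 2 * z)"
        using le unfolding exp_add[symmetric] by (simp only: exp_le_cancel_iff)
      also have "\<dots> \<le> (\<Prod>j\<in>{Suc m..<M}. 1 - (real m / real j)\<^sup>2 / 4) * (1 - z)"
        using Suc.IH[OF mM] exp_minus_two_le[OF z] z by (intro mult_mono) (auto intro: order_trans[rotated])
      finally show ?thesis using mM by (simp add: z_def)
    qed simp
  qed simp
  moreover have "- real m / 2 \<le> - (real m)\<^sup>2 / 2 * (1 / real m - 1 / real (M - 1))"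
    using assms by (simp add: field_simps power2_eq_square)
  ultimately show ?thesis by (meson exp_le_cancel_iff order_trans)
qed

section \<open>Success probabilities and pool sizes along one chain\<close>

lemma real_half_div_le:
  assumes "1 \<le> r"
  shows "real j / real (2 * r) \<le> real (max 1 (j div r))"
proof -
  have "j < r * Suc (j div r)" using dividend_less_times_div[of r j] assms by simp
  \<comment> \<open>The factor 2 pays for rounding, including j < r, where the quotient is 0 and the
    maximum is 1.\<close>
  also have "\<dots> \<le> r * (2 * max 1 (j div r))" by (intro mult_le_mono2) auto
  finally have "real j \<le> real (r * (2 * max 1 (j div r)))" by (intro of_nat_mono) simp
  then show ?thesis using assms by (simp add: field_simps)
qed

lemma prob_none_linked_le_exp:
  assumes V: "finite V" and Y: "distinct Y" "set Y \<subseteq> V" and Q: "Q \<subseteq> V" "Q \<inter> set Y = {}"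
    and p: "0 \<le> p" "p \<le> 1" and \<sigma>: "\<sigma> \<le> real (card Q)" and r: "1 \<le> r"
  shows "measure_pmf.prob (rsub (nsets V 2) p) {S. \<forall>v\<in>Q. \<not> linked r Y v S} \<le>
    exp (- ((min 1 (p * length Y / (2 * r)) / 2) ^ r * \<sigma>))"
proof -
  define j where "j = length Y"
  define k where "k = max 1 (j div r)"
  define h where "h = (1 - (1 - p) ^ k) ^ r"
  define h' where "h' = (min 1 (p * j / (2 * r)) / 2) ^ r"
  have "real j / (2 * r) \<le> k" unfolding k_def by (rule real_half_div_le[OF r])
  then have pk: "p * j / (2 * r) \<le> p * k"
    using p mult_left_mono[of "real j / (2 * r)" k p] by simp
  have q1: "(1 - p) ^ k \<le> 1" using p by (intro power_le_one) auto
  have "(1 - p) ^ k \<le> exp (- p) ^ k"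
    using p exp_ge_add_one_self[of "- p"] by (intro power_mono) auto
  also have "\<dots> = exp (- (p * k))" by (simp add: exp_of_nat_mult[symmetric] mult.commute)
  finally have "1 - exp (- (p * k)) \<le> 1 - (1 - p) ^ k" by simp
  moreover have "min 1 (p * k) / 2 \<le> 1 - exp (- (p * k))"
    using p by (intro half_min_le_one_minus_exp) auto
  ultimately have "min 1 (p * j / (2 * r)) / 2 \<le> 1 - (1 - p) ^ k"
    using pk by (auto simp: min_def split: if_splits)
  then have h': "0 \<le> h'" "h' \<le> h"
    unfolding h'_def h_def using p by (auto intro!: power_mono)
  have h: "h \<le> 1" unfolding h_def using p q1 by (intro power_le_one) auto
  have "measure_pmf.prob (rsub (nsets V 2) p) {S. \<forall>v\<in>Q. \<not> linked r Y v S} \<le> (1 - h) ^ card Q"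
    using prob_none_linked_le[OF V Y Q p, of r] by (simp add: h_def k_def j_def)
  also have "\<dots> \<le> exp (- h) ^ card Q"
    using h exp_ge_add_one_self[of "- h"] by (intro power_mono) auto
  also have "\<dots> = exp (- (h * card Q))" by (simp add: exp_of_nat_mult[symmetric] mult.commute)
  also have "\<dots> \<le> exp (- (h' * \<sigma>))"
  proof -
    have "h' * \<sigma> \<le> h' * card Q" using h' \<sigma> by (intro mult_left_mono) auto
    also have "\<dots> \<le> h * card Q" using h' by (intro mult_right_mono) auto
    finally show ?thesis by simp
  qed
  finally show ?thesis by (simp add: h'_def j_def)
qed

text \<open>A lower bound for the chance of extending a chain of length j. Up to m it follows the
  expected number of good candidates, which scales like (j / m)^r; beyond m the permitted failure (m
  / j)^2 / 4 has a sum of order m. The first vertex is free.\<close>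

definition step_bound :: "nat \<Rightarrow> nat \<Rightarrow> nat \<Rightarrow> real" where
  "step_bound r m j = (if j = 0 then 1 else if j \<le> m then (real j / real m) ^ r / 2
     else 1 - (real m / real j)\<^sup>2 / 4)"

lemma step_bound_bounds:
  assumes "1 \<le> m"
  shows "0 \<le> step_bound r m j" "step_bound r m j \<le> 1"
proof -
  have "(real j / real m) ^ r \<le> 1" if "j \<le> m" using that assms by (intro power_le_one) auto
  moreover have "(real m / real j)\<^sup>2 \<le> 1" if "m < j" using that by (intro power_le_one) auto
  ultimately show "0 \<le> step_bound r m j" "step_bound r m j \<le> 1"
    by (fastforce simp: step_bound_def)+
qed

text \<open>The start contributes 2^(-m) (m! / m^m)^r, which is at least exp (- (r + 1) m) because
  m^m / m! is a term of the series of exp m. The tail costs at most exp (- m / 2).\<close>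

lemma prod_step_bound_ge:
  assumes "1 \<le> m" "m < M"
  shows "exp (- (real (r + 2) * real m)) \<le> (\<Prod>j<M. step_bound r m j)"
proof -
  have "exp (- real m) ^ Suc r = exp (- real m) * exp (- real m) ^ r" by simp
  also have "\<dots> \<le> (1 / 2) ^ m * (fact m / real m ^ m) ^ r"
  proof (intro mult_mono power_mono)
    have "exp (- real m) = exp (- 1) ^ m" by (simp add: exp_of_nat_mult[symmetric])
    also have "\<dots> \<le> (1 / 2) ^ m"
      using exp_ge_add_one_self[of 1] by (intro power_mono) (auto simp: exp_minus field_simps)
    finally show "exp (- real m) \<le> (1 / 2) ^ m" .
    show "exp (- real m) \<le> fact m / real m ^ m"
      using power_div_fact_le_exp[of "real m" m] assms by (simp add: exp_minus field_simps)
  qed auto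
  also have "\<dots> = (\<Prod>j<m. (real (Suc j) / real m) ^ r / 2)"
    by (simp add: prod_dividef power_divide prod_power_distrib fact_prod_Suc atLeast0LessThan power_mult_distrib
        flip: power_mult) (simp add: mult.commute)
  also have "\<dots> = (\<Prod>j<Suc m. step_bound r m j)"
    by (subst prod.lessThan_Suc_shift) (simp add: step_bound_def)
  finally have 1: "exp (- real m) ^ Suc r \<le> (\<Prod>j<Suc m. step_bound r m j)" .
  have 2: "exp (- real m / 2) \<le> (\<Prod>j\<in>{Suc m..<M}. step_bound r m j)"
    using prod_tail_ge[OF assms] by (simp add: step_bound_def)
  have "exp (- (real (r + 2) * real m)) \<le> exp (- real m) ^ Suc r * exp (- real m / 2)"
    by (simp add: exp_of_nat_mult[symmetric] exp_add[symmetric] algebra_simps)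
  also have "\<dots> \<le> (\<Prod>j<Suc m. step_bound r m j) * (\<Prod>j\<in>{Suc m..<M}. step_bound r m j)"
    using 1 2 by (intro mult_mono) (auto intro: order_trans[rotated])
  also have "\<dots> = (\<Prod>j<M. step_bound r m j)"
    using prod.atLeastLessThan_concat[of 0 "Suc m" M "step_bound r m"] assms by (simp add: atLeast0LessThan)
  finally show ?thesis .
qed

text \<open>Half of the size of pool j, up to rounding; the other half makes up for discarded
  vertices. The exponent 3/2 is large enough for a summable tail and small enough that u^r / u^(3/2)
  \<ge> sqrt u for u = j / m \<ge> 1 and r \<ge> 2. With the constant 8, the pools up to m and those
  beyond m take at most n / 2 vertices each.\<close>

definition pool_weight :: "nat \<Rightarrow> nat \<Rightarrow> nat \<Rightarrow> real" where
  "pool_weight n m j = (if j \<le> m then real n / (8 * real m)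
     else real n * sqrt (real m) / (8 * (real j * sqrt (real j))))"

lemma sum_pool_weight_le:
  assumes "1 \<le> m" "m < M"
  shows "(\<Sum>j<M. 2 * pool_weight n m j) \<le> n"
proof -
  have "(\<Sum>j<M. 2 * pool_weight n m j) =
      (\<Sum>j<Suc m. 2 * pool_weight n m j) + (\<Sum>j\<in>{Suc m..<M}. 2 * pool_weight n m j)"
    using sum.atLeastLessThan_concat[of 0 "Suc m" M "\<lambda>j. 2 * pool_weight n m j"] assms
    by (simp add: atLeast0LessThan)
  also have "(\<Sum>j<Suc m. 2 * pool_weight n m j) = real (Suc m) * (real n / (4 * real m))"
    by (simp add: pool_weight_def)
  also have "\<dots> \<le> real n / 2"
    using assms mult_right_mono[of "real (Suc m)" "2 * real m" "real n / (4 * real m)"] by simp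
  also have "(\<Sum>j\<in>{Suc m..<M}. 2 * pool_weight n m j) =
      real n * sqrt (real m) / 4 * (\<Sum>j\<in>{Suc m..<M}. 1 / (real j * sqrt (real j)))"
    unfolding sum_distrib_left by (intro sum.cong) (auto simp: pool_weight_def)
  also have "\<dots> \<le> real n * sqrt (real m) / 4 * (2 / sqrt (real m))"
    by (intro mult_left_mono sum_inverse_three_halves_le assms) auto
  also have "\<dots> = real n / 2" using assms by simp
  finally show ?thesis by simp
qed

lemma pool_weight_ge:
  assumes "1 \<le> m" "m < M" "j < M"
  shows "real n * sqrt (real m) / (8 * (real M * sqrt (real M))) \<le> pool_weight n m j"
proof (cases "j \<le> m")
  case True
  have "real m * sqrt (real m) \<le> real M * sqrt (real M)" using assms by (intro mult_mono) auto
  then have "real n * (real m * sqrt (real m)) \<le> real n * (real M * sqrt (real M))"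
    by (intro mult_left_mono) auto
  then show ?thesis using True assms by (simp add: pool_weight_def field_simps)
next
  case False
  have "real j * sqrt (real j) \<le> real M * sqrt (real M)" using assms by (intro mult_mono) auto
  moreover have "0 < j" "0 < M" using False assms by auto
  ultimately show ?thesis using False by (auto simp: pool_weight_def intro!: divide_left_mono)
qed

text \<open>The term of order 4 of the exponential series is 256 u^2 / 24, more than 4 u^2. This
  turns the exponent available beyond m into the failure allowed by
  \<open>step_bound\<close>.\<close>

lemma exp_minus_four_sqrt_le:
  fixes u :: real
  assumes "0 < u"
  shows "exp (- (4 * sqrt u)) \<le> 1 / (4 * u\<^sup>2)"
proof -
  have "(4 * sqrt u) ^ 4 = 256 * (sqrt u ^ 2) ^ 2" by (simp only: power_mult_distrib power_mult[symmetric]) simp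
  then have "(4 * sqrt u) ^ 4 = 256 * u\<^sup>2" using assms by simp
  moreover have "fact 4 = (24::real)" by (simp add: fact_numeral)
  ultimately have "256 * u\<^sup>2 / 24 \<le> exp (4 * sqrt u)"
    using power_div_fact_le_exp[of "4 * sqrt u" 4] assms by simp
  then have "4 * u\<^sup>2 \<le> exp (4 * sqrt u)" by (rule order_trans[rotated]) simp
  then show ?thesis using assms by (simp add: exp_minus field_simps)
qed

text \<open>Three ranges, with u = j / m. Up to m the exponent is K0 u^r, and half of its minimum
  with 1 is a lower bound for the success. Beyond m, while the minimum is not saturated, the
  exponent is at least 4 sqrt u. Once it is saturated, a candidate is linked with probability at
  least 2^(-r), and N2 pushes the failure below 1 / (4 M^2), which suffices as u \<le> M.\<close>

lemma step_failure_le: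
  fixes p1 :: real
  assumes r: "2 \<le> r" and m: "1 \<le> m" "m < M" and j: "1 \<le> j" "j < M" and p1: "0 \<le> p1"
    and K: "32 * (4 * real r) ^ r \<le> p1 ^ r * real n * real m ^ (r - 1)"
    and pm: "p1 * real m \<le> 2 * real r"
    and N2: "8 * 2 ^ r * (real M * sqrt (real M)) * ln (4 * (real M)\<^sup>2) \<le> real n * sqrt (real m)"
  shows "exp (- ((min 1 (p1 * j / (2 * r)) / 2) ^ r * pool_weight n m j)) \<le> 1 - step_bound r m j"
proof -
  \<comment> \<open>K0 is the exponent at j = m: the base \<open>4 * real r\<close> collects 2 r
    from the class size and 2 from the bound on 1 - exp, and 8 comes from
    \<open>pool_weight\<close>. Hypothesis K says K0 \<ge> 4.\<close>
  define K0 where "K0 = p1 ^ r * real n * real m ^ (r - 1) / (8 * (4 * real r) ^ r)"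
  have K0: "4 \<le> K0" unfolding K0_def using K r by (simp add: field_simps)
  define u where "u = real j / real m"
  have u0: "0 < u" using j m by (simp add: u_def)
  have mr: "real m ^ r = real m * real m ^ (r - 1)" using r by (cases r) auto
  have base: "(p1 * j / (2 * r) / 2) ^ r * (real n / (8 * real m)) = K0 * u ^ r"
    using m r by (simp add: K0_def u_def power_mult_distrib power_divide mr field_simps)
  show ?thesis
  proof (cases "j \<le> m")
    case True
    have "p1 * j \<le> p1 * m" using True p1 by (intro mult_left_mono) auto
    then have "p1 * j / (2 * r) \<le> 1" using pm r by (simp add: field_simps)
    then have x: "(min 1 (p1 * j / (2 * r)) / 2) ^ r * pool_weight n m j = K0 * u ^ r"
      using base True by (simp add: pool_weight_def)
    have "u ^ r \<le> 1" using True u0 m by (intro power_le_one) (auto simp: u_def)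
    moreover have "1 * u ^ r \<le> K0 * u ^ r" using K0 u0 by (intro mult_right_mono) auto
    ultimately have "u ^ r / 2 \<le> min 1 (K0 * u ^ r) / 2" by simp
    also have "\<dots> \<le> 1 - exp (- (K0 * u ^ r))"
      using K0 u0 by (intro half_min_le_one_minus_exp) auto
    finally show ?thesis unfolding x using True j by (simp add: step_bound_def u_def)
  next
    case False
    then have u1: "1 \<le> u" using m by (simp add: u_def)
    have mj: "(real m / real j)\<^sup>2 / 4 = 1 / (4 * u\<^sup>2)" by (simp add: u_def power_divide)
    have "exp (- ((min 1 (p1 * j / (2 * r)) / 2) ^ r * pool_weight n m j)) \<le> 1 / (4 * u\<^sup>2)"
    proof (cases "p1 * j / (2 * r) \<le> 1")
      case True
      have "pool_weight n m j = real n / (8 * real m) * (1 / (u * sqrt u))"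
        using False m j by (simp add: pool_weight_def u_def real_sqrt_divide field_simps)
      then have "(min 1 (p1 * j / (2 * r)) / 2) ^ r * pool_weight n m j =
          (p1 * j / (2 * r) / 2) ^ r * (real n / (8 * real m)) * (1 / (u * sqrt u))"
        using True by (simp only: min_absorb2 mult.assoc)
      then have x: "(min 1 (p1 * j / (2 * r)) / 2) ^ r * pool_weight n m j = K0 * u ^ r / (u * sqrt u)"
        unfolding base by simp
      have "4 * sqrt u = 4 * u ^ 2 / (u * sqrt u)"
        using u0 by (simp add: power2_eq_square field_simps)
      \<comment> \<open>Here r \<ge> 2 enters, through u^r \<ge> u^2.\<close>
      also have "\<dots> \<le> K0 * u ^ r / (u * sqrt u)"
        using K0 u0 u1 r by (intro divide_right_mono mult_mono power_increasing) auto
      finally have "exp (- (K0 * u ^ r / (u * sqrt u))) \<le> exp (- (4 * sqrt u))" by simp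
      also have "\<dots> \<le> 1 / (4 * u\<^sup>2)" by (rule exp_minus_four_sqrt_le[OF u0])
      finally show ?thesis by (simp only: x)
    next
      case big: False
      have "ln (4 * (real M)\<^sup>2) \<le> (1 / 2) ^ r * (real n * sqrt (real m) / (8 * (real M * sqrt (real M))))"
        using N2 m by (simp add: field_simps power_divide)
      also have "\<dots> \<le> (1 / 2) ^ r * pool_weight n m j"
        by (intro mult_left_mono pool_weight_ge m j) auto
      finally have "exp (- ((1 / 2) ^ r * pool_weight n m j)) \<le> exp (- ln (4 * (real M)\<^sup>2))" by simp
      also have "\<dots> = 1 / (4 * (real M)\<^sup>2)" using m by (simp add: exp_minus field_simps)
      also have "\<dots> \<le> 1 / (4 * u\<^sup>2)"
      proof -
        have "u \<le> real j / 1" unfolding u_def using m by (intro divide_left_mono) auto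
        then have "u \<le> real M" using j by simp
        then have "u\<^sup>2 \<le> (real M)\<^sup>2" using u0 by (intro power_mono) auto
        then show ?thesis using u0 by (intro divide_left_mono) auto
      qed
      finally show ?thesis using big by simp
    qed
    then show ?thesis unfolding mj[symmetric] using False by (simp add: step_bound_def)
  qed
qed

text \<open>The first term bounds the failure of all N trials in the first graph, the second is a
  union bound over vertices that miss a link in the second. K and pm control the growth of a chain,
  N2 its late steps, and N1 gives each pool room for N discarded vertices.\<close>

lemma prob_not_percolating_le:
  fixes n r m M N :: nat and p1 p2 :: real
  assumes r: "2 \<le> r" and m: "1 \<le> m" "m < M" and rM: "r \<le> M"
    and p1: "0 \<le> p1" "p1 \<le> 1" and p2: "0 \<le> p2" "p2 \<le> 1"
    and K: "32 * (4 * real r) ^ r \<le> p1 ^ r * real n * real m ^ (r - 1)"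
    and pm: "p1 * real m \<le> 2 * real r"
    and N1: "8 * (real M * sqrt (real M)) * (real N + 1) \<le> real n * sqrt (real m)"
    and N2: "8 * 2 ^ r * (real M * sqrt (real M)) * ln (4 * (real M)\<^sup>2) \<le> real n * sqrt (real m)"
  shows "measure_pmf.prob (rsub (nsets {1..n} 2) (1 - (1 - p1) * (1 - p2)))
      {S. \<nexists>vs. percolating_order r ({1..n}, S) vs} \<le>
    (1 - exp (- (real (r + 2) * real m))) ^ N + real n * (1 - (1 - (1 - p2) ^ max 1 (M div r)) ^ r)"
proof -
  let ?V = "{1..n}" and ?E = "nsets {1..n} 2"
  have finE: "finite ?E" by (simp add: finite_imp_finite_nsets)
  define a where "a j = nat \<lfloor>2 * pool_weight n m j\<rfloor>" for j
  have pw: "real N + 1 \<le> pool_weight n m j" if "j < M" for j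
  proof -
    have "real N + 1 \<le> real n * sqrt (real m) / (8 * (real M * sqrt (real M)))"
      using N1 m by (simp add: field_simps)
    then show ?thesis using pool_weight_ge[OF m that, of n] by linarith
  qed
  \<comment> \<open>Rounding down loses less than 1, and the weight is at least N + 1; so the weight
    is still there after N removals.\<close>
  have a: "pool_weight n m j + real N \<le> real (a j)" "real (a j) \<le> 2 * pool_weight n m j" if "j < M" for j
    using pw[OF that] unfolding a_def by linarith+
  have "real (\<Sum>j<M. a j) \<le> (\<Sum>j<M. 2 * pool_weight n m j)"
    unfolding of_nat_sum by (intro sum_mono a) auto
  also have "\<dots> \<le> real n" by (rule sum_pool_weight_le[OF m])
  finally have "(\<Sum>j<M. a j) \<le> n" by (simp only: of_nat_le_iff)
  then obtain P where P: "disjoint_family_on P {..<M}" "\<And>j. j < M \<Longrightarrow> P j \<subseteq> ?V" "\<And>j. card (P j) = a j"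
    by (metis disjoint_pools)
  define s where "s j = a j - N" for j
  have sN: "s j + N = a j" and s: "pool_weight n m j \<le> real (s j)" if "j < M" for j
  proof -
    have "N \<le> a j" using a(1)[OF that] pw[OF that] by linarith
    then show "s j + N = a j" "pool_weight n m j \<le> real (s j)"
      using a(1)[OF that] by (auto simp: s_def of_nat_diff)
  qed
  have A: "measure_pmf.prob (rsub ?E p1) {S. \<not> chain r P M [] ?V S} \<le> (1 - (\<Prod>j<M. step_bound r m j)) ^ N"
  proof (rule prob_no_chain[OF finE P(1), where s = s and V = ?V])
    fix Y Q
    assume Y: "distinct Y" "set Y \<subseteq> ?V" "length Y < M" and Q: "Q \<subseteq> ?V" "Q \<inter> set Y = {}" "s (length Y) \<le> card Q"
    show "measure_pmf.prob (rsub ?E p1) {S. \<forall>v\<in>Q. \<not> linked r Y v S} \<le> 1 - step_bound r m (length Y)"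
    proof (cases "length Y = 0")
      case True
      have "0 < real (s (length Y))" using pw[OF Y(3)] s[OF Y(3)] by linarith
      then have "Q \<noteq> {}" using Q(3) by auto
      then have empty: "{S. \<forall>v\<in>Q. \<not> linked r Y v S} = {}" using True by (auto simp: linked_def)
      show ?thesis unfolding empty using True by (simp add: step_bound_def)
    next
      case False
      have "measure_pmf.prob (rsub ?E p1) {S. \<forall>v\<in>Q. \<not> linked r Y v S} \<le>
          exp (- ((min 1 (p1 * length Y / (2 * r)) / 2) ^ r * pool_weight n m (length Y)))"
        using Q(3) s[OF Y(3)] r Y Q p1 by (intro prob_none_linked_le_exp) auto
      also have "\<dots> \<le> 1 - step_bound r m (length Y)"
        using False Y(3) by (intro step_failure_le[OF r m _ _ p1(1) K pm N2]) (auto simp: Suc_le_eq)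
      finally show ?thesis .
    qed
  next
    fix i assume "i < M"
    then show "s i + N \<le> card (P i \<inter> ?V)" using P(2)[of i] P(3)[of i] sN[of i] by (simp add: Int_absorb2)
  qed (use step_bound_bounds[OF m(1)] in auto)
  have prod1: "(\<Prod>j<M. step_bound r m j) \<le> 1"
    using step_bound_bounds[OF m(1)] by (intro prod_le_1) auto
  have A': "measure_pmf.prob (rsub ?E p1) {S. \<not> chain r P M [] ?V S} \<le> (1 - exp (- (real (r + 2) * real m))) ^ N"
    by (rule order_trans[OF A]) (use prod_step_bound_ge[OF m, of r] prod1 in \<open>intro power_mono; simp\<close>)
  let ?\<delta> = "1 - (1 - (1 - p2) ^ max 1 (M div r)) ^ r"
  have \<delta>: "0 \<le> ?\<delta>" using p2 by (simp add: power_le_one)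
  let ?B = "{(S, T). \<nexists>vs. percolating_order r (?V, S \<union> T) vs}"
  have "measure_pmf.prob (rsub ?E (1 - (1 - p1) * (1 - p2))) {S. \<nexists>vs. percolating_order r (?V, S) vs} =
      measure_pmf.prob (pair_pmf (rsub ?E p1) (rsub ?E p2)) ?B"
    unfolding rsub_sprinkle[OF finE p1 p2] by (simp add: vimage_def case_prod_unfold)
  also have "\<dots> \<le> measure_pmf.prob (rsub ?E p1) {S. \<not> chain r P M [] ?V S} + real n * ?\<delta>"
  proof (rule prob_pair_pmf_le)
    fix S assume "S \<notin> {S. \<not> chain r P M [] ?V S}"
    \<comment> \<open>Y is determined by S alone, so it is a fixed list for the second
      graph.\<close>
    then obtain Y where Y: "length Y = M" "distinct Y" "set Y \<subseteq> ?V"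
      "\<And>i. i < M \<Longrightarrow> linked r (take i Y) (Y ! i) S"
      using chain_list[of r P M "[]" ?V S] by auto
    have "measure_pmf.prob (rsub ?E p2) {T. (S, T) \<in> ?B} \<le>
        measure_pmf.prob (rsub ?E p2) (\<Union>v\<in>?V - set Y. {T. \<not> linked r Y v T})"
    proof (intro measure_pmf.finite_measure_mono subsetI)
      fix T assume T: "T \<in> {T. (S, T) \<in> ?B}"
      show "T \<in> (\<Union>v\<in>?V - set Y. {T. \<not> linked r Y v T})"
      proof (rule ccontr)
        assume "T \<notin> (\<Union>v\<in>?V - set Y. {T. \<not> linked r Y v T})"
        then have "linked r Y v (S \<union> T)" if "v \<in> ?V - set Y" for v
          using that linked_mono[of r Y v T "S \<union> T"] by auto
        moreover have "linked r (take i Y) (Y ! i) (S \<union> T)" if "i < length Y" for i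
          using Y(1,4) that linked_mono[of r "take i Y" "Y ! i" S "S \<union> T"] by auto
        ultimately have "\<exists>vs. percolating_order r (?V, S \<union> T) vs"
          using Y rM by (intro percolating_order_linked[of Y]) auto
        then show False using T by auto
      qed
    qed auto
    also have "\<dots> \<le> (\<Sum>v\<in>?V - set Y. measure_pmf.prob (rsub ?E p2) {T. \<not> linked r Y v T})"
      by (intro measure_pmf.finite_measure_subadditive_finite) auto
    also have "\<dots> \<le> (\<Sum>v\<in>?V - set Y. ?\<delta>)"
      using Y p2 prob_not_linked_le[of ?V Y _ p2 r] by (intro sum_mono) auto
    also have "\<dots> \<le> (\<Sum>v\<in>?V. ?\<delta>)" using \<delta> by (intro sum_mono2) auto
    finally show "measure_pmf.prob (rsub ?E p2) {T. (S, T) \<in> ?B} \<le> real n * ?\<delta>" by simp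
  qed (use \<delta> in auto)
  finally show ?thesis using A' by simp
qed

section \<open>Above the threshold\<close>

lemma random_graph_rsub:
  "random_graph n p = map_pmf (\<lambda>S. ({1..n}, S)) (rsub (nsets {1..n} 2) p)"
  by (simp add: random_graph_def rsub_def complete_graph_on_def pmf.map_comp comp_def)

lemma whpI:
  assumes "\<forall>\<^sub>F n in sequentially. measure_pmf.prob (rsub (nsets {1..n} 2) (p n)) {S. \<not> P n ({1..n}, S)} \<le> f n"
    and "f \<longlonglongrightarrow> 0"
  shows "whp (\<lambda>n. random_graph n (p n)) P"
proof -
  have eq: "measure_pmf.prob (random_graph n (p n)) {G. P n G} =
      1 - measure_pmf.prob (rsub (nsets {1..n} 2) (p n)) {S. \<not> P n ({1..n}, S)}" for n
    unfolding random_graph_rsub measure_map_pmf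
    using measure_pmf.prob_compl[of "{S. \<not> P n ({1..n}, S)}" "rsub (nsets {1..n} 2) (p n)"]
    by (simp add: vimage_def set_diff_eq)
  have "(\<lambda>n. measure_pmf.prob (rsub (nsets {1..n} 2) (p n)) {S. \<not> P n ({1..n}, S)}) \<longlonglongrightarrow> 0"
    by (rule tendsto_sandwich[OF _ assms(1) tendsto_const assms(2)]) auto
  then show ?thesis unfolding whp_def eq by (auto intro: tendsto_eq_intros)
qed

lemma threshold_Suc: "threshold n (Suc r) = real n powr (- 1 / real r) * ln (real n) powr (- (real r - 1) / real r)"
  by (simp add: threshold_def)

lemma threshold_power:
  assumes "1 \<le> r" "2 \<le> n"
  shows "threshold n (Suc r) ^ r = 1 / (real n * ln (real n) ^ (r - 1))"
proof -
  have L: "0 < ln (real n)" and n: "0 < real n" and r: "0 < real r" using assms by auto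
  have "threshold n (Suc r) ^ r = threshold n (Suc r) powr real r"
    using L n by (subst powr_realpow) (auto simp: threshold_Suc)
  also have "\<dots> = (real n powr (- 1 / real r)) powr real r * (ln (real n) powr (- (real r - 1) / real r)) powr real r"
    unfolding threshold_Suc by (rule powr_mult)
  also have "\<dots> = real n powr (- 1) * ln (real n) powr (- (real r - 1))"
    unfolding powr_powr using r by simp
  also have "ln (real n) powr (- (real r - 1)) = 1 / ln (real n) ^ (r - 1)"
    using assms L by (simp add: powr_realpow[symmetric] of_nat_diff powr_minus_divide[symmetric])
  finally show ?thesis using n by (simp add: powr_minus_divide)
qed

text \<open>Cruder than \<open>threshold_power\<close> but without fractional powers of the
  logarithm; like \<open>threshold_ge\<close> it serves where a logarithmic factor can be
  wasted.\<close>

lemma threshold_le: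
  assumes "1 \<le> r" "1 \<le> ln (real n)"
  shows "threshold n (Suc r) \<le> real n powr (- 1 / real r)"
proof -
  have "ln (real n) powr (- (real r - 1) / real r) \<le> ln (real n) powr 0"
    using assms by (intro powr_mono) (auto simp: field_simps)
  then show ?thesis using assms mult_left_mono[of "ln (real n) powr (- (real r - 1) / real r)" 1 "real n powr (- 1 / real r)"]
    by (auto simp: threshold_Suc)
qed

lemma threshold_ge:
  assumes "1 \<le> r" "1 \<le> ln (real n)"
  shows "1 / (real n powr (1 / real r) * ln (real n)) \<le> threshold n (Suc r)"
proof -
  have "ln (real n) powr (- 1) \<le> ln (real n) powr (- (real r - 1) / real r)"
    using assms by (intro powr_mono) (auto simp: field_simps)
  then have "real n powr (- 1 / real r) * ln (real n) powr (- 1) \<le> threshold n (Suc r)"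
    unfolding threshold_Suc by (intro mult_left_mono) auto
  then show ?thesis using assms by (auto simp: powr_minus_divide)
qed

text \<open>In effect a union bound over the r classes, in the form of Bernoulli's
  inequality.\<close>

lemma not_linked_bound_le:
  fixes p :: real
  assumes "0 \<le> p" "p \<le> 1"
  shows "1 - (1 - (1 - p) ^ k) ^ r \<le> real r * exp (- (p * real k))"
proof -
  have "1 + real r * (- ((1 - p) ^ k)) \<le> (1 + (- ((1 - p) ^ k))) ^ r"
    using assms by (intro Bernoulli_inequality) (simp add: power_le_one)
  moreover have "(1 - p) ^ k \<le> exp (- p) ^ k"
    using assms exp_ge_add_one_self[of "- p"] by (intro power_mono) auto
  then have "real r * (1 - p) ^ k \<le> real r * exp (- (p * k))"
    by (intro mult_left_mono) (auto simp: exp_of_nat_mult[symmetric] mult.commute)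
  ultimately show ?thesis by simp
qed

text \<open>
  With this m, a single attempt succeeds with probability at least n powr (-1/16), so N = n powr (1/8)
  attempts suffice; M is chosen such that a chain of length M gives every other vertex an expected number of
  at least ln n squared neighbours in each residue class.
\<close>

lemma percolating_parameters:
  fixes r :: nat and D :: real
  assumes r: "2 \<le> r" and D: "D = 4096 * real r * (real r + 2)"
  defines "m \<equiv> \<lambda>n::nat. nat \<lfloor>ln (real n) / (16 * (real r + 2))\<rfloor>"
    and "M \<equiv> \<lambda>n::nat. nat \<lceil>real n powr (1 / real r) * ln (real n) ^ 3\<rceil>"
    and "N \<equiv> \<lambda>n::nat. nat \<lfloor>real n powr (1 / 8)\<rfloor>"
    and "p1 \<equiv> \<lambda>n. D * threshold n (Suc r)"
  shows "\<forall>\<^sub>F n in sequentially. 1 \<le> m n \<and> m n < M n \<and> r \<le> M n \<and> 0 \<le> p1 n \<and> p1 n \<le> 1 / 2 \<and>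
    32 * (4 * real r) ^ r \<le> p1 n ^ r * real n * real (m n) ^ (r - 1) \<and>
    p1 n * real (m n) \<le> 2 * real r \<and>
    8 * (real (M n) * sqrt (real (M n))) * (real (N n) + 1) \<le> real n * sqrt (real (m n)) \<and>
    8 * 2 ^ r * (real (M n) * sqrt (real (M n))) * ln (4 * (real (M n))\<^sup>2) \<le> real n * sqrt (real (m n)) \<and>
    (1 - exp (- (real (r + 2) * real (m n)))) ^ N n \<le> exp (- ((real n powr (1/8) - 1) * real n powr (- (1 / 16)))) \<and>
    ln (real n)^2 \<le> p1 n * real (max 1 (M n div r))"
proof -
  have rpos: "0 < real r" using r by simp
  have D0: "0 < D" using D r by simp
  \<comment> \<open>A bound for M valid for every r \<ge> 2. Its power 3/2 is n^(3/4) up to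
    logarithms, so a further factor n^(1/8) stays below n.\<close>
  define M0 where "M0 n = 2 * sqrt (real n) * ln (real n) ^ 3" for n :: nat
  have ev1: "\<forall>\<^sub>F n::nat in sequentially. 32 * (real r + 2) \<le> ln (real n)" by real_asymp
  have ev2: "\<forall>\<^sub>F n::nat in sequentially. 8 * (M0 n * sqrt (M0 n)) * (real n powr (1 / 8) + 1) \<le> real n"
    unfolding M0_def by real_asymp
  have ev3: "\<forall>\<^sub>F n::nat in sequentially. 8 * 2 ^ r * (M0 n * sqrt (M0 n)) * ln (4 * (M0 n)\<^sup>2) \<le> real n"
  proof -
    define K where "K = 8 * (2::real) ^ r"
    have K: "0 < K" by (simp add: K_def)
    show ?thesis unfolding K_def[symmetric] M0_def using K by real_asymp
  qed
  define a where "a = - 1 / real r"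
  have a: "a < 0" using rpos by (simp add: a_def)
  have ev4: "\<forall>\<^sub>F n::nat in sequentially. D * real n powr a * ln (real n) \<le> 1 / 2"
    using D0 a by real_asymp
  show ?thesis
    using ev1 ev2 ev3 ev4 eventually_gt_at_top[of 2]
  proof eventually_elim
    fix n :: nat assume n: "32 * (real r + 2) \<le> ln (real n)" "8 * (M0 n * sqrt (M0 n)) * (real n powr (1 / 8) + 1) \<le> real n"
      "8 * 2 ^ r * (M0 n * sqrt (M0 n)) * ln (4 * (M0 n)\<^sup>2) \<le> real n" "D * real n powr a * ln (real n) \<le> 1 / 2" "2 < n"
    define L where "L = ln (real n)"
    have L: "1 \<le> L" "r \<le> L" using n(1) by (auto simp: L_def)
    have mL: "L / (32 * (real r + 2)) \<le> real (m n)" "real (m n) \<le> L / (16 * (real r + 2))"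
    proof -
      \<comment> \<open>As q \<ge> 1, the floor of 2 q is at least q: rounding costs a factor of at
        most 2.\<close>
      define q where "q = L / (32 * (real r + 2))"
      have h: "1 \<le> q" using n(1) by (simp add: q_def L_def field_simps)
      have e: "L / (16 * (real r + 2)) = 2 * q" by (simp add: q_def divide_simps)
      have mq: "m n = nat \<lfloor>2 * q\<rfloor>" unfolding m_def L_def[symmetric] e ..
      have "real (m n) \<le> 2 * q" "q \<le> real (m n)" using h unfolding mq by linarith+
      then show "real (m n) \<le> L / (16 * (real r + 2))" "L / (32 * (real r + 2)) \<le> real (m n)"
        unfolding e q_def by auto
    qed
    have m1: "1 \<le> m n"
    proof -
      have "1 \<le> L / (32 * (real r + 2))" using n(1) by (simp add: L_def field_simps)
      then have "1 \<le> real (m n)" using mL by linarith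
      then show ?thesis by simp
    qed
    have mleL: "real (m n) * (16 * (real r + 2)) \<le> L" using mL(2) by (simp add: field_simps)
    have mL': "real (m n) < L"
    proof -
      have "real (m n) * 16 \<le> real (m n) * (16 * (real r + 2))" by (intro mult_left_mono) auto
      then show ?thesis using mleL m1 by linarith
    qed
    have nr: "1 \<le> real n powr (1 / real r)" using n rpos by (intro ge_one_powr_ge_zero) auto
    have L3: "L \<le> L ^ 3" using L self_le_power[of L 3] by simp
    have Mge: "real n powr (1 / real r) * L ^ 3 \<le> real (M n)" unfolding M_def L_def by (rule real_nat_ceiling_ge)
    have "1 * L ^ 3 \<le> real n powr (1 / real r) * L ^ 3" using nr L by (intro mult_right_mono) auto
    then have L_le_M: "L \<le> real (M n)" using L3 Mge by linarith
    have Mle: "real (M n) \<le> M0 n"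
    proof -
      have "real n powr (1 / real r) \<le> real n powr (1 / 2)" using n r by (intro powr_mono) (auto simp: field_simps)
      then have "real n powr (1 / real r) * L ^ 3 \<le> sqrt n * L ^ 3"
        using L by (intro mult_right_mono) (auto simp: powr_half_sqrt)
      moreover have "1 * 1 \<le> sqrt n * L ^ 3" using n L by (intro mult_mono) auto
      moreover have "real (M n) < real n powr (1 / real r) * L ^ 3 + 1"
      proof -
        have "real (nat \<lceil>x\<rceil>) < x + 1" if "0 \<le> x" for x :: real using that by linarith
        then show ?thesis using L by (simp add: M_def L_def)
      qed
      ultimately show ?thesis by (simp add: M0_def L_def)
    qed
    have M1: "1 \<le> real (M n)" using L_le_M L by linarith
    have p0: "0 \<le> p1 n" using D0 by (simp add: p1_def threshold_def)
    have thr: "p1 n \<le> D * real n powr a"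
      using threshold_le[of r n] r L D0 by (simp add: p1_def a_def L_def)
    have pL: "p1 n * L \<le> 1 / 2"
      using mult_right_mono[OF thr, of L] L n(4) unfolding L_def by linarith
    have c1: "p1 n \<le> 1 / 2" using pL mult_left_mono[OF L(1) p0] by simp
    have c2: "p1 n * real (m n) \<le> 2 * real r"
    proof -
      have "p1 n * real (m n) \<le> p1 n * L" using mL' p0 by (intro mult_left_mono) auto
      then show ?thesis using pL r by simp
    qed
    have c3: "32 * (4 * real r) ^ r \<le> p1 n ^ r * real n * real (m n) ^ (r - 1)"
    proof -
      \<comment> \<open>D is 32 times 4 r times b. In the r-th power the middle factor gives the
        required (4 r)^r, while b absorbs the denominator lost in m^(r - 1).\<close>
      define b where "b = 32 * (real r + 2)"
      define a4 where "a4 = 4 * real r"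
      have b: "1 \<le> b" and a4: "1 \<le> a4" using r by (auto simp: b_def a4_def)
      have Dab: "D = 32 * a4 * b" unfolding D a4_def b_def by simp
      have e: "D ^ r = 32 ^ r * a4 ^ r * b ^ r"
        unfolding Dab by (simp only: power_mult_distrib)
      have "32 ^ 1 * a4 ^ r * (b ^ (r - 1) / b ^ (r - 1)) \<le> 32 ^ r * a4 ^ r * (b ^ r / b ^ (r - 1))"
        using r a4 b by (intro mult_mono power_increasing divide_right_mono) auto
      also have "\<dots> = D ^ r * (1 / b ^ (r - 1))" unfolding e by simp
      also have "\<dots> = (D ^ r / (real n * L ^ (r - 1))) * real n * (L / b) ^ (r - 1)"
        using L n by (simp add: power_divide)
      also have "\<dots> = p1 n ^ r * real n * (L / b) ^ (r - 1)"
        using threshold_power[of r n] r n by (simp add: p1_def power_mult_distrib L_def)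
      also have "\<dots> \<le> p1 n ^ r * real n * real (m n) ^ (r - 1)"
        using p0 L mL b unfolding b_def by (intro mult_left_mono power_mono) auto
      finally show ?thesis using b by (simp add: a4_def)
    qed
    have MM: "real (M n) * sqrt (real (M n)) \<le> M0 n * sqrt (M0 n)"
      using Mle by (intro mult_mono) auto
    have nm: "real n \<le> real n * sqrt (real (m n))" using m1 mult_left_mono[of 1 "sqrt (real (m n))" "real n"] by simp
    have Nle: "real (N n) \<le> real n powr (1 / 8)" "real n powr (1/8) - 1 \<le> real (N n)"
    proof -
      have "0 \<le> real n powr (1 / 8)" by simp
      then show "real (N n) \<le> real n powr (1 / 8)" "real n powr (1/8) - 1 \<le> real (N n)"
        unfolding N_def by linarith+
    qed
    have c4: "8 * (real (M n) * sqrt (real (M n))) * (real (N n) + 1) \<le> real n * sqrt (real (m n))"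
    proof -
      have "8 * (real (M n) * sqrt (real (M n))) * (real (N n) + 1) \<le> 8 * (M0 n * sqrt (M0 n)) * (real n powr (1 / 8) + 1)"
        using MM Nle Mle M1 by (intro mult_mono) auto
      then show ?thesis using n(2) nm by linarith
    qed
    have c5: "8 * 2 ^ r * (real (M n) * sqrt (real (M n))) * ln (4 * (real (M n))\<^sup>2) \<le> real n * sqrt (real (m n))"
    proof -
      have "1 \<le> (real (M n))\<^sup>2" using M1 by simp
      then have "1 \<le> 4 * (real (M n))\<^sup>2" by linarith
      moreover have "(real (M n))\<^sup>2 \<le> (M0 n)\<^sup>2" using Mle by (intro power_mono) auto
      ultimately have "8 * 2 ^ r * (real (M n) * sqrt (real (M n))) * ln (4 * (real (M n))\<^sup>2) \<le> 8 * 2 ^ r * (M0 n * sqrt (M0 n)) * ln (4 * (M0 n)\<^sup>2)"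
        using MM Mle M1 by (intro mult_mono ln_mono) auto
      then show ?thesis using n(3) nm by linarith
    qed
    have c6: "(1 - exp (- (real (r + 2) * real (m n)))) ^ N n \<le> exp (- ((real n powr (1/8) - 1) * real n powr (- (1 / 16))))"
    proof -
      let ?x = "exp (- (real (r + 2) * real (m n)))"
      have x: "real n powr (- (1 / 16)) \<le> ?x"
        using mleL n by (simp add: powr_def L_def algebra_simps)
      have "(1 - ?x) ^ N n \<le> exp (- ?x) ^ N n"
        using exp_ge_add_one_self[of "- ?x"] by (intro power_mono) auto
      also have "\<dots> = exp (- (real (N n) * ?x))" by (simp add: exp_of_nat_mult[symmetric])
      also have "\<dots> \<le> exp (- ((real n powr (1/8) - 1) * real n powr (- (1 / 16))))"
        using Nle x n by (simp, intro mult_mono) (auto intro: ge_one_powr_ge_zero)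
      finally show ?thesis .
    qed
    have c7: "ln (real n)^2 \<le> p1 n * real (max 1 (M n div r))"
    proof -
      have "ln (real n) ^ 2 \<le> D * (L ^ 2 / (2 * r))" 
      proof -
        have "2 * real r \<le> D" unfolding D by (simp add: field_simps)
        then have "L ^ 2 * (2 * r) \<le> L ^ 2 * D" by (intro mult_left_mono) auto
        then show ?thesis using rpos by (simp add: L_def field_simps)
      qed
      \<comment> \<open>Of the three logarithms in M one is lost to \<open>threshold_ge\<close>; the
        remaining two make the union bound over n vertices tend to 0.\<close>
      also have "\<dots> = D * (1 / (real n powr (1 / real r) * L)) * (real n powr (1 / real r) * L ^ 3 / (2 * r))"
        using nr L n by (simp add: power2_eq_square power3_eq_cube)
      also have "\<dots> \<le> p1 n * (real (M n) / (2 * r))"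
        unfolding p1_def using threshold_ge[of r n] D0 L r Mge
        by (intro mult_mono mult_left_mono divide_right_mono) (auto simp: L_def threshold_def)
      also have "\<dots> \<le> p1 n * real (max 1 (M n div r))"
        using real_half_div_le[of r "M n"] r p0 by (intro mult_left_mono) auto
      finally show ?thesis .
    qed
    show "1 \<le> m n \<and> m n < M n \<and> r \<le> M n \<and> 0 \<le> p1 n \<and> p1 n \<le> 1 / 2 \<and>
    32 * (4 * real r) ^ r \<le> p1 n ^ r * real n * real (m n) ^ (r - 1) \<and>
    p1 n * real (m n) \<le> 2 * real r \<and>
    8 * (real (M n) * sqrt (real (M n))) * (real (N n) + 1) \<le> real n * sqrt (real (m n)) \<and>
    8 * 2 ^ r * (real (M n) * sqrt (real (M n))) * ln (4 * (real (M n))\<^sup>2) \<le> real n * sqrt (real (m n)) \<and>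
    (1 - exp (- (real (r + 2) * real (m n)))) ^ N n \<le> exp (- ((real n powr (1/8) - 1) * real n powr (- (1 / 16)))) \<and>
    ln (real n)^2 \<le> p1 n * real (max 1 (M n div r))"
      using m1 mL' L_le_M L p0 c1 c2 c3 c4 c5 c6 c7 by (auto simp flip: of_nat_less_iff of_nat_le_iff)
  qed
qed


lemma whp_wsat_eq:
  assumes r: "2 \<le> r" and D: "D = 4096 * real r * (real r + 2)" and p: "\<And>n. p n \<le> 1"
    and lower: "\<forall>\<^sub>F n in sequentially. 2 * D * threshold n (Suc r) < p n"
  shows "whp (\<lambda>n. random_graph n (p n))
    (\<lambda>n G. wsat G (star_graph (Suc r)) = wsat (complete_graph_on n) (star_graph (Suc r)))"
proof (rule whpI)
  define f where "f n = exp (- ((real n powr (1/8) - 1) * real n powr (- (1 / 16)))) +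
      real r * (real n * exp (- (ln (real n)^2)))" for n :: nat
  have "(\<lambda>n. exp (- ((real n powr (1/8) - 1) * real n powr (- (1 / 16))))) \<longlonglongrightarrow> 0" by real_asymp
  moreover have "(\<lambda>n. real n * exp (- (ln (real n)^2))) \<longlonglongrightarrow> 0" by real_asymp
  ultimately show "f \<longlonglongrightarrow> 0"
    unfolding f_def by (intro tendsto_add_zero tendsto_mult_right_zero)
  have "\<forall>\<^sub>F n::nat in sequentially. Suc r + 2 * (Suc r choose 2) \<le> n" by (rule eventually_ge_at_top)
  with percolating_parameters[OF r D] lower
  show "\<forall>\<^sub>F n in sequentially. measure_pmf.prob (rsub (nsets {1..n} 2) (p n))
      {S. \<not> wsat ({1..n}, S) (star_graph (Suc r)) = wsat (complete_graph_on n) (star_graph (Suc r))} \<le> f n"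
  proof eventually_elim
    case (elim n)
    define p1 where "p1 = D * threshold n (Suc r)"
    \<comment> \<open>The solution of 1 - p = (1 - p1) (1 - p2). As p exceeds 2 p1, it is at least
      p1.\<close>
    define p2 where "p2 = (p n - p1) / (1 - p1)"
    define M where "M = nat \<lceil>real n powr (1 / real r) * ln (real n) ^ 3\<rceil>"
    define m where "m = nat \<lfloor>ln (real n) / (16 * (real r + 2))\<rfloor>"
    define N where "N = nat \<lfloor>real n powr (1 / 8)\<rfloor>"
    note e = elim(1)[folded p1_def M_def m_def N_def]
    have p1: "0 \<le> p1" "p1 \<le> 1 / 2" using e by auto
    have pn: "2 * p1 < p n" using elim(2) by (simp add: p1_def)
    have p2: "0 \<le> p2" "p2 \<le> 1" using p1 pn p[of n] by (auto simp: p2_def field_simps)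
    have "p1 * (1 - p1) \<le> p1 * 1" using p1 by (intro mult_left_mono) auto
    then have p12: "p1 \<le> p2" using p1 pn by (simp add: p2_def pos_le_divide_eq)
    have pp: "p n = 1 - (1 - p1) * (1 - p2)" using p1 by (simp add: p2_def field_simps)
    let ?bad = "{S. \<not> wsat ({1..n}, S) (star_graph (Suc r)) = wsat (complete_graph_on n) (star_graph (Suc r))}"
    have "measure_pmf.prob (rsub (nsets {1..n} 2) (p n)) ?bad \<le>
        measure_pmf.prob (rsub (nsets {1..n} 2) (p n)) {S. \<nexists>vs. percolating_order r ({1..n}, S) vs}"
    proof (rule measure_pmf.finite_measure_mono_AE)
      show "AE S in rsub (nsets {1..n} 2) (p n). S \<in> ?bad \<longrightarrow> S \<in> {S. \<nexists>vs. percolating_order r ({1..n}, S) vs}"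
        using elim(3) set_pmf_rsub[of "nsets {1..n} 2" "p n"] wsat_star_eq[of "({1..n}, _)" r]
        by (auto simp: AE_measure_pmf_iff wsat_complete_graph_star)
    qed simp
    also have "\<dots> \<le> (1 - exp (- (real (r + 2) * real m))) ^ N + real n * (1 - (1 - (1 - p2) ^ max 1 (M div r)) ^ r)"
      unfolding pp using e p1 p2 r by (intro prob_not_percolating_le) auto
    also have "\<dots> \<le> f n"
      unfolding f_def
    proof (intro add_mono)
      have "ln (real n)^2 \<le> p1 * real (max 1 (M div r))" using e by blast
      also have "\<dots> \<le> p2 * real (max 1 (M div r))" using p12 by (intro mult_right_mono) auto
      finally have "real r * exp (- (p2 * real (max 1 (M div r)))) \<le> real r * exp (- (ln (real n)^2))"
        by (intro mult_left_mono) auto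
      then have "real n * (1 - (1 - (1 - p2) ^ max 1 (M div r)) ^ r) \<le> real n * (real r * exp (- (ln (real n)^2)))"
        using not_linked_bound_le[OF p2, of "max 1 (M div r)" r] by (intro mult_left_mono) auto
      then show "real n * (1 - (1 - (1 - p2) ^ max 1 (M div r)) ^ r) \<le> real r * (real n * exp (- (ln (real n)^2)))"
        by (simp add: mult.left_commute)
    qed (use e in blast)
    finally show ?case .
  qed
qed

section \<open>Below the threshold\<close>

lemma real_choose_le:
  assumes "1 \<le> s"
  shows "real (a choose s) \<le> (exp 1 * real a / real s) ^ s"
proof -
  have "real (a choose s) * fact s \<le> real a ^ s"
    using of_nat_mono[OF binomial_fact_pow[of a s], where 'a = real] by simp
  then have "real (a choose s) \<le> real a ^ s / fact s" by (simp add: field_simps)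
  also have "\<dots> = (real s ^ s / fact s) * (real a / real s) ^ s" using assms by (simp add: power_divide)
  also have "\<dots> \<le> exp (real s) * (real a / real s) ^ s"
    using power_div_fact_le_exp[of "real s" s] by (intro mult_right_mono) auto
  also have "exp (real s) = exp 1 ^ s" by (simp flip: exp_of_nat_mult)
  also have "exp 1 ^ s * (real a / real s) ^ s = (exp 1 * real a / real s) ^ s"
    by (simp add: power_mult_distrib power_divide)
  finally show ?thesis .
qed

lemma two_times_choose_two: "2 * (n choose 2) = n * (n - 1)"
proof -
  have "even (n * (n - 1))" by (cases n) auto
  then show ?thesis unfolding choose_two by (rule dvd_mult_div_cancel)
qed

lemma real_choose_two_le: "real (n choose 2) \<le> (real n)\<^sup>2 / 2"
proof -
  have "2 * (n choose 2) = n * (n - 1)" by (rule two_times_choose_two)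
  also have "\<dots> \<le> n * n" by simp
  finally have "real (2 * (n choose 2)) \<le> real (n * n)" by (rule of_nat_mono)
  then show ?thesis by (simp add: power2_eq_square)
qed

lemma real_choose_two_ge:
  assumes "2 \<le> n"
  shows "(real n)\<^sup>2 / 4 \<le> real (n choose 2)"
proof -
  have "n * n \<le> n * (2 * (n - 1))" using assms by (intro mult_le_mono2) auto
  also have "\<dots> = 4 * (n choose 2)" using two_times_choose_two[of n] by simp
  finally have "real (n * n) \<le> real (4 * (n choose 2))" by (rule of_nat_mono)
  then show ?thesis by (simp add: power2_eq_square)
qed

text \<open>A set that leaves E is never contained in the random set, so union bounds may include
  degenerate D.\<close>

lemma prob_rsub_superset_le:
  assumes "finite E" "0 \<le> p" "p \<le> 1" "0 < card D"
  shows "measure_pmf.prob (rsub E p) {S. D \<subseteq> S} \<le> p ^ card D"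
proof (cases "D \<subseteq> E")
  case True
  then show ?thesis using prob_rsub_superset[of E D p] assms by simp
next
  case False
  then have "measure_pmf.prob (rsub E p) {S. D \<subseteq> S} = 0"
    using set_pmf_rsub[of E p] by (auto simp: measure_pmf_zero_iff)
  then show ?thesis using assms by simp
qed

text \<open>First moment over a k-set together with exactly s of its pairs, which avoids the tail of
  a binomial distribution.\<close>

lemma prob_dense_subset_le:
  assumes V: "finite V" and p: "0 \<le> p" "p \<le> 1" and s: "0 < s"
  shows "measure_pmf.prob (rsub (nsets V 2) p) {E. \<exists>S\<subseteq>V. card S = k \<and> s \<le> card (E \<inter> nsets S 2)} \<le>
    real (card V choose k) * real ((k choose 2) choose s) * p ^ s"
proof -
  let ?M = "rsub (nsets V 2) p"
  let ?X = "SIGMA S : nsets V k. nsets (nsets S 2) s"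
  have finE: "finite (nsets V 2)" using V by (simp add: finite_imp_finite_nsets)
  have finS: "finite S" if "S \<in> nsets V k" for S using that by (simp add: nsets_def)
  have finX: "finite ?X" using V finS by (intro finite_SigmaI finite_imp_finite_nsets) auto
  have "measure_pmf.prob ?M {E. \<exists>S\<subseteq>V. card S = k \<and> s \<le> card (E \<inter> nsets S 2)} \<le>
      measure_pmf.prob ?M (\<Union>(S, D)\<in>?X. {E. D \<subseteq> E})"
  proof (intro measure_pmf.finite_measure_mono subsetI)
    fix E assume "E \<in> {E. \<exists>S\<subseteq>V. card S = k \<and> s \<le> card (E \<inter> nsets S 2)}"
    then obtain S where S: "S \<subseteq> V" "card S = k" "s \<le> card (E \<inter> nsets S 2)" by auto
    obtain D where "D \<subseteq> E \<inter> nsets S 2" "card D = s" "finite D"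
      using obtain_subset_with_card_n[OF S(3)] by metis
    then have "(S, D) \<in> ?X" "D \<subseteq> E" using S V finite_subset[of S V] by (auto simp: nsets_def)
    then show "E \<in> (\<Union>(S, D)\<in>?X. {E. D \<subseteq> E})" by auto
  qed auto
  also have "\<dots> \<le> (\<Sum>x\<in>?X. measure_pmf.prob ?M (case x of (S, D) \<Rightarrow> {E. D \<subseteq> E}))"
    by (intro measure_pmf.finite_measure_subadditive_finite finX) auto
  also have "\<dots> \<le> (\<Sum>x\<in>?X. p ^ s)"
  proof (intro sum_mono)
    fix x assume "x \<in> ?X"
    then obtain S D where x: "x = (S, D)" "card D = s" by (auto simp: nsets_def)
    then show "measure_pmf.prob ?M (case x of (S, D) \<Rightarrow> {E. D \<subseteq> E}) \<le> p ^ s"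
      using prob_rsub_superset_le[OF finE p, of D] s by simp
  qed
  also have "\<dots> = real (card ?X) * p ^ s" by simp
  also have "card ?X = (\<Sum>S\<in>nsets V k. card (nsets (nsets S 2) s))"
    using V finS by (intro card_SigmaI) (auto intro!: finite_imp_finite_nsets)
  also have "\<dots> = (\<Sum>S\<in>nsets V k. (k choose 2) choose s)"
    using finS by (intro sum.cong refl) (simp, simp add: nsets_def)
  also have "\<dots> = (card V choose k) * ((k choose 2) choose s)"
    using V by simp
  finally show ?thesis by simp
qed

text \<open>A cover can be enlarged to exactly b vertices; then all pairs avoiding it are
  absent.\<close>

lemma prob_small_cover_le:
  assumes V: "finite V" and p: "0 \<le> p" "p \<le> 1" and b: "b \<le> card V"
  shows "measure_pmf.prob (rsub (nsets V 2) p) {E. \<exists>B\<subseteq>V. card B \<le> b \<and> (\<forall>e\<in>E. e \<inter> B \<noteq> {})} \<le>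
    real (card V choose b) * (1 - p) ^ ((card V - b) choose 2)"
proof -
  let ?M = "rsub (nsets V 2) p"
  have finE: "finite (nsets V 2)" using V by (simp add: finite_imp_finite_nsets)
  have finB: "finite (nsets V b)" using V by (rule finite_imp_finite_nsets)
  have "measure_pmf.prob ?M {E. \<exists>B\<subseteq>V. card B \<le> b \<and> (\<forall>e\<in>E. e \<inter> B \<noteq> {})} \<le>
      measure_pmf.prob ?M (\<Union>B\<in>nsets V b. {E. E \<inter> nsets (V - B) 2 = {}})"
  proof (intro measure_pmf.finite_measure_mono subsetI)
    fix E assume "E \<in> {E. \<exists>B\<subseteq>V. card B \<le> b \<and> (\<forall>e\<in>E. e \<inter> B \<noteq> {})}"
    then obtain B where B: "B \<subseteq> V" "card B \<le> b" "\<And>e. e \<in> E \<Longrightarrow> e \<inter> B \<noteq> {}" by auto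
    obtain B' where B': "B \<subseteq> B'" "B' \<subseteq> V" "card B' = b"
      using exists_subset_between[OF B(2) b B(1) V] by auto
    have "E \<inter> nsets (V - B') 2 = {}" using B(3) B'(1) by (fastforce simp: nsets_def)
    moreover have "B' \<in> nsets V b" using B' V finite_subset[of B' V] by (auto simp: nsets_def)
    ultimately show "E \<in> (\<Union>B\<in>nsets V b. {E. E \<inter> nsets (V - B) 2 = {}})" by auto
  qed auto
  also have "\<dots> \<le> (\<Sum>B\<in>nsets V b. measure_pmf.prob ?M {E. E \<inter> nsets (V - B) 2 = {}})"
    by (intro measure_pmf.finite_measure_subadditive_finite finB) auto
  also have "\<dots> = (\<Sum>B\<in>nsets V b. (1 - p) ^ ((card V - b) choose 2))"
  proof (intro sum.cong refl)
    fix B assume B: "B \<in> nsets V b"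
    have "nsets (V - B) 2 \<subseteq> nsets V 2" by (auto simp: nsets_def)
    moreover have "card (V - B) = card V - b" using B V by (auto simp: nsets_def card_Diff_subset)
    ultimately show "measure_pmf.prob ?M {E. E \<inter> nsets (V - B) 2 = {}} = (1 - p) ^ ((card V - b) choose 2)"
      using prob_rsub_disjoint[OF finE _ p, of "nsets (V - B) 2"] V by simp
  qed
  also have "\<dots> = real (card V choose b) * (1 - p) ^ ((card V - b) choose 2)"
    using V by simp
  finally show ?thesis .
qed

text \<open>Among k disjoint blocks of size a, a set with fewer than k elements misses one. This
  crude lower tail is enough because it is applied with constant k.\<close>

lemma prob_card_less_le:
  assumes E: "finite E" and p: "0 \<le> p" "p \<le> 1" and ka: "k * a \<le> card E"
  shows "measure_pmf.prob (rsub E p) {S. card S < k} \<le> real k * (1 - p) ^ a"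
proof -
  obtain P :: "nat \<Rightarrow> nat set" where P: "disjoint_family_on P {..<k}"
      "\<And>j. j < k \<Longrightarrow> P j \<subseteq> {1..card E}" "\<And>j. card (P j) = a"
    using disjoint_pools[of "\<lambda>_. a" k "card E"] ka by auto
  obtain f where f: "bij_betw f {1..card E} E" using ex_bij_betw_nat_finite_1[OF E] by auto
  have sub: "f ` P j \<subseteq> E" if "j < k" for j using P(2)[OF that] f by (auto simp: bij_betw_def)
  have card: "card (f ` P j) = a" if "j < k" for j
    using P(2)[OF that] P(3) f by (subst card_image) (auto simp: bij_betw_def intro: inj_on_subset)
  have disj: "disjoint_family_on (\<lambda>j. f ` P j) {..<k}"
    unfolding disjoint_family_on_def
  proof (intro ballI impI)
    fix i j assume ij: "i \<in> {..<k}" "j \<in> {..<k}" "i \<noteq> j"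
    then have "f ` P i \<inter> f ` P j = f ` (P i \<inter> P j)"
      using f P(2) by (intro inj_on_image_Int[symmetric, of f "{1..card E}"]) (auto simp: bij_betw_def)
    then show "f ` P i \<inter> f ` P j = {}" using P(1) ij by (auto simp: disjoint_family_on_def)
  qed
  have "measure_pmf.prob (rsub E p) {S. card S < k} \<le>
      measure_pmf.prob (rsub E p) (\<Union>j<k. {S. S \<inter> f ` P j = {}})"
  proof (rule measure_pmf.finite_measure_mono_AE)
    have sub_less: "\<exists>j<k. S \<inter> f ` P j = {}" if S: "S \<subseteq> E" "card S < k" for S
    proof (rule ccontr)
      assume "\<not> ?thesis"
      then have "\<forall>j. \<exists>x. j < k \<longrightarrow> x \<in> S \<inter> f ` P j" by blast
      then obtain g where g: "\<And>j. j < k \<Longrightarrow> g j \<in> S \<inter> f ` P j" by metis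
      have "inj_on g {..<k}"
      proof (rule inj_onI, rule ccontr)
        fix i j assume ij: "i \<in> {..<k}" "j \<in> {..<k}" "g i = g j" "i \<noteq> j"
        then have "g i \<in> f ` P i \<inter> f ` P j" using g[of i] g[of j] by auto
        then show False using disj ij unfolding disjoint_family_on_def by blast
      qed
      then have "card {..<k} \<le> card S"
        using g finite_subset[OF S(1) E] by (intro card_inj_on_le) auto
      then show False using S by simp
    qed
    show "AE S in rsub E p. S \<in> {S. card S < k} \<longrightarrow> S \<in> (\<Union>j<k. {S. S \<inter> f ` P j = {}})"
      unfolding AE_measure_pmf_iff
    proof (intro ballI impI)
      fix S assume "S \<in> set_pmf (rsub E p)" "S \<in> {S. card S < k}"
      then obtain j where "j < k" "S \<inter> f ` P j = {}" using set_pmf_rsub[of E p] sub_less[of S] by auto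
      then show "S \<in> (\<Union>j<k. {S. S \<inter> f ` P j = {}})" by auto
    qed
  qed simp
  also have "\<dots> \<le> (\<Sum>j<k. measure_pmf.prob (rsub E p) {S. S \<inter> f ` P j = {}})"
    by (intro measure_pmf.finite_measure_subadditive_finite) auto
  also have "\<dots> = (\<Sum>j<k. (1 - p) ^ a)"
    using prob_rsub_disjoint[OF E sub p] card by (intro sum.cong) auto
  finally show ?thesis by simp
qed

text \<open>The union also runs over d-sets X that contain v; then {v} would have to be an edge, a
  case covered by \<open>prob_rsub_superset_le\<close>.\<close>

lemma prob_large_degree_le:
  assumes V: "finite V" and p: "0 \<le> p" "p \<le> 1" and d: "0 < d"
  shows "measure_pmf.prob (rsub (nsets V 2) p) {S. \<exists>v\<in>V. d \<le> card {e \<in> S. v \<in> e}} \<le>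
    real (card V) * real (card V choose d) * p ^ d"
proof -
  let ?M = "rsub (nsets V 2) p"
  let ?D = "\<lambda>v X. (\<lambda>x. {v, x}) ` X"
  have finE: "finite (nsets V 2)" using V by (simp add: finite_imp_finite_nsets)
  have finX: "finite (V \<times> nsets V d)" using V by (simp add: finite_imp_finite_nsets)
  have "measure_pmf.prob ?M {S. \<exists>v\<in>V. d \<le> card {e \<in> S. v \<in> e}} \<le>
      measure_pmf.prob ?M (\<Union>(v, X)\<in>V \<times> nsets V d. {S. ?D v X \<subseteq> S})"
  proof (rule measure_pmf.finite_measure_mono_AE)
    have X: "\<exists>X\<in>nsets V d. ?D v X \<subseteq> S" if S: "S \<subseteq> nsets V 2" "v \<in> V" "d \<le> card {e \<in> S. v \<in> e}" for S v
    proof -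
      have "d \<le> card {x. {v, x} \<in> S}" using card_edges_at[OF V S(1)] S(3) by simp
      from obtain_subset_with_card_n[OF this]
      obtain X where X: "X \<subseteq> {x. {v, x} \<in> S}" "card X = d" "finite X" .
      moreover have "x \<in> V" if "{v, x} \<in> S" for x using that S(1) by (auto simp: nsets_def)
      ultimately have "X \<in> nsets V d" by (auto simp: nsets_def)
      then show ?thesis using X by blast
    qed
    show "AE S in ?M. S \<in> {S. \<exists>v\<in>V. d \<le> card {e \<in> S. v \<in> e}} \<longrightarrow>
        S \<in> (\<Union>(v, X)\<in>V \<times> nsets V d. {S. ?D v X \<subseteq> S})"
      unfolding AE_measure_pmf_iff
    proof (intro ballI impI)
      fix S assume "S \<in> set_pmf ?M" "S \<in> {S. \<exists>v\<in>V. d \<le> card {e \<in> S. v \<in> e}}"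
      then obtain v where v: "v \<in> V" "d \<le> card {e \<in> S. v \<in> e}" "S \<subseteq> nsets V 2"
        using set_pmf_rsub[of "nsets V 2" p] by auto
      obtain X where "X \<in> nsets V d" "?D v X \<subseteq> S" using X[OF v(3,1,2)] by auto
      then show "S \<in> (\<Union>(v, X)\<in>V \<times> nsets V d. {S. ?D v X \<subseteq> S})"
        using v(1) by (intro UN_I[of "(v, X)"]) auto
    qed
  qed simp
  also have "\<dots> \<le> (\<Sum>x\<in>V \<times> nsets V d. measure_pmf.prob ?M (case x of (v, X) \<Rightarrow> {S. ?D v X \<subseteq> S}))"
    by (intro measure_pmf.finite_measure_subadditive_finite finX) auto
  also have "\<dots> \<le> (\<Sum>x\<in>V \<times> nsets V d. p ^ d)"
  proof (intro sum_mono)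
    fix x assume "x \<in> V \<times> nsets V d"
    then obtain v X where x: "x = (v, X)" "card X = d" by (auto simp: nsets_def)
    have "card (?D v X) = d"
      using x by (subst card_image) (auto simp: inj_on_def doubleton_eq_iff)
    then show "measure_pmf.prob ?M (case x of (v, X) \<Rightarrow> {S. ?D v X \<subseteq> S}) \<le> p ^ d"
      using prob_rsub_superset_le[OF finE p, of "?D v X"] d x by simp
  qed
  also have "\<dots> = real (card V) * real (card V choose d) * p ^ d"
    using V by (simp add: card_cartesian_product)
  finally show ?thesis .
qed

section \<open>First moment for dense sets of about ln n vertices\<close>

text \<open>By L * threshold = (L / n)^(1/r), the factor n / L for choosing a vertex cancels against
  L / n for its r edges, and constants remain. The 2 a missing edges cost at most n^(2 a). The
  exponent 2 a + 3 is made for this: two units cancel the factors e of the binomial coefficients, 2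
  a units beat n^(2 a) since k \<ge> ln n, and the last one leaves 1 / n.\<close>

lemma dense_subset_bound_le:
  fixes p :: real
  assumes r: "2 \<le> r" and k: "k = nat \<lceil>ln (real n)\<rceil>" "2 * a \<le> k" and L: "1 \<le> ln (real n)"
    and p: "0 \<le> p" "p \<le> exp (- (2 * real a + 3)) * threshold n (Suc r)"
  shows "real (n choose k) * real ((k choose 2) choose (r * k - 2 * a)) * p ^ (r * k - 2 * a) \<le> 1 / real n"
proof -
  define L where "L = ln (real n)"
  define s where "s = r * k - 2 * a"
  have L1: "1 \<le> L" using assms by (simp add: L_def)
  have n: "1 < real n" using L by (cases "n \<le> 1") (auto simp: not_le le_Suc_eq)
  have Ln: "L \<le> real n" using n ln_le_minus_one[of "real n"] by (simp add: L_def)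
  have kL: "L \<le> real k" "real k \<le> 2 * L" and k1: "1 \<le> k"
    using L1 k(1) unfolding L_def by linarith+
  \<comment> \<open>The bound s \<ge> k is used twice: to get (k choose 2) / s \<le> k / 2 \<le> L,
    and to lower the exponent of the small constant from s to k.\<close>
  have "2 * k \<le> r * k" using r by (rule mult_le_mono1)
  then have sk: "k \<le> s" "s + 2 * a = r * k" using k(2) unfolding s_def by linarith+
  have srk: "real s / real r = real k - 2 * real a / real r"
  proof -
    have "real s + 2 * real a = real r * real k" using arg_cong[OF sk(2), of real] by simp
    then show ?thesis using r by (simp add: field_simps)
  qed
  have 1: "real (n choose k) \<le> (exp 1 * real n / L) ^ k"
  proof -
    have "exp 1 * real n / real k \<le> exp 1 * real n / L" using kL L1 by (intro divide_left_mono) auto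
    then show ?thesis by (intro order_trans[OF real_choose_le[OF k1]] power_mono) auto
  qed
  have "real (k choose 2) / real s \<le> (real k)\<^sup>2 / 2 / real k"
    using sk k1 real_choose_two_le[of k] by (intro frac_le) auto
  also have "\<dots> \<le> L" using kL k1 by (simp add: power2_eq_square)
  finally have Ks: "real (k choose 2) / real s \<le> L" .
  have Lthr: "L * threshold n (Suc r) = (L / real n) powr (1 / real r)"
  proof -
    have "L * threshold n (Suc r) = L powr 1 * (real n powr (- (1 / real r)) * L powr (- (real r - 1) / real r))"
      using L1 by (simp add: threshold_Suc L_def)
    also have "\<dots> = L powr (1 + - (real r - 1) / real r) * real n powr (- (1 / real r))"
      by (simp only: powr_add mult_ac)
    also have "1 + - (real r - 1) / real r = 1 / real r" using r by (simp add: field_simps)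
    finally show ?thesis using L1 n by (simp add: powr_divide powr_minus_divide)
  qed
  have "exp 1 * L * p \<le> exp 1 * L * (exp (- (2 * real a + 3)) * threshold n (Suc r))"
    using p L1 by (intro mult_left_mono) auto
  also have "\<dots> = exp 1 * (exp (- (2 * real a + 3)) * (L / real n) powr (1 / real r))"
    unfolding Lthr[symmetric] by (simp only: mult_ac)
  also have "\<dots> = exp (- (2 * real a + 2)) * (L / real n) powr (1 / real r)"
    by (simp flip: exp_add mult.assoc)
  finally have eLp: "exp 1 * L * p \<le> exp (- (2 * real a + 2)) * (L / real n) powr (1 / real r)" .
  have "real ((k choose 2) choose s) * p ^ s \<le> (exp 1 * real (k choose 2) / real s) ^ s * p ^ s"
    using real_choose_le[of s "k choose 2"] sk k1 p by (intro mult_right_mono) auto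
  also have "\<dots> = (exp 1 * (real (k choose 2) / real s) * p) ^ s"
    by (simp only: power_mult_distrib[symmetric] times_divide_eq_right)
  also have "\<dots> \<le> (exp (- (2 * real a + 2)) * (L / real n) powr (1 / real r)) ^ s"
  proof (intro power_mono)
    have "exp 1 * (real (k choose 2) / real s) * p \<le> exp 1 * L * p"
      using Ks p by (intro mult_right_mono mult_left_mono) auto
    then show "exp 1 * (real (k choose 2) / real s) * p \<le> exp (- (2 * real a + 2)) * (L / real n) powr (1 / real r)"
      using eLp by linarith
  qed (use p in auto)
  also have "\<dots> = exp (- (2 * real a + 2)) ^ s * (L / real n) powr (real s / real r)"
    using L1 n by (simp add: power_mult_distrib powr_powr flip: powr_realpow)
  also have "\<dots> \<le> exp (- (2 * real a + 2)) ^ k * ((L / real n) ^ k * real n powr (2 * real a))"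
  proof (intro mult_mono power_decreasing sk)
    have "(L / real n) powr (real s / real r) = (L / real n) ^ k * (real n / L) powr (2 * real a / real r)"
      unfolding srk powr_diff using L1 n by (simp add: powr_realpow powr_divide power_divide)
    also have "\<dots> \<le> (L / real n) ^ k * real n powr (2 * real a)"
    proof (intro mult_left_mono)
      have "(real n / L) powr (2 * real a / real r) \<le> real n powr (2 * real a / real r)"
        using L1 n by (intro powr_mono2) (auto simp: field_simps)
      also have "\<dots> \<le> real n powr (2 * real a)"
        using n r mult_left_mono[of 1 "real r" "2 * real a"] by (intro powr_mono) (auto simp: field_simps)
      finally show "(real n / L) powr (2 * real a / real r) \<le> real n powr (2 * real a)" .
    qed (use L1 in auto)
    finally show "(L / real n) powr (real s / real r) \<le> (L / real n) ^ k * real n powr (2 * real a)" .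
  qed auto
  finally have 2: "real ((k choose 2) choose s) * p ^ s \<le>
      exp (- (2 * real a + 2)) ^ k * ((L / real n) ^ k * real n powr (2 * real a))" .
  have "real (n choose k) * (real ((k choose 2) choose s) * p ^ s) \<le>
      (exp 1 * real n / L) ^ k * (exp (- (2 * real a + 2)) ^ k * ((L / real n) ^ k * real n powr (2 * real a)))"
    using L1 p by (intro mult_mono 1 2) auto
  also have "\<dots> = (exp 1 * real n / L * exp (- (2 * real a + 2)) * (L / real n)) ^ k * real n powr (2 * real a)"
    by (simp only: power_mult_distrib mult.assoc)
  also have "exp 1 * real n / L * exp (- (2 * real a + 2)) * (L / real n) = exp (- (2 * real a + 1))"
    using L1 n by (simp flip: exp_add)
  also have "exp (- (2 * real a + 1)) ^ k * real n powr (2 * real a) \<le>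
      real n powr (- (2 * real a + 1)) * real n powr (2 * real a)"
  proof (intro mult_right_mono)
    have "exp (- (2 * real a + 1)) ^ k = exp (- ((2 * real a + 1) * real k))"
      by (simp flip: exp_of_nat_mult) (simp add: algebra_simps)
    also have "\<dots> \<le> exp (- ((2 * real a + 1) * L))" using kL by (simp add: mult_left_mono)
    also have "\<dots> = real n powr (- (2 * real a + 1))" using n by (simp add: powr_def L_def algebra_simps)
    finally show "exp (- (2 * real a + 1)) ^ k \<le> real n powr (- (2 * real a + 1))" .
  qed simp
  also have "real n powr (- (2 * real a + 1)) * real n powr (2 * real a) = real n powr (- 1)"
    by (simp flip: powr_add)
  also have "\<dots> = 1 / real n" using n by (simp add: powr_minus_divide)
  finally show ?thesis by (simp add: s_def mult.assoc)
qed

lemma obtain_weakly_saturated_wsat: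
  obtains F where "weakly_saturated G H F" "card (edges F) = wsat G H"
proof -
  have "weakly_saturated G H G" by (auto simp: weakly_saturated_def spanning_subgraph_def)
  then have "\<exists>F. weakly_saturated G H F \<and> card (edges F) = wsat G H"
    unfolding wsat_def by (intro LeastI_ex[where P = "\<lambda>k. \<exists>F. weakly_saturated G H F \<and> card (edges F) = k"]) blast
  then show ?thesis using that by blast
qed

section \<open>The two density regimes below the threshold\<close>

text \<open>A vertex of degree 3 has probability at most n^4 p^3 \<le> n^(-1/2). Otherwise all
  degrees are at most 2 \<le> r, so F is all of G and G has only a edges; the second term bounds
  this and is small once p n^2 is large.\<close>

lemma prob_wsat_sparse_le:
  fixes p :: real and n r :: nat
  defines "a \<equiv> Suc r choose 2"
  assumes r: "2 \<le> r" and n: "2 \<le> n" and p: "0 \<le> p" "p \<le> real n powr (- 3 / 2)"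
  shows "measure_pmf.prob (rsub (nsets {1..n} 2) p) {S. wsat ({1..n}, S) (star_graph (Suc r)) = a} \<le>
    real n powr (- 1 / 2) + real (Suc a) * exp (1 - p * (real n)\<^sup>2 / (4 * real (Suc a)))"
proof -
  let ?V = "{1..n}" let ?E = "nsets {1..n} 2"
  have finE: "finite ?E" by (simp add: finite_imp_finite_nsets)
  have "real n powr (- 3 / 2) \<le> real n powr 0" using n by (intro powr_mono) auto
  then have p1: "p \<le> 1" using p n by simp
  have "measure_pmf.prob (rsub ?E p) {S. wsat (?V, S) (star_graph (Suc r)) = a} \<le>
      measure_pmf.prob (rsub ?E p) ({S. \<exists>v\<in>?V. 3 \<le> card {e \<in> S. v \<in> e}} \<union> {S. card S < Suc a})"
  proof (rule measure_pmf.finite_measure_mono_AE)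
    show "AE S in rsub ?E p. S \<in> {S. wsat (?V, S) (star_graph (Suc r)) = a} \<longrightarrow>
        S \<in> {S. \<exists>v\<in>?V. 3 \<le> card {e \<in> S. v \<in> e}} \<union> {S. card S < Suc a}"
      unfolding AE_measure_pmf_iff
    proof (intro ballI impI)
      fix S assume S: "S \<in> set_pmf (rsub ?E p)" "S \<in> {S. wsat (?V, S) (star_graph (Suc r)) = a}"
      then have SE: "S \<subseteq> ?E" using set_pmf_rsub[of ?E p] by auto
      obtain F where F: "weakly_saturated (?V, S) (star_graph (Suc r)) F" "card (edges F) = a"
        using S obtain_weakly_saturated_wsat[of "(?V, S)" "star_graph (Suc r)"] by auto
      show "S \<in> {S. \<exists>v\<in>?V. 3 \<le> card {e \<in> S. v \<in> e}} \<union> {S. card S < Suc a}"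
      proof (cases "\<exists>v\<in>?V. 3 \<le> card {e \<in> S. v \<in> e}")
        case False
        have "card {e \<in> S. v \<in> e} \<le> r" if "v \<in> ?V" for v
        proof -
          have "\<not> 3 \<le> card {e \<in> S. v \<in> e}" using False that by blast
          then show ?thesis using r by linarith
        qed
        then have "edges F = S" using weakly_saturated_star_trivial[OF _ _ F(1)] SE by simp
        then show ?thesis using F(2) by simp
      qed simp
    qed
  qed simp
  also have "\<dots> \<le> measure_pmf.prob (rsub ?E p) {S. \<exists>v\<in>?V. 3 \<le> card {e \<in> S. v \<in> e}} +
      measure_pmf.prob (rsub ?E p) {S. card S < Suc a}"
    by (intro measure_Un_le) auto
  also have "\<dots> \<le> real n powr (- 1 / 2) + real (Suc a) * exp (1 - p * (real n)\<^sup>2 / (4 * real (Suc a)))"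
  proof (intro add_mono)
    have "real (n choose 3) \<le> real n ^ 3"
    proof (cases "3 \<le> n")
      case True
      then show ?thesis using of_nat_mono[OF binomial_le_pow[of 3 n], where 'a = real] by simp
    qed (simp add: binomial_eq_0)
    then have "real n * real (n choose 3) * p ^ 3 \<le> real n * real n ^ 3 * (real n powr (- 3 / 2)) ^ 3"
      using p by (intro mult_mono power_mono) auto
    also have "\<dots> = real n powr (4 + (- 3 / 2) * 3)"
    proof -
      have "(real n powr (- 3 / 2)) ^ 3 = real n powr ((- 3 / 2) * 3)"
        using n by (subst powr_powr[symmetric]) (simp add: powr_realpow)
      moreover have "real n * real n ^ 3 = real n powr 4"
        using n by (simp flip: power_Suc)
      ultimately show ?thesis by (simp only: powr_add)
    qed
    finally have "real n * real (n choose 3) * p ^ 3 \<le> real n powr (- 1 / 2)" by simp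
    then show "measure_pmf.prob (rsub ?E p) {S. \<exists>v\<in>?V. 3 \<le> card {e \<in> S. v \<in> e}} \<le> real n powr (- 1 / 2)"
      using prob_large_degree_le[of ?V p 3] p p1 by simp
    \<comment> \<open>The pairs are split into \<open>Suc a\<close> blocks of l; rounding loses less
      than one pair per block, which becomes the 1 in the exponent because p \<le> 1.\<close>
    define l where "l = (n choose 2) div Suc a"
    have l: "Suc a * l \<le> n choose 2" "n choose 2 < Suc a * l + Suc a"
      unfolding l_def using mod_less_divisor[of "Suc a" "n choose 2"] mult_div_mod_eq[of "Suc a" "n choose 2"] by linarith+
    have "(real n)\<^sup>2 / 4 \<le> real (Suc a * l + Suc a)"
      using real_choose_two_ge[OF n] of_nat_mono[OF less_imp_le[OF l(2)], where 'a = real] by linarith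
    then have "(real n)\<^sup>2 / (4 * real (Suc a)) \<le> real l + 1" by (simp add: field_simps)
    then have "p * ((real n)\<^sup>2 / (4 * real (Suc a))) \<le> p * (real l + 1)" using p by (intro mult_left_mono) auto
    then have pl: "p * (real n)\<^sup>2 / (4 * real (Suc a)) - 1 \<le> p * real l" using p1 by (simp add: algebra_simps)
    have "(1 - p) ^ l \<le> exp (- p) ^ l" using p1 exp_ge_add_one_self[of "- p"] by (intro power_mono) auto
    also have "\<dots> = exp (- (p * real l))" by (simp add: mult.commute flip: exp_of_nat_mult)
    also have "\<dots> \<le> exp (1 - p * (real n)\<^sup>2 / (4 * real (Suc a)))" using pl by simp
    finally have "real (Suc a) * (1 - p) ^ l \<le> real (Suc a) * exp (1 - p * (real n)\<^sup>2 / (4 * real (Suc a)))"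
      by (intro mult_left_mono) auto
    moreover have "measure_pmf.prob (rsub ?E p) {S. card S < Suc a} \<le> real (Suc a) * (1 - p) ^ l"
      using l(1) by (intro prob_card_less_le finE p p1) simp
    ultimately show "measure_pmf.prob (rsub ?E p) {S. card S < Suc a} \<le>
        real (Suc a) * exp (1 - p * (real n)\<^sup>2 / (4 * real (Suc a)))"
      by linarith
  qed
  finally show ?thesis .
qed

text \<open>A cover of at most n / 2 vertices leaves at least n^2 / 16 pairs outside. For p \<ge>
  n^(-3/2) they are all absent with probability at most exp (- sqrt n / 16), which outweighs the exp
  (O((ln n)^2)) covers.\<close>

lemma prob_wsat_dense_le:
  fixes p :: real and n r :: nat
  defines "a \<equiv> Suc r choose 2"
  assumes r: "2 \<le> r" and L: "1 \<le> ln (real n)" "2 * real a \<le> ln (real n)" "2 * (2 * ln (real n) + real a) \<le> real n"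
      "16 \<le> real n"
    and p: "real n powr (- 3 / 2) \<le> p" "p \<le> exp (- (2 * real a + 3)) * threshold n (Suc r)" "p \<le> 1"
  shows "measure_pmf.prob (rsub (nsets {1..n} 2) p) {S. wsat ({1..n}, S) (star_graph (Suc r)) = a} \<le>
    1 / real n + exp ((2 * ln (real n) + real a) * ln (real n) - sqrt (real n) / 16)"
proof -
  let ?V = "{1..n}" let ?E = "nsets {1..n} 2"
  define k where "k = nat \<lceil>ln (real n)\<rceil>"
  have kL: "ln (real n) \<le> real k" "real k \<le> 2 * ln (real n)" using L(1) unfolding k_def by linarith+
  have "real (2 * (k + a)) \<le> real n" using kL L by simp
  then have k: "2 * a \<le> k" "2 * (k + a) \<le> n" using kL L by linarith+
  have p0: "0 \<le> p" using p(1) powr_ge_zero[of "real n" "- 3 / 2"] by linarith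
  have s: "0 < r * k - 2 * a"
  proof -
    have "2 * k \<le> r * k" using r by (rule mult_le_mono1)
    moreover have "0 < k" using kL L by linarith
    ultimately show ?thesis using k by linarith
  qed
  let ?A = "{S. \<exists>T\<subseteq>?V. card T = k \<and> r * k - 2 * a \<le> card (S \<inter> nsets T 2)}"
  let ?B = "{S. \<exists>B\<subseteq>?V. card B \<le> k + a \<and> (\<forall>e\<in>S. e \<inter> B \<noteq> {})}"
  have "measure_pmf.prob (rsub ?E p) {S. wsat (?V, S) (star_graph (Suc r)) = a} \<le>
      measure_pmf.prob (rsub ?E p) (?A \<union> ?B)"
  proof (rule measure_pmf.finite_measure_mono_AE)
    show "AE S in rsub ?E p. S \<in> {S. wsat (?V, S) (star_graph (Suc r)) = a} \<longrightarrow> S \<in> ?A \<union> ?B"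
      unfolding AE_measure_pmf_iff
    proof (intro ballI impI)
      fix S assume S: "S \<in> set_pmf (rsub ?E p)" "S \<in> {S. wsat (?V, S) (star_graph (Suc r)) = a}"
      then have SE: "S \<subseteq> ?E" using set_pmf_rsub[of ?E p] by auto
      obtain F where F: "weakly_saturated (?V, S) (star_graph (Suc r)) F" "card (edges F) = a"
        using S obtain_weakly_saturated_wsat[of "(?V, S)" "star_graph (Suc r)"] by auto
      from weakly_saturated_star_dense_or_cover[OF _ _ F(1), of k]
      have "(\<exists>T\<subseteq>?V. card T = k \<and> r * k \<le> 2 * a + card (S \<inter> nsets T 2)) \<or>
          (\<exists>B\<subseteq>?V. card B \<le> k + a \<and> (\<forall>e\<in>S. e \<inter> B \<noteq> {}))"
        using SE F(2) by simp
      then show "S \<in> ?A \<union> ?B"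
      proof
        assume "\<exists>T\<subseteq>?V. card T = k \<and> r * k \<le> 2 * a + card (S \<inter> nsets T 2)"
        then obtain T where "T \<subseteq> ?V" "card T = k" "r * k - 2 * a \<le> card (S \<inter> nsets T 2)"
          by (auto simp: le_diff_conv add.commute)
        then show ?thesis by blast
      qed blast
    qed
  qed simp
  also have "\<dots> \<le> measure_pmf.prob (rsub ?E p) ?A + measure_pmf.prob (rsub ?E p) ?B"
    by (intro measure_Un_le) auto
  also have "\<dots> \<le> 1 / real n + exp ((2 * ln (real n) + real a) * ln (real n) - sqrt (real n) / 16)"
  proof (intro add_mono)
    have "measure_pmf.prob (rsub ?E p) ?A \<le>
        real (n choose k) * real ((k choose 2) choose (r * k - 2 * a)) * p ^ (r * k - 2 * a)"
      using prob_dense_subset_le[of ?V p "r * k - 2 * a" k] p0 p(3) s by simp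
    also have "\<dots> \<le> 1 / real n" using dense_subset_bound_le[OF r k_def k(1) L(1) p0 p(2)] .
    finally show "measure_pmf.prob (rsub ?E p) ?A \<le> 1 / real n" .
    define l where "l = (n - (k + a)) choose 2"
    have "measure_pmf.prob (rsub ?E p) ?B \<le> real (n choose (k + a)) * (1 - p) ^ l"
      using prob_small_cover_le[of ?V p "k + a"] p0 p(3) k(2) by (simp add: l_def)
    also have "\<dots> \<le> exp ((2 * ln (real n) + real a) * ln (real n)) * exp (- (sqrt (real n) / 16))"
    proof (intro mult_mono)
      have "real (n choose (k + a)) \<le> real n ^ (k + a)"
        using of_nat_mono[OF binomial_le_pow[of "k + a" n], where 'a = real] k(2) by simp
      also have "\<dots> = exp (real (k + a) * ln (real n))"
        using L by (simp only: exp_of_nat_mult) simp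
      also have "\<dots> \<le> exp ((2 * ln (real n) + real a) * ln (real n))"
        using kL L by (simp add: mult_right_mono)
      finally show "real (n choose (k + a)) \<le> exp ((2 * ln (real n) + real a) * ln (real n))" .
      have "(real n / 2)\<^sup>2 / 4 \<le> (real (n - (k + a)))\<^sup>2 / 4"
        using k(2) by (intro divide_right_mono power_mono) auto
      also have "\<dots> \<le> real l"
        unfolding l_def using k(2) L(4) by (intro real_choose_two_ge) (simp add: le_diff_conv2)
      finally have l: "(real n)\<^sup>2 / 16 \<le> real l" by (simp add: power_divide)
      have "(1 - p) ^ l \<le> exp (- p) ^ l" using p(3) exp_ge_add_one_self[of "- p"] by (intro power_mono) auto
      also have "\<dots> = exp (- (p * real l))" by (simp add: mult.commute flip: exp_of_nat_mult)
      also have "\<dots> \<le> exp (- (sqrt (real n) / 16))"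
      proof -
        have "sqrt (real n) / 16 = real n powr (- 3 / 2) * ((real n)\<^sup>2 / 16)"
        proof -
          have "real n powr (- 3 / 2) * (real n)\<^sup>2 = real n powr (- 3 / 2 + 2)"
            unfolding powr_add using L(4) by simp
          also have "\<dots> = sqrt (real n)" by (simp add: powr_half_sqrt)
          finally show ?thesis by (simp only: times_divide_eq_right)
        qed
        also have "\<dots> \<le> p * real l" using p l p0 by (intro mult_mono) auto
        finally show ?thesis by simp
      qed
      finally show "(1 - p) ^ l \<le> exp (- (sqrt (real n) / 16))" .
    qed (use p in auto)
    also have "\<dots> = exp ((2 * ln (real n) + real a) * ln (real n) - sqrt (real n) / 16)"
      by (simp flip: exp_add)
    finally show "measure_pmf.prob (rsub ?E p) ?B \<le>
        exp ((2 * ln (real n) + real a) * ln (real n) - sqrt (real n) / 16)" .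
  qed
  finally show ?thesis .
qed

text \<open>The regimes are separated for each n, since p may alternate between them; the sum of
  both error terms bounds the failure in either case.\<close>

lemma whp_wsat_ne:
  fixes p :: "nat \<Rightarrow> real"
  assumes r: "2 \<le> r" and p: "\<And>n. 0 \<le> p n" "\<And>n. p n \<le> 1"
    and lower: "filterlim (\<lambda>n. p n * (real n)\<^sup>2) at_top sequentially"
    and upper: "\<forall>\<^sub>F n in sequentially. p n < exp (- (2 * real (Suc r choose 2) + 3)) * threshold n (Suc r)"
  shows "whp (\<lambda>n. random_graph n (p n))
    (\<lambda>n G. wsat G (star_graph (Suc r)) \<noteq> wsat (complete_graph_on n) (star_graph (Suc r)))"
proof (rule whpI)
  define a where "a = Suc r choose 2"
  define f1 where "f1 n = real n powr (- 1 / 2) + real (Suc a) * exp (1 - p n * (real n)\<^sup>2 / (4 * real (Suc a)))" for n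
  define f2 where "f2 n = 1 / real n + exp ((2 * ln (real n) + real a) * ln (real n) - sqrt (real n) / 16)" for n :: nat
  show "(\<lambda>n. f1 n + f2 n) \<longlonglongrightarrow> 0"
  proof (intro tendsto_add_zero)
    show "f2 \<longlonglongrightarrow> 0" unfolding f2_def by real_asymp
    have "filterlim (\<lambda>n. 1 / (4 * real (Suc a)) * (p n * (real n)\<^sup>2)) at_top sequentially"
      by (rule filterlim_tendsto_pos_mult_at_top[OF tendsto_const _ lower]) simp
    moreover have "((\<lambda>x::real. exp (1 - x)) \<longlongrightarrow> 0) at_top" by real_asymp
    ultimately have "(\<lambda>n. exp (1 - 1 / (4 * real (Suc a)) * (p n * (real n)\<^sup>2))) \<longlonglongrightarrow> 0"
      by (rule filterlim_compose[rotated])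
    then have "(\<lambda>n. real (Suc a) * exp (1 - p n * (real n)\<^sup>2 / (4 * real (Suc a)))) \<longlonglongrightarrow> 0"
      by (intro tendsto_mult_right_zero) simp
    moreover have "(\<lambda>n. real n powr (- 1 / 2)) \<longlonglongrightarrow> 0" by real_asymp
    ultimately show "f1 \<longlonglongrightarrow> 0" unfolding f1_def by (intro tendsto_add_zero)
  qed
  have ev: "\<forall>\<^sub>F n::nat in sequentially. 1 \<le> ln (real n)" "\<forall>\<^sub>F n::nat in sequentially. 2 * real a \<le> ln (real n)"
    "\<forall>\<^sub>F n::nat in sequentially. 2 * (2 * ln (real n) + real a) \<le> real n"
    by real_asymp+
  show "\<forall>\<^sub>F n in sequentially. measure_pmf.prob (rsub (nsets {1..n} 2) (p n))
      {S. \<not> wsat ({1..n}, S) (star_graph (Suc r)) \<noteq> wsat (complete_graph_on n) (star_graph (Suc r))} \<le> f1 n + f2 n"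
    using ev upper eventually_ge_at_top[of "Suc r + 2 * (Suc r choose 2)"] eventually_ge_at_top[of 16]
  proof eventually_elim
    case (elim n)
    have nonneg: "0 \<le> f1 n" "0 \<le> f2 n" by (auto simp: f1_def f2_def)
    have K: "wsat (complete_graph_on n) (star_graph (Suc r)) = a"
      unfolding a_def by (rule wsat_complete_graph_star[OF elim(5)])
    let ?P = "measure_pmf.prob (rsub (nsets {1..n} 2) (p n)) {S. wsat ({1..n}, S) (star_graph (Suc r)) = a}"
    have "?P \<le> f1 n" if "p n \<le> real n powr (- 3 / 2)"
      unfolding f1_def a_def using elim(6) by (intro prob_wsat_sparse_le r p(1) that) linarith
    moreover have "?P \<le> f2 n" if "real n powr (- 3 / 2) \<le> p n"
    proof -
      have "p n \<le> exp (- (2 * real a + 3)) * threshold n (Suc r)" "16 \<le> real n"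
        using elim(4,6) by (auto simp: a_def)
      then show ?thesis
        using that elim(1-3) p(2) unfolding f2_def a_def by (intro prob_wsat_dense_le r)
    qed
    ultimately have "?P \<le> f1 n + f2 n" using nonneg by linarith
    then show ?case unfolding K by simp
  qed
qed

theorem theorem2:
  fixes t :: nat
  assumes "t \<ge> 3"
  shows
    "(\<exists>c>0. \<forall>p :: nat \<Rightarrow> real.
        (\<forall>n. 0 \<le> p n \<and> p n \<le> 1) \<longrightarrow>
        filterlim (\<lambda>n. p n * (real n)\<^sup>2) at_top sequentially \<longrightarrow>
        (\<forall>\<^sub>F n in sequentially. p n < c * threshold n t) \<longrightarrow>
        whp (\<lambda>n. random_graph n (p n))
          (\<lambda>n G. wsat G (star_graph t) \<noteq> wsat (complete_graph_on n) (star_graph t))) \<and>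
     (\<exists>C>0. \<forall>p :: nat \<Rightarrow> real.
        (\<forall>n. 0 \<le> p n \<and> p n \<le> 1) \<longrightarrow>
        (\<forall>\<^sub>F n in sequentially. p n > C * threshold n t) \<longrightarrow>
        whp (\<lambda>n. random_graph n (p n))
          (\<lambda>n G. wsat G (star_graph t) = wsat (complete_graph_on n) (star_graph t)))"
proof -
  obtain r where t: "t = Suc r" and r: "2 \<le> r" using assms by (cases t) auto
  show ?thesis
    unfolding t
  proof
    show "\<exists>c>0. \<forall>p :: nat \<Rightarrow> real. (\<forall>n. 0 \<le> p n \<and> p n \<le> 1) \<longrightarrow>
        filterlim (\<lambda>n. p n * (real n)\<^sup>2) at_top sequentially \<longrightarrow>
        (\<forall>\<^sub>F n in sequentially. p n < c * threshold n (Suc r)) \<longrightarrow>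
        whp (\<lambda>n. random_graph n (p n))
          (\<lambda>n G. wsat G (star_graph (Suc r)) \<noteq> wsat (complete_graph_on n) (star_graph (Suc r)))"
      using whp_wsat_ne[OF r] by (intro exI[of _ "exp (- (2 * real (Suc r choose 2) + 3))"]) simp
    \<comment> \<open>C is twice the constant of the first graph, which leaves the second one at
      least the same density.\<close>
    have "0 < 2 * (4096 * real r * (real r + 2))" using r by simp
    then show "\<exists>C>0. \<forall>p :: nat \<Rightarrow> real. (\<forall>n. 0 \<le> p n \<and> p n \<le> 1) \<longrightarrow>
        (\<forall>\<^sub>F n in sequentially. p n > C * threshold n (Suc r)) \<longrightarrow>
        whp (\<lambda>n. random_graph n (p n))
          (\<lambda>n G. wsat G (star_graph (Suc r)) = wsat (complete_graph_on n) (star_graph (Suc r)))"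
      using whp_wsat_eq[OF r refl] by blast
  qed
qed

end
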